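(* Let $\mathcal B$ be a bicategory whose categories of 1-morphisms are idempotent complete, let $\mathcal B_{\mathrm{eq}}$ be its equivariant completion, and let $X\in\mathcal B(a,b)$ and $Y\in\mathcal B(b,a)$. (i) Suppose $X,Y$ form a biadjunction $Y\dashv X\dashv Y$, with adjunction maps $\varepsilon:Y\otimes X\to I_a$, $\eta:I_b\to X\otimes Y$ for $Y\dashv X$ and $\tilde\varepsilon:X\otimes Y\to I_b$, $\tilde\eta:I_a\to Y\otimes X$ for $X\dashv Y$, such that $\tilde\varepsilon\circ\eta$ is invertible. Then for $A=Y\otimes X$ there is an adjoint equivalence $X:(a,A)\rightleftarrows(b,I_b):Y$ in $\mathcal B_{\mathrm{eq}}$. (ii) Conversely, if we are given an adjoint equivalence $X:(a,A)\rightleftarrows(b,I_b):Y$ in $\mathcal B_{\mathrm{eq}}$, then there are adjunctions $Y\dashv X\dashv Y$ in $\mathcal B$ with $\tilde\varepsilon\circ\eta=1_{I_b}$, and $A\cong Y\otimes X$ as Frobenius algebras.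
   Context: Conventions: in a bicategory $\mathcal B$ the composite of $X\in\mathcal B(a,b)$ and $Y\in\mathcal B(b,c)$ is $Y\otimes X\in\mathcal B(a,c)$; $I_a$ is the unit 1-morphism; associators and unitors are suppressed. Algebras: an algebra in $\mathcal B(a,a)$ is $A$ with associative $\mu:A\otimes A\to A$ and unit $I_a\to A$; a coalgebra dually has $\Delta$ and a counit. $A$ with both is Frobenius if $(1_A\otimes\mu)(\Delta\otimes 1_A)=\Delta\mu=(\mu\otimes 1_A)(1_A\otimes\Delta)$, and separable if $\mu\Delta=1_A$. Modules, bimodules and (bi)module maps are defined as usual; for a right $A$-module $M$ and left $A$-module $N$, $M\otimes_AN$ is the coequaliser of the two action maps $M\otimes A\otimes N\rightrightarrows M\otimes N$. Equivariant completion $\mathcal B_{\mathrm{eq}}$: objects are pairs $(a,A)$ with $A\in\mathcal B(a,a)$ a separable Frobenius algebra; 1-morphisms $(a,A)\to(b,B)$ are $B$-$A$-bimodules in $\mathcal B(a,b)$; 2-morphisms are bimodule maps; composition of $X:(a,A)\to(b,B)$ and $Y:(b,B)\to(c,C)$ is $Y\otimes_BX$; the unit of $(a,A)$ is $A$. $I_b$ is a separable Frobenius algebra via the unit isomorphisms. The Frobenius algebra structure on $Y\otimes X$ for a biadjunction $Y\dashv X\dashv Y$: multiplication $1_Y\otimes\tilde\varepsilon\otimes1_X$, unit $\tilde\eta$, comultiplication $1_Y\otimes\eta\otimes1_X$, counit $\varepsilon$. It is separable if $\tilde\varepsilon\circ\eta=1_{I_b}$. In (i), where $\tilde\varepsilon\circ\eta$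 is only invertible, $\varepsilon,\eta$ are first replaced by $\varepsilon\circ(1_Y\otimes\varphi^{-1})$ and $(\varphi\otimes1_Y)\circ\eta$, where $\varphi:X\to X$ is $(\tilde\varepsilon\circ\eta)^{-1}\otimes1_X$ (under $I_b\otimes X\cong X$); with these maps $A=Y\otimes X$ is a separable Frobenius algebra. $X$ is a right $A$-module via $\tilde\varepsilon\otimes1_X$ and $Y$ is a left $A$-module via $1_Y\otimes\tilde\varepsilon$. *)

theory Defs
  imports Main
begin

section \<open>Bicategories\<close>

text \<open>
  Every 1-morphism and every 2-morphism determines its own source and target, so the operations
  need no index arguments.  They are only meaningful on (composable) elements of the carriers
  \<open>Obj\<close>, \<open>Mor\<close>, \<open>Cell\<close>.  For \<open>X \<in> \<B>(a,b)\<close> and \<open>Y \<in> \<B>(b,c)\<close> the composite is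
  written \<open>Y \<otimes> X\<close>; \<open>\<odot>\<close> is its action on 2-morphisms, and \<open>\<cdot>\<close> is vertical composition
  (\<open>g \<cdot> f\<close> means \<open>f\<close> first).  Associators and unitors are explicit:
  \<open>\<aa> Z Y X : (Z \<otimes> Y) \<otimes> X \<Rightarrow> Z \<otimes> (Y \<otimes> X)\<close>, \<open>\<ll> X : I \<otimes> X \<Rightarrow> X\<close>, \<open>\<rr> X : X \<otimes> I \<Rightarrow> X\<close>.
\<close>

record ('o, 'f, 'm) bicat =
  Obj :: "'o set"
  Mor :: "'f set"
  Cell :: "'m set"
  src :: "'f \<Rightarrow> 'o"
  trg :: "'f \<Rightarrow> 'o"
  dom2 :: "'m \<Rightarrow> 'f"
  cod2 :: "'m \<Rightarrow> 'f"
  ident2 :: "'f \<Rightarrow> 'm" (\<open>\<one>\<index>\<close>)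
  vcomp :: "'m \<Rightarrow> 'm \<Rightarrow> 'm" (infixr \<open>\<cdot>\<index>\<close> 55)
  unit1 :: "'o \<Rightarrow> 'f" (\<open>\<I>\<index>\<close>)
  tensor1 :: "'f \<Rightarrow> 'f \<Rightarrow> 'f" (infix \<open>\<otimes>\<index>\<close> 70)
  tensor2 :: "'m \<Rightarrow> 'm \<Rightarrow> 'm" (infix \<open>\<odot>\<index>\<close> 70)
  associator :: "'f \<Rightarrow> 'f \<Rightarrow> 'f \<Rightarrow> 'm" (\<open>\<aa>\<index>\<close>)
  lunitor :: "'f \<Rightarrow> 'm" (\<open>\<ll>\<index>\<close>)
  runitor :: "'f \<Rightarrow> 'm" (\<open>\<rr>\<index>\<close>)

definition hom1 :: "('o, 'f, 'm) bicat \<Rightarrow> 'o \<Rightarrow> 'o \<Rightarrow> 'f set" where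
  "hom1 B a b = {X \<in> Mor B. src B X = a \<and> trg B X = b}"

definition hom2 :: "('o, 'f, 'm) bicat \<Rightarrow> 'f \<Rightarrow> 'f \<Rightarrow> 'm set" where
  "hom2 B X Y = {f \<in> Cell B. dom2 B f = X \<and> cod2 B f = Y}"

definition inverse2 :: "('o, 'f, 'm) bicat \<Rightarrow> 'm \<Rightarrow> 'm \<Rightarrow> bool" where
  "inverse2 B f g \<longleftrightarrow>
     f \<in> hom2 B (dom2 B f) (cod2 B f) \<and> g \<in> hom2 B (cod2 B f) (dom2 B f) \<and>
     g \<cdot>\<^bsub>B\<^esub> f = \<one>\<^bsub>B\<^esub> (dom2 B f) \<and> f \<cdot>\<^bsub>B\<^esub> g = \<one>\<^bsub>B\<^esub> (cod2 B f)"

definition iso2 :: "('o, 'f, 'm) bicat \<Rightarrow> 'm \<Rightarrow> bool" where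
  "iso2 B f \<longleftrightarrow> (\<exists>g. inverse2 B f g)"

definition inv2 :: "('o, 'f, 'm) bicat \<Rightarrow> 'm \<Rightarrow> 'm" (\<open>inv2\<index>\<close>) where
  "inv2\<^bsub>B\<^esub> f = (THE g. inverse2 B f g)"

locale bicategory =
  fixes B :: "('o, 'f, 'm) bicat" (structure)
  assumes src_trg: "X \<in> Mor B \<Longrightarrow> src B X \<in> Obj B \<and> trg B X \<in> Obj B"
    and dom_cod: "f \<in> Cell B \<Longrightarrow> dom2 B f \<in> Mor B \<and> cod2 B f \<in> Mor B \<and>
      src B (dom2 B f) = src B (cod2 B f) \<and> trg B (dom2 B f) = trg B (cod2 B f)"
    \<comment> \<open>hom-categories\<close>
    and ident2_in: "X \<in> Mor B \<Longrightarrow> \<one> X \<in> hom2 B X X"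
    and vcomp_in: "\<lbrakk>f \<in> hom2 B X Y; g \<in> hom2 B Y Z\<rbrakk> \<Longrightarrow> g \<cdot> f \<in> hom2 B X Z"
    and vcomp_ident: "f \<in> hom2 B X Y \<Longrightarrow> f \<cdot> \<one> X = f"
    and ident_vcomp: "f \<in> hom2 B X Y \<Longrightarrow> \<one> Y \<cdot> f = f"
    and vcomp_assoc: "\<lbrakk>f \<in> hom2 B W X; g \<in> hom2 B X Y; h \<in> hom2 B Y Z\<rbrakk>
      \<Longrightarrow> (h \<cdot> g) \<cdot> f = h \<cdot> (g \<cdot> f)"
    \<comment> \<open>units and composition functors\<close>
    and unit1_in: "a \<in> Obj B \<Longrightarrow> \<I> a \<in> hom1 B a a"
    and tensor1_in: "\<lbrakk>X \<in> hom1 B a b; Y \<in> hom1 B b c\<rbrakk> \<Longrightarrow> Y \<otimes> X \<in> hom1 B a c"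
    and tensor2_in: "\<lbrakk>X \<in> hom1 B a b; Y \<in> hom1 B b c; f \<in> hom2 B X X'; g \<in> hom2 B Y Y'\<rbrakk>
      \<Longrightarrow> g \<odot> f \<in> hom2 B (Y \<otimes> X) (Y' \<otimes> X')"
    and tensor2_ident: "\<lbrakk>X \<in> hom1 B a b; Y \<in> hom1 B b c\<rbrakk> \<Longrightarrow> \<one> Y \<odot> \<one> X = \<one> (Y \<otimes> X)"
    and interchange: "\<lbrakk>X \<in> hom1 B a b; Y \<in> hom1 B b c;
        f \<in> hom2 B X X'; f' \<in> hom2 B X' X''; g \<in> hom2 B Y Y'; g' \<in> hom2 B Y' Y''\<rbrakk>
      \<Longrightarrow> (g' \<cdot> g) \<odot> (f' \<cdot> f) = (g' \<odot> f') \<cdot> (g \<odot> f)"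
    \<comment> \<open>associators and unitors\<close>
    and associator_in: "\<lbrakk>X \<in> hom1 B a b; Y \<in> hom1 B b c; Z \<in> hom1 B c d\<rbrakk>
      \<Longrightarrow> \<aa> Z Y X \<in> hom2 B ((Z \<otimes> Y) \<otimes> X) (Z \<otimes> (Y \<otimes> X))"
    and associator_iso: "\<lbrakk>X \<in> hom1 B a b; Y \<in> hom1 B b c; Z \<in> hom1 B c d\<rbrakk>
      \<Longrightarrow> iso2 B (\<aa> Z Y X)"
    and associator_natural: "\<lbrakk>X \<in> hom1 B a b; Y \<in> hom1 B b c; Z \<in> hom1 B c d;
        f \<in> hom2 B X X'; g \<in> hom2 B Y Y'; h \<in> hom2 B Z Z'\<rbrakk>
      \<Longrightarrow> \<aa> Z' Y' X' \<cdot> ((h \<odot> g) \<odot> f) = (h \<odot> (g \<odot> f)) \<cdot> \<aa> Z Y X"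
    and lunitor_in: "X \<in> hom1 B a b \<Longrightarrow> \<ll> X \<in> hom2 B (\<I> b \<otimes> X) X"
    and lunitor_iso: "X \<in> hom1 B a b \<Longrightarrow> iso2 B (\<ll> X)"
    and lunitor_natural: "\<lbrakk>X \<in> hom1 B a b; f \<in> hom2 B X X'\<rbrakk>
      \<Longrightarrow> \<ll> X' \<cdot> (\<one> (\<I> b) \<odot> f) = f \<cdot> \<ll> X"
    and runitor_in: "X \<in> hom1 B a b \<Longrightarrow> \<rr> X \<in> hom2 B (X \<otimes> \<I> a) X"
    and runitor_iso: "X \<in> hom1 B a b \<Longrightarrow> iso2 B (\<rr> X)"
    and runitor_natural: "\<lbrakk>X \<in> hom1 B a b; f \<in> hom2 B X X'\<rbrakk>
      \<Longrightarrow> \<rr> X' \<cdot> (f \<odot> \<one> (\<I> a)) = f \<cdot> \<rr> X"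
    and pentagon: "\<lbrakk>W \<in> hom1 B a b; X \<in> hom1 B b c; Y \<in> hom1 B c d; Z \<in> hom1 B d e\<rbrakk>
      \<Longrightarrow> (\<one> Z \<odot> \<aa> Y X W) \<cdot> \<aa> Z (Y \<otimes> X) W \<cdot> (\<aa> Z Y X \<odot> \<one> W)
          = \<aa> Z Y (X \<otimes> W) \<cdot> \<aa> (Z \<otimes> Y) X W"
    and triangle: "\<lbrakk>X \<in> hom1 B a b; Y \<in> hom1 B b c\<rbrakk>
      \<Longrightarrow> (\<one> Y \<odot> \<ll> X) \<cdot> \<aa> Y (\<I> b) X = \<rr> Y \<odot> \<one> X"

definition idempotent_complete :: "('o, 'f, 'm) bicat \<Rightarrow> bool" where
  "idempotent_complete B \<longleftrightarrow>
     (\<forall>X \<in> Mor B. \<forall>e \<in> hom2 B X X. e \<cdot>\<^bsub>B\<^esub> e = e \<longrightarrow>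
        (\<exists>Z \<in> Mor B. \<exists>r \<in> hom2 B X Z. \<exists>s \<in> hom2 B Z X.
           s \<cdot>\<^bsub>B\<^esub> r = e \<and> r \<cdot>\<^bsub>B\<^esub> s = \<one>\<^bsub>B\<^esub> Z))"

section \<open>Adjunctions\<close>

definition adjunction ::
    "('o, 'f, 'm) bicat \<Rightarrow> 'o \<Rightarrow> 'o \<Rightarrow> 'f \<Rightarrow> 'f \<Rightarrow> 'm \<Rightarrow> 'm \<Rightarrow> bool" where
  "adjunction B a b L R \<eta> \<epsilon> \<longleftrightarrow>
     L \<in> hom1 B a b \<and> R \<in> hom1 B b a \<and>
     \<eta> \<in> hom2 B (\<I>\<^bsub>B\<^esub> a) (R \<otimes>\<^bsub>B\<^esub> L) \<and> \<epsilon> \<in> hom2 B (L \<otimes>\<^bsub>B\<^esub> R) (\<I>\<^bsub>B\<^esub> b) \<and>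
     \<ll>\<^bsub>B\<^esub> L \<cdot>\<^bsub>B\<^esub> (\<epsilon> \<odot>\<^bsub>B\<^esub> \<one>\<^bsub>B\<^esub> L) \<cdot>\<^bsub>B\<^esub> inv2\<^bsub>B\<^esub> (\<aa>\<^bsub>B\<^esub> L R L) \<cdot>\<^bsub>B\<^esub> (\<one>\<^bsub>B\<^esub> L \<odot>\<^bsub>B\<^esub> \<eta>) = \<rr>\<^bsub>B\<^esub> L \<and>
     \<rr>\<^bsub>B\<^esub> R \<cdot>\<^bsub>B\<^esub> (\<one>\<^bsub>B\<^esub> R \<odot>\<^bsub>B\<^esub> \<epsilon>) \<cdot>\<^bsub>B\<^esub> \<aa>\<^bsub>B\<^esub> R L R \<cdot>\<^bsub>B\<^esub> (\<eta> \<odot>\<^bsub>B\<^esub> \<one>\<^bsub>B\<^esub> R) = \<ll>\<^bsub>B\<^esub> R"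

definition adjoint_equivalence ::
    "('o, 'f, 'm) bicat \<Rightarrow> 'o \<Rightarrow> 'o \<Rightarrow> 'f \<Rightarrow> 'f \<Rightarrow> 'm \<Rightarrow> 'm \<Rightarrow> bool" where
  "adjoint_equivalence B a b L R \<eta> \<epsilon> \<longleftrightarrow>
     adjunction B a b L R \<eta> \<epsilon> \<and> iso2 B \<eta> \<and> iso2 B \<epsilon>"

section \<open>Separable Frobenius algebras\<close>

definition algebra :: "('o, 'f, 'm) bicat \<Rightarrow> 'o \<Rightarrow> 'f \<Rightarrow> 'm \<Rightarrow> 'm \<Rightarrow> bool" where
  "algebra B a A m u \<longleftrightarrow>
     A \<in> hom1 B a a \<and> m \<in> hom2 B (A \<otimes>\<^bsub>B\<^esub> A) A \<and> u \<in> hom2 B (\<I>\<^bsub>B\<^esub> a) A \<and>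
     m \<cdot>\<^bsub>B\<^esub> (m \<odot>\<^bsub>B\<^esub> \<one>\<^bsub>B\<^esub> A) = m \<cdot>\<^bsub>B\<^esub> (\<one>\<^bsub>B\<^esub> A \<odot>\<^bsub>B\<^esub> m) \<cdot>\<^bsub>B\<^esub> \<aa>\<^bsub>B\<^esub> A A A \<and>
     m \<cdot>\<^bsub>B\<^esub> (u \<odot>\<^bsub>B\<^esub> \<one>\<^bsub>B\<^esub> A) = \<ll>\<^bsub>B\<^esub> A \<and>
     m \<cdot>\<^bsub>B\<^esub> (\<one>\<^bsub>B\<^esub> A \<odot>\<^bsub>B\<^esub> u) = \<rr>\<^bsub>B\<^esub> A"

definition coalgebra :: "('o, 'f, 'm) bicat \<Rightarrow> 'o \<Rightarrow> 'f \<Rightarrow> 'm \<Rightarrow> 'm \<Rightarrow> bool" where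
  "coalgebra B a A d e \<longleftrightarrow>
     A \<in> hom1 B a a \<and> d \<in> hom2 B A (A \<otimes>\<^bsub>B\<^esub> A) \<and> e \<in> hom2 B A (\<I>\<^bsub>B\<^esub> a) \<and>
     \<aa>\<^bsub>B\<^esub> A A A \<cdot>\<^bsub>B\<^esub> (d \<odot>\<^bsub>B\<^esub> \<one>\<^bsub>B\<^esub> A) \<cdot>\<^bsub>B\<^esub> d = (\<one>\<^bsub>B\<^esub> A \<odot>\<^bsub>B\<^esub> d) \<cdot>\<^bsub>B\<^esub> d \<and>
     \<ll>\<^bsub>B\<^esub> A \<cdot>\<^bsub>B\<^esub> (e \<odot>\<^bsub>B\<^esub> \<one>\<^bsub>B\<^esub> A) \<cdot>\<^bsub>B\<^esub> d = \<one>\<^bsub>B\<^esub> A \<and>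
     \<rr>\<^bsub>B\<^esub> A \<cdot>\<^bsub>B\<^esub> (\<one>\<^bsub>B\<^esub> A \<odot>\<^bsub>B\<^esub> e) \<cdot>\<^bsub>B\<^esub> d = \<one>\<^bsub>B\<^esub> A"

record ('f, 'm) frob =
  fcar :: 'f
  mult :: 'm
  unit :: 'm
  comult :: 'm
  counit :: 'm

definition frobenius :: "('o, 'f, 'm) bicat \<Rightarrow> 'o \<Rightarrow> ('f, 'm) frob \<Rightarrow> bool" where
  "frobenius B a F \<longleftrightarrow>
     (let A = fcar F; m = mult F; d = comult F in
        algebra B a A m (unit F) \<and> coalgebra B a A d (counit F) \<and>
        (\<one>\<^bsub>B\<^esub> A \<odot>\<^bsub>B\<^esub> m) \<cdot>\<^bsub>B\<^esub> \<aa>\<^bsub>B\<^esub> A A A \<cdot>\<^bsub>B\<^esub> (d \<odot>\<^bsub>B\<^esub> \<one>\<^bsub>B\<^esub> A) = d \<cdot>\<^bsub>B\<^esub> m \<and>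
        (m \<odot>\<^bsub>B\<^esub> \<one>\<^bsub>B\<^esub> A) \<cdot>\<^bsub>B\<^esub> inv2\<^bsub>B\<^esub> (\<aa>\<^bsub>B\<^esub> A A A) \<cdot>\<^bsub>B\<^esub> (\<one>\<^bsub>B\<^esub> A \<odot>\<^bsub>B\<^esub> d) = d \<cdot>\<^bsub>B\<^esub> m)"

definition separable_frobenius :: "('o, 'f, 'm) bicat \<Rightarrow> 'o \<Rightarrow> ('f, 'm) frob \<Rightarrow> bool" where
  "separable_frobenius B a F \<longleftrightarrow>
     frobenius B a F \<and> mult F \<cdot>\<^bsub>B\<^esub> comult F = \<one>\<^bsub>B\<^esub> (fcar F)"

definition frobenius_iso ::
    "('o, 'f, 'm) bicat \<Rightarrow> ('f, 'm) frob \<Rightarrow> ('f, 'm) frob \<Rightarrow> 'm \<Rightarrow> bool" where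
  "frobenius_iso B F G f \<longleftrightarrow>
     f \<in> hom2 B (fcar F) (fcar G) \<and> iso2 B f \<and>
     f \<cdot>\<^bsub>B\<^esub> mult F = mult G \<cdot>\<^bsub>B\<^esub> (f \<odot>\<^bsub>B\<^esub> f) \<and> f \<cdot>\<^bsub>B\<^esub> unit F = unit G \<and>
     (f \<odot>\<^bsub>B\<^esub> f) \<cdot>\<^bsub>B\<^esub> comult F = comult G \<cdot>\<^bsub>B\<^esub> f \<and> counit G \<cdot>\<^bsub>B\<^esub> f = counit F"

definition unit_frob :: "('o, 'f, 'm) bicat \<Rightarrow> 'o \<Rightarrow> ('f, 'm) frob" where
  "unit_frob B b =
     \<lparr>fcar = \<I>\<^bsub>B\<^esub> b, mult = \<ll>\<^bsub>B\<^esub> (\<I>\<^bsub>B\<^esub> b), unit = \<one>\<^bsub>B\<^esub> (\<I>\<^bsub>B\<^esub> b),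
      comult = inv2\<^bsub>B\<^esub> (\<ll>\<^bsub>B\<^esub> (\<I>\<^bsub>B\<^esub> b)), counit = \<one>\<^bsub>B\<^esub> (\<I>\<^bsub>B\<^esub> b)\<rparr>"

section \<open>Modules, bimodules and relative tensor products\<close>

definition left_module :: "('o, 'f, 'm) bicat \<Rightarrow> ('f, 'm) frob \<Rightarrow> 'f \<Rightarrow> 'm \<Rightarrow> bool" where
  "left_module B F N l \<longleftrightarrow>
     (let A = fcar F in
        l \<in> hom2 B (A \<otimes>\<^bsub>B\<^esub> N) N \<and>
        l \<cdot>\<^bsub>B\<^esub> (mult F \<odot>\<^bsub>B\<^esub> \<one>\<^bsub>B\<^esub> N) = l \<cdot>\<^bsub>B\<^esub> (\<one>\<^bsub>B\<^esub> A \<odot>\<^bsub>B\<^esub> l) \<cdot>\<^bsub>B\<^esub> \<aa>\<^bsub>B\<^esub> A A N \<and>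
        l \<cdot>\<^bsub>B\<^esub> (unit F \<odot>\<^bsub>B\<^esub> \<one>\<^bsub>B\<^esub> N) = \<ll>\<^bsub>B\<^esub> N)"

definition right_module :: "('o, 'f, 'm) bicat \<Rightarrow> ('f, 'm) frob \<Rightarrow> 'f \<Rightarrow> 'm \<Rightarrow> bool" where
  "right_module B F M r \<longleftrightarrow>
     (let A = fcar F in
        r \<in> hom2 B (M \<otimes>\<^bsub>B\<^esub> A) M \<and>
        r \<cdot>\<^bsub>B\<^esub> (r \<odot>\<^bsub>B\<^esub> \<one>\<^bsub>B\<^esub> A) = r \<cdot>\<^bsub>B\<^esub> (\<one>\<^bsub>B\<^esub> M \<odot>\<^bsub>B\<^esub> mult F) \<cdot>\<^bsub>B\<^esub> \<aa>\<^bsub>B\<^esub> M A A \<and>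
        r \<cdot>\<^bsub>B\<^esub> (\<one>\<^bsub>B\<^esub> M \<odot>\<^bsub>B\<^esub> unit F) = \<rr>\<^bsub>B\<^esub> M)"

text \<open>
  A bimodule records its source \<open>(a,A)\<close> and target \<open>(b,D)\<close>; it is then a \<open>D\<close>-\<open>A\<close>-bimodule
  in \<open>\<B>(a,b)\<close>.
\<close>

record ('o, 'f, 'm) bimod =
  bsrc :: "'o \<times> ('f, 'm) frob"
  btrg :: "'o \<times> ('f, 'm) frob"
  bcar :: 'f
  lact :: 'm
  ract :: 'm

abbreviation salg :: "('o, 'f, 'm) bimod \<Rightarrow> ('f, 'm) frob" where
  "salg X \<equiv> snd (bsrc X)"

abbreviation talg :: "('o, 'f, 'm) bimod \<Rightarrow> ('f, 'm) frob" where
  "talg X \<equiv> snd (btrg X)"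

definition bimodule :: "('o, 'f, 'm) bicat \<Rightarrow> ('o, 'f, 'm) bimod \<Rightarrow> bool" where
  "bimodule B X \<longleftrightarrow>
     bcar X \<in> hom1 B (fst (bsrc X)) (fst (btrg X)) \<and>
     left_module B (talg X) (bcar X) (lact X) \<and>
     right_module B (salg X) (bcar X) (ract X) \<and>
     ract X \<cdot>\<^bsub>B\<^esub> (lact X \<odot>\<^bsub>B\<^esub> \<one>\<^bsub>B\<^esub> (fcar (salg X))) =
       lact X \<cdot>\<^bsub>B\<^esub> (\<one>\<^bsub>B\<^esub> (fcar (talg X)) \<odot>\<^bsub>B\<^esub> ract X)
         \<cdot>\<^bsub>B\<^esub> \<aa>\<^bsub>B\<^esub> (fcar (talg X)) (bcar X) (fcar (salg X))"

definition bimodule_map ::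
    "('o, 'f, 'm) bicat \<Rightarrow> ('o, 'f, 'm) bimod \<Rightarrow> ('o, 'f, 'm) bimod \<Rightarrow> 'm \<Rightarrow> bool" where
  "bimodule_map B X X' f \<longleftrightarrow>
     bsrc X = bsrc X' \<and> btrg X = btrg X' \<and>
     f \<in> hom2 B (bcar X) (bcar X') \<and>
     f \<cdot>\<^bsub>B\<^esub> lact X = lact X' \<cdot>\<^bsub>B\<^esub> (\<one>\<^bsub>B\<^esub> (fcar (talg X)) \<odot>\<^bsub>B\<^esub> f) \<and>
     f \<cdot>\<^bsub>B\<^esub> ract X = ract X' \<cdot>\<^bsub>B\<^esub> (f \<odot>\<^bsub>B\<^esub> \<one>\<^bsub>B\<^esub> (fcar (salg X)))"

definition is_coequaliser :: "('o, 'f, 'm) bicat \<Rightarrow> 'm \<Rightarrow> 'm \<Rightarrow> 'm \<Rightarrow> bool" where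
  "is_coequaliser B f g q \<longleftrightarrow>
     (\<exists>P Q T. f \<in> hom2 B P Q \<and> g \<in> hom2 B P Q \<and> q \<in> hom2 B Q T \<and>
        q \<cdot>\<^bsub>B\<^esub> f = q \<cdot>\<^bsub>B\<^esub> g \<and>
        (\<forall>W h. h \<in> hom2 B Q W \<and> h \<cdot>\<^bsub>B\<^esub> f = h \<cdot>\<^bsub>B\<^esub> g \<longrightarrow>
           (\<exists>!k. k \<in> hom2 B T W \<and> k \<cdot>\<^bsub>B\<^esub> q = h)))"

text \<open>
  A chosen coequaliser \<open>q : M \<otimes> N \<Rightarrow> M \<otimes>\<^sub>A N\<close> of the two action maps
  \<open>(M \<otimes> A) \<otimes> N \<Rightarrow> M \<otimes> N\<close>.  It exists for \<open>A\<close> separable Frobenius if the hom-categories are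
  idempotent complete.
\<close>

definition rel_proj ::
    "('o, 'f, 'm) bicat \<Rightarrow> ('f, 'm) frob \<Rightarrow> 'f \<Rightarrow> 'm \<Rightarrow> 'f \<Rightarrow> 'm \<Rightarrow> 'm" where
  "rel_proj B F M r N l =
     (SOME q. is_coequaliser B (r \<odot>\<^bsub>B\<^esub> \<one>\<^bsub>B\<^esub> N) ((\<one>\<^bsub>B\<^esub> M \<odot>\<^bsub>B\<^esub> l) \<cdot>\<^bsub>B\<^esub> \<aa>\<^bsub>B\<^esub> M (fcar F) N) q)"

section \<open>The equivariant completion\<close>

record ('o, 'f, 'm) bimap =
  mdom :: "('o, 'f, 'm) bimod"
  mcod :: "('o, 'f, 'm) bimod"
  mcell :: 'm

definition bproj :: "('o, 'f, 'm) bicat \<Rightarrow> ('o, 'f, 'm) bimod \<Rightarrow> ('o, 'f, 'm) bimod \<Rightarrow> 'm" where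
  "bproj B Y X = rel_proj B (talg X) (bcar Y) (ract Y) (bcar X) (lact X)"

abbreviation bcar_comp ::
    "('o, 'f, 'm) bicat \<Rightarrow> ('o, 'f, 'm) bimod \<Rightarrow> ('o, 'f, 'm) bimod \<Rightarrow> 'f" where
  "bcar_comp B Y X \<equiv> cod2 B (bproj B Y X)"

text \<open>
  The definite descriptions below select the maps out of relative tensor products that are
  induced by the universal property of the coequaliser (coequalisers of this form are split,
  hence preserved by composition with 1-morphisms).
\<close>

definition bcomp ::
    "('o, 'f, 'm) bicat \<Rightarrow> ('o, 'f, 'm) bimod \<Rightarrow> ('o, 'f, 'm) bimod \<Rightarrow> ('o, 'f, 'm) bimod" where
  "bcomp B Y X =
     (let q = bproj B Y X; T = bcar_comp B Y X; C = fcar (talg Y); A = fcar (salg X) in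
      \<lparr>bsrc = bsrc X, btrg = btrg Y, bcar = T,
       lact = (THE l. l \<in> hom2 B (C \<otimes>\<^bsub>B\<^esub> T) T \<and>
          l \<cdot>\<^bsub>B\<^esub> (\<one>\<^bsub>B\<^esub> C \<odot>\<^bsub>B\<^esub> q) =
            q \<cdot>\<^bsub>B\<^esub> (lact Y \<odot>\<^bsub>B\<^esub> \<one>\<^bsub>B\<^esub> (bcar X)) \<cdot>\<^bsub>B\<^esub> inv2\<^bsub>B\<^esub> (\<aa>\<^bsub>B\<^esub> C (bcar Y) (bcar X))),
       ract = (THE r. r \<in> hom2 B (T \<otimes>\<^bsub>B\<^esub> A) T \<and>
          r \<cdot>\<^bsub>B\<^esub> (q \<odot>\<^bsub>B\<^esub> \<one>\<^bsub>B\<^esub> A) =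
            q \<cdot>\<^bsub>B\<^esub> (\<one>\<^bsub>B\<^esub> (bcar Y) \<odot>\<^bsub>B\<^esub> ract X) \<cdot>\<^bsub>B\<^esub> \<aa>\<^bsub>B\<^esub> (bcar Y) (bcar X) A)\<rparr>)"

definition bunit :: "'o \<times> ('f, 'm) frob \<Rightarrow> ('o, 'f, 'm) bimod" where
  "bunit p = \<lparr>bsrc = p, btrg = p, bcar = fcar (snd p), lact = mult (snd p), ract = mult (snd p)\<rparr>"

definition bcomp2 ::
    "('o, 'f, 'm) bicat \<Rightarrow> ('o, 'f, 'm) bimap \<Rightarrow> ('o, 'f, 'm) bimap \<Rightarrow> ('o, 'f, 'm) bimap" where
  "bcomp2 B g f =
     \<lparr>mdom = bcomp B (mdom g) (mdom f), mcod = bcomp B (mcod g) (mcod f),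
      mcell = (THE h. h \<in> hom2 B (bcar_comp B (mdom g) (mdom f)) (bcar_comp B (mcod g) (mcod f)) \<and>
         h \<cdot>\<^bsub>B\<^esub> bproj B (mdom g) (mdom f) =
           bproj B (mcod g) (mcod f) \<cdot>\<^bsub>B\<^esub> (mcell g \<odot>\<^bsub>B\<^esub> mcell f))\<rparr>"

definition bassoc ::
    "('o, 'f, 'm) bicat \<Rightarrow> ('o, 'f, 'm) bimod \<Rightarrow> ('o, 'f, 'm) bimod \<Rightarrow> ('o, 'f, 'm) bimod
      \<Rightarrow> ('o, 'f, 'm) bimap" where
  "bassoc B Z Y X =
     \<lparr>mdom = bcomp B (bcomp B Z Y) X, mcod = bcomp B Z (bcomp B Y X),
      mcell = (THE h.
         h \<in> hom2 B (bcar_comp B (bcomp B Z Y) X) (bcar_comp B Z (bcomp B Y X)) \<and>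
         h \<cdot>\<^bsub>B\<^esub> bproj B (bcomp B Z Y) X \<cdot>\<^bsub>B\<^esub> (bproj B Z Y \<odot>\<^bsub>B\<^esub> \<one>\<^bsub>B\<^esub> (bcar X)) =
           bproj B Z (bcomp B Y X) \<cdot>\<^bsub>B\<^esub> (\<one>\<^bsub>B\<^esub> (bcar Z) \<odot>\<^bsub>B\<^esub> bproj B Y X)
             \<cdot>\<^bsub>B\<^esub> \<aa>\<^bsub>B\<^esub> (bcar Z) (bcar Y) (bcar X))\<rparr>"

definition blunitor :: "('o, 'f, 'm) bicat \<Rightarrow> ('o, 'f, 'm) bimod \<Rightarrow> ('o, 'f, 'm) bimap" where
  "blunitor B X =
     \<lparr>mdom = bcomp B (bunit (btrg X)) X, mcod = X,
      mcell = (THE h. h \<in> hom2 B (bcar_comp B (bunit (btrg X)) X) (bcar X) \<and>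
         h \<cdot>\<^bsub>B\<^esub> bproj B (bunit (btrg X)) X = lact X)\<rparr>"

definition brunitor :: "('o, 'f, 'm) bicat \<Rightarrow> ('o, 'f, 'm) bimod \<Rightarrow> ('o, 'f, 'm) bimap" where
  "brunitor B X =
     \<lparr>mdom = bcomp B X (bunit (bsrc X)), mcod = X,
      mcell = (THE h. h \<in> hom2 B (bcar_comp B X (bunit (bsrc X))) (bcar X) \<and>
         h \<cdot>\<^bsub>B\<^esub> bproj B X (bunit (bsrc X)) = ract X)\<rparr>"

definition equivariant_completion ::
    "('o, 'f, 'm) bicat \<Rightarrow>
     ('o \<times> ('f, 'm) frob, ('o, 'f, 'm) bimod, ('o, 'f, 'm) bimap) bicat" where
  "equivariant_completion B =
     (let Ob = {(a, F). a \<in> Obj B \<and> separable_frobenius B a F};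
          Bim = {X. bsrc X \<in> Ob \<and> btrg X \<in> Ob \<and> bimodule B X}
      in \<lparr>Obj = Ob,
          Mor = Bim,
          Cell = {f. mdom f \<in> Bim \<and> mcod f \<in> Bim \<and> bimodule_map B (mdom f) (mcod f) (mcell f)},
          src = bsrc,
          trg = btrg,
          dom2 = mdom,
          cod2 = mcod,
          ident2 = (\<lambda>X. \<lparr>mdom = X, mcod = X, mcell = \<one>\<^bsub>B\<^esub> (bcar X)\<rparr>),
          vcomp = (\<lambda>g f. \<lparr>mdom = mdom f, mcod = mcod g, mcell = mcell g \<cdot>\<^bsub>B\<^esub> mcell f\<rparr>),
          unit1 = bunit,
          tensor1 = bcomp B,
          tensor2 = bcomp2 B,
          associator = bassoc B,
          lunitor = blunitor B,
          runitor = brunitor B\<rparr>)"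

section \<open>Biadjunctions\<close>

text \<open>
  For a biadjunction \<open>Y \<stileturn> X \<stileturn> Y\<close> (with \<open>\<epsilon>, \<eta>\<close> for \<open>Y \<stileturn> X\<close> and \<open>\<epsilon>t, \<eta>t\<close> for
  \<open>X \<stileturn> Y\<close>): the right action \<open>\<epsilon>t \<otimes> 1\<^sub>X\<close> of \<open>Y \<otimes> X\<close> on \<open>X\<close>, the left action
  \<open>1\<^sub>Y \<otimes> \<epsilon>t\<close> of \<open>Y \<otimes> X\<close> on \<open>Y\<close>, and the Frobenius structure on \<open>Y \<otimes> X\<close>.
\<close>

definition biadj_ract :: "('o, 'f, 'm) bicat \<Rightarrow> 'f \<Rightarrow> 'f \<Rightarrow> 'm \<Rightarrow> 'm" where
  "biadj_ract B X Y \<epsilon>t =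
     \<ll>\<^bsub>B\<^esub> X \<cdot>\<^bsub>B\<^esub> (\<epsilon>t \<odot>\<^bsub>B\<^esub> \<one>\<^bsub>B\<^esub> X) \<cdot>\<^bsub>B\<^esub> inv2\<^bsub>B\<^esub> (\<aa>\<^bsub>B\<^esub> X Y X)"

definition biadj_lact :: "('o, 'f, 'm) bicat \<Rightarrow> 'f \<Rightarrow> 'f \<Rightarrow> 'm \<Rightarrow> 'm" where
  "biadj_lact B X Y \<epsilon>t = \<rr>\<^bsub>B\<^esub> Y \<cdot>\<^bsub>B\<^esub> (\<one>\<^bsub>B\<^esub> Y \<odot>\<^bsub>B\<^esub> \<epsilon>t) \<cdot>\<^bsub>B\<^esub> \<aa>\<^bsub>B\<^esub> Y X Y"

definition biadj_frob ::
    "('o, 'f, 'm) bicat \<Rightarrow> 'f \<Rightarrow> 'f \<Rightarrow> 'm \<Rightarrow> 'm \<Rightarrow> 'm \<Rightarrow> 'm \<Rightarrow> ('f, 'm) frob" where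
  "biadj_frob B X Y \<epsilon> \<eta> \<epsilon>t \<eta>t =
     \<lparr>fcar = Y \<otimes>\<^bsub>B\<^esub> X,
      mult = (\<one>\<^bsub>B\<^esub> Y \<odot>\<^bsub>B\<^esub> (\<ll>\<^bsub>B\<^esub> X \<cdot>\<^bsub>B\<^esub> (\<epsilon>t \<odot>\<^bsub>B\<^esub> \<one>\<^bsub>B\<^esub> X) \<cdot>\<^bsub>B\<^esub> inv2\<^bsub>B\<^esub> (\<aa>\<^bsub>B\<^esub> X Y X)))
               \<cdot>\<^bsub>B\<^esub> \<aa>\<^bsub>B\<^esub> Y X (Y \<otimes>\<^bsub>B\<^esub> X),
      unit = \<eta>t,
      comult = inv2\<^bsub>B\<^esub> (\<aa>\<^bsub>B\<^esub> Y X (Y \<otimes>\<^bsub>B\<^esub> X))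
               \<cdot>\<^bsub>B\<^esub> (\<one>\<^bsub>B\<^esub> Y \<odot>\<^bsub>B\<^esub> (\<aa>\<^bsub>B\<^esub> X Y X \<cdot>\<^bsub>B\<^esub> (\<eta> \<odot>\<^bsub>B\<^esub> \<one>\<^bsub>B\<^esub> X) \<cdot>\<^bsub>B\<^esub> inv2\<^bsub>B\<^esub> (\<ll>\<^bsub>B\<^esub> X))),
      counit = \<epsilon>\<rparr>"

text \<open>The automorphism \<open>(\<epsilon>t \<cdot> \<eta>)\<^sup>-\<^sup>1 \<otimes> 1\<^sub>X\<close> of \<open>X\<close>, transported along \<open>I\<^sub>b \<otimes> X \<cong> X\<close>.\<close>

definition biadj_phi :: "('o, 'f, 'm) bicat \<Rightarrow> 'f \<Rightarrow> 'm \<Rightarrow> 'm \<Rightarrow> 'm" where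
  "biadj_phi B X \<eta> \<epsilon>t =
     \<ll>\<^bsub>B\<^esub> X \<cdot>\<^bsub>B\<^esub> (inv2\<^bsub>B\<^esub> (\<epsilon>t \<cdot>\<^bsub>B\<^esub> \<eta>) \<odot>\<^bsub>B\<^esub> \<one>\<^bsub>B\<^esub> X) \<cdot>\<^bsub>B\<^esub> inv2\<^bsub>B\<^esub> (\<ll>\<^bsub>B\<^esub> X)"

definition biadj_X :: "('o, 'f, 'm) bicat \<Rightarrow> 'o \<Rightarrow> 'o \<Rightarrow> ('f, 'm) frob \<Rightarrow> 'f \<Rightarrow> 'f \<Rightarrow> 'm
    \<Rightarrow> ('o, 'f, 'm) bimod" where
  "biadj_X B a b A X Y \<epsilon>t =
     \<lparr>bsrc = (a, A), btrg = (b, unit_frob B b), bcar = X,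
      lact = \<ll>\<^bsub>B\<^esub> X, ract = biadj_ract B X Y \<epsilon>t\<rparr>"

definition biadj_Y :: "('o, 'f, 'm) bicat \<Rightarrow> 'o \<Rightarrow> 'o \<Rightarrow> ('f, 'm) frob \<Rightarrow> 'f \<Rightarrow> 'f \<Rightarrow> 'm
    \<Rightarrow> ('o, 'f, 'm) bimod" where
  "biadj_Y B a b A X Y \<epsilon>t =
     \<lparr>bsrc = (b, unit_frob B b), btrg = (a, A), bcar = Y,
      lact = biadj_lact B X Y \<epsilon>t, ract = \<rr>\<^bsub>B\<^esub> Y\<rparr>"

end

theory Submission
  imports Defs
begin

text \<open>
  Coherence is removed by a Cayley-type strictification: a 2-cell \<open>f : X \<Rightarrow> X'\<close> is replaced by the
  family of cells \<open>X \<otimes> Z \<Rightarrow> X' \<otimes> Z\<close> that it induces for all \<open>Z\<close>, where tensor products are read as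
  words acting letter by letter.  Associators and unitors become identities, \<open>f\<close> is recovered from
  \<open>Z = I\<close>, and equations of 2-cells become equations of string diagrams.

  For a separable Frobenius algebra \<open>A\<close>, inserting \<open>\<Delta> \<circ> u\<close> between \<open>M\<close> and \<open>N\<close> and letting the two legs
  act is an idempotent of \<open>M \<otimes> N\<close> which coequalises the two actions; so every chosen coequaliser is
  split by it.  Hence the structure maps of the equivariant completion can be compared after
  precomposition with the split projections, and the zigzag equations of
  \<open>X : (a,A) \<rightleftharpoons> (b,I) : Y\<close> turn into \<open>(\<epsilon>t \<otimes> X)(X \<otimes> f) = ract X\<close> and \<open>(Y \<otimes> \<epsilon>t)(f \<otimes> Y) = lact Y\<close>, where
  \<open>f : A \<Rightarrow> Y \<otimes> X\<close> is the unit and \<open>\<epsilon>t : X \<otimes> Y \<Rightarrow> I\<close> the counit, both read without projections.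

  In (i) one takes \<open>f = 1\<close>; the counit is invertible because \<open>\<epsilon>t\<close>, split by \<open>\<eta>\<close>, is itself a coequaliser
  of the two actions.  In (ii) \<open>f\<close> is an isomorphism of algebras and \<open>\<eta>\<close> is the section of \<open>\<epsilon>t\<close> whose
  composite \<open>\<eta> \<circ> \<epsilon>t\<close> is the idempotent; the Frobenius relation then identifies the comultiplication
  with \<open>Y \<otimes> \<eta> \<otimes> X\<close>, and counitality gives the zigzags of \<open>Y \<stileturn> X\<close> after cancelling split
  epimorphisms.
\<close>

section \<open>Bicategory calculus\<close>

text \<open>The completion is built from choices and descriptions: \<open>bproj\<close> is some
  coequaliser, and the induced actions, horizontal composites, associators and unitors are
  \<open>THE\<close> of a factorisation. Nothing can be said about such a map before existence and
  uniqueness of the factorisation are known, also after tensoring with further 1-morphisms, where a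
  coequaliser need not stay one. Split epimorphisms do stay epic; this is why the splitting, and not
  the bare universal property, carries the proof. A second obstacle is the number of typing side
  conditions in diagrams with several strands. Composition and whiskering of strict cells are
  therefore total, with a junk value for ill-typed input, so that associativity, distributivity of
  whiskering and interchange hold without hypotheses on the surrounding words and can be used for
  rewriting anywhere in a diagram. For the same reason most strict equations are stated for all
  whiskers \<open>w\<close> and \<open>v\<close>.\<close>

context bicategory begin

lemma Cell_hom2: "f \<in> Cell B \<Longrightarrow> f \<in> hom2 B (dom2 B f) (cod2 B f)"
  by (simp add: hom2_def)

lemma hom2_Mor:
  assumes "f \<in> hom2 B X Y"
  shows "X \<in> Mor B" "Y \<in> Mor B" "src B Y = src B X" "trg B Y = trg B X"
  using dom_cod[of f] assms by (auto simp: hom2_def)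

lemma dom2_typ [simp]:
  assumes "f \<in> Cell B"
  shows "dom2 B f \<in> Mor B" "cod2 B f \<in> Mor B"
    "src B (cod2 B f) = src B (dom2 B f)" "trg B (cod2 B f) = trg B (dom2 B f)"
  using dom_cod[OF assms] by auto

lemma src_typ [simp]:
  assumes "X \<in> Mor B" shows "src B X \<in> Obj B" "trg B X \<in> Obj B"
  using src_trg[OF assms] by auto

lemma ident2_typ [simp]:
  assumes "X \<in> Mor B" shows "\<one> X \<in> Cell B" "dom2 B (\<one> X) = X" "cod2 B (\<one> X) = X"
  using ident2_in[OF assms] by (auto simp: hom2_def)

lemma unit1_typ [simp]:
  assumes "a \<in> Obj B" shows "\<I> a \<in> Mor B" "src B (\<I> a) = a" "trg B (\<I> a) = a"
  using unit1_in[OF assms] by (auto simp: hom1_def)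

lemma tensor1_typ [simp]:
  assumes "X \<in> Mor B" "Y \<in> Mor B" "src B Y = trg B X"
  shows "Y \<otimes> X \<in> Mor B" "src B (Y \<otimes> X) = src B X" "trg B (Y \<otimes> X) = trg B Y"
  using tensor1_in[of X "src B X" "trg B X" Y "trg B Y"] assms by (auto simp: hom1_def)

lemma vcomp_typ [simp]:
  assumes "f \<in> Cell B" "g \<in> Cell B" "dom2 B g = cod2 B f"
  shows "g \<cdot> f \<in> Cell B" "dom2 B (g \<cdot> f) = dom2 B f" "cod2 B (g \<cdot> f) = cod2 B g"
  using vcomp_in[of f "dom2 B f" "cod2 B f" g "cod2 B g"] assms by (auto simp: hom2_def)

lemma tensor2_typ [simp]:
  assumes "f \<in> Cell B" "g \<in> Cell B" "src B (dom2 B g) = trg B (dom2 B f)"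
  shows "g \<odot> f \<in> Cell B" "dom2 B (g \<odot> f) = dom2 B g \<otimes> dom2 B f"
    "cod2 B (g \<odot> f) = cod2 B g \<otimes> cod2 B f"
  using tensor2_in[of "dom2 B f" "src B (dom2 B f)" "trg B (dom2 B f)" "dom2 B g" "trg B (dom2 B g)"
      f "cod2 B f" g "cod2 B g"] assms by (auto simp: hom1_def hom2_def)

lemma vcomp_id [simp]:
  assumes "f \<in> Cell B"
  shows "X = dom2 B f \<Longrightarrow> f \<cdot> \<one> X = f" "X = cod2 B f \<Longrightarrow> \<one> X \<cdot> f = f"
  using vcomp_ident[OF Cell_hom2] ident_vcomp[OF Cell_hom2] assms by auto

lemma vcomp_assoc_cell:
  assumes "f \<in> Cell B" "g \<in> Cell B" "h \<in> Cell B" "dom2 B g = cod2 B f" "dom2 B h = cod2 B g"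
  shows "(h \<cdot> g) \<cdot> f = h \<cdot> (g \<cdot> f)"
  using vcomp_assoc[of f "dom2 B f" "cod2 B f" g "cod2 B g" h "cod2 B h"] assms
  by (auto simp: hom2_def)

lemma tensor_id [simp]:
  assumes "X \<in> Mor B" "Y \<in> Mor B" "src B Y = trg B X"
  shows "\<one> Y \<odot> \<one> X = \<one> (Y \<otimes> X)"
  using tensor2_ident[of X "src B X" "trg B X" Y "trg B Y"] assms by (auto simp: hom1_def)

lemma tensor_comp:
  assumes "f \<in> Cell B" "f' \<in> Cell B" "g \<in> Cell B" "g' \<in> Cell B"
    "dom2 B f' = cod2 B f" "dom2 B g' = cod2 B g" "src B (dom2 B g) = trg B (dom2 B f)"
  shows "(g' \<odot> f') \<cdot> (g \<odot> f) = (g' \<cdot> g) \<odot> (f' \<cdot> f)"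
  using interchange[of "dom2 B f" "src B (dom2 B f)" "trg B (dom2 B f)" "dom2 B g" "trg B (dom2 B g)"
      f "cod2 B f" f' "cod2 B f'" g "cod2 B g" g' "cod2 B g'"] assms
  by (auto simp: hom1_def hom2_def)

lemma inverse2_unique:
  assumes "inverse2 B f g" "inverse2 B f h" shows "g = h"
proof -
  have c: "f \<in> Cell B" "g \<in> Cell B" "h \<in> Cell B" "dom2 B g = cod2 B f" "dom2 B h = cod2 B f"
    "cod2 B g = dom2 B f" "cod2 B h = dom2 B f"
    using assms by (auto simp: inverse2_def hom2_def)
  have e: "h \<cdot> f = \<one> (dom2 B f)" "f \<cdot> g = \<one> (cod2 B f)"
    using assms by (auto simp: inverse2_def)
  have "g = (h \<cdot> f) \<cdot> g" using c unfolding e by simp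
  also have "\<dots> = h" using c vcomp_assoc_cell[of g f h] by (simp add: e(2))
  finally show ?thesis .
qed

lemma inv2_eqI: "inverse2 B f g \<Longrightarrow> inv2 f = g"
  unfolding inv2_def by (rule the_equality) (auto intro: inverse2_unique)

lemma inverse2_inv2: "iso2 B f \<Longrightarrow> inverse2 B f (inv2 f)"
  by (auto simp: iso2_def inv2_eqI)

lemma iso2_Cell: "iso2 B f \<Longrightarrow> f \<in> Cell B"
  by (auto simp: iso2_def inverse2_def hom2_def)

lemma inv2_typ [simp]:
  assumes "iso2 B f"
  shows "inv2 f \<in> Cell B" "dom2 B (inv2 f) = cod2 B f" "cod2 B (inv2 f) = dom2 B f"
  using inverse2_inv2[OF assms] by (auto simp: inverse2_def hom2_def)

lemma inv2_comp [simp]: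
  assumes "iso2 B f"
  shows "inv2 f \<cdot> f = \<one> (dom2 B f)" "f \<cdot> inv2 f = \<one> (cod2 B f)"
  using inverse2_inv2[OF assms] by (auto simp: inverse2_def hom2_def)

lemma inv2_comp_left [simp]:
  assumes "iso2 B f" "g \<in> Cell B"
  shows "cod2 B g = dom2 B f \<Longrightarrow> inv2 f \<cdot> (f \<cdot> g) = g" "cod2 B g = cod2 B f \<Longrightarrow> f \<cdot> (inv2 f \<cdot> g) = g"
  using assms by (simp_all add: iso2_Cell flip: vcomp_assoc_cell)

lemma iso2_cancel_right:
  assumes "iso2 B f" "g \<in> Cell B" "h \<in> Cell B" "dom2 B g = cod2 B f" "dom2 B h = cod2 B f"
    "g \<cdot> f = h \<cdot> f"
  shows "g = h"
proof -
  have "g = (g \<cdot> f) \<cdot> inv2 f" using assms(1-5) by (simp add: vcomp_assoc_cell iso2_Cell)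
  also have "\<dots> = h" using assms by (simp add: vcomp_assoc_cell iso2_Cell)
  finally show ?thesis .
qed

lemma inverse2_sym: "inverse2 B f g \<Longrightarrow> inverse2 B g f"
  by (auto simp: inverse2_def hom2_def)

lemma assoc_typ [simp]:
  assumes "X \<in> Mor B" "Y \<in> Mor B" "Z \<in> Mor B" "src B Y = trg B X" "src B Z = trg B Y"
  shows "\<aa> Z Y X \<in> Cell B" "dom2 B (\<aa> Z Y X) = (Z \<otimes> Y) \<otimes> X" "cod2 B (\<aa> Z Y X) = Z \<otimes> (Y \<otimes> X)"
    "iso2 B (\<aa> Z Y X)"
  using associator_in[of X "src B X" "trg B X" Y "trg B Y" Z "trg B Z"]
    associator_iso[of X "src B X" "trg B X" Y "trg B Y" Z "trg B Z"] assms
  by (auto simp: hom1_def hom2_def)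

lemma assoc_nat:
  assumes "f \<in> Cell B" "g \<in> Cell B" "h \<in> Cell B"
    "src B (dom2 B g) = trg B (dom2 B f)" "src B (dom2 B h) = trg B (dom2 B g)"
    "X' = cod2 B f" "Y' = cod2 B g" "Z' = cod2 B h"
  shows "\<aa> Z' Y' X' \<cdot> ((h \<odot> g) \<odot> f) = (h \<odot> (g \<odot> f)) \<cdot> \<aa> (dom2 B h) (dom2 B g) (dom2 B f)"
  using associator_natural[of "dom2 B f" "src B (dom2 B f)" "trg B (dom2 B f)"
      "dom2 B g" "trg B (dom2 B g)" "dom2 B h" "trg B (dom2 B h)" f X' g Y' h Z'] assms
  by (auto simp: hom1_def hom2_def)

lemma lunit_typ [simp]:
  assumes "X \<in> Mor B"
  shows "\<ll> X \<in> Cell B" "dom2 B (\<ll> X) = \<I> (trg B X) \<otimes> X" "cod2 B (\<ll> X) = X" "iso2 B (\<ll> X)"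
  using lunitor_in[of X "src B X" "trg B X"] lunitor_iso[of X "src B X" "trg B X"] assms
  by (auto simp: hom1_def hom2_def)

lemma runit_typ [simp]:
  assumes "X \<in> Mor B"
  shows "\<rr> X \<in> Cell B" "dom2 B (\<rr> X) = X \<otimes> \<I> (src B X)" "cod2 B (\<rr> X) = X" "iso2 B (\<rr> X)"
  using runitor_in[of X "src B X" "trg B X"] runitor_iso[of X "src B X" "trg B X"] assms
  by (auto simp: hom1_def hom2_def)

lemma lunit_nat:
  assumes "f \<in> Cell B" "X = cod2 B f" "a = trg B (dom2 B f)"
  shows "\<ll> X \<cdot> (\<one> (\<I> a) \<odot> f) = f \<cdot> \<ll> (dom2 B f)"
  using lunitor_natural[of "dom2 B f" "src B (dom2 B f)" a f X] assms
  by (auto simp: hom1_def hom2_def)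

lemma runit_nat:
  assumes "f \<in> Cell B" "X = cod2 B f" "a = src B (dom2 B f)"
  shows "\<rr> X \<cdot> (f \<odot> \<one> (\<I> a)) = f \<cdot> \<rr> (dom2 B f)"
  using runitor_natural[of "dom2 B f" a "trg B (dom2 B f)" f X] assms
  by (auto simp: hom1_def hom2_def)

lemma pentagon_eq:
  assumes "W \<in> Mor B" "X \<in> Mor B" "Y \<in> Mor B" "Z \<in> Mor B"
    "src B X = trg B W" "src B Y = trg B X" "src B Z = trg B Y"
  shows "(\<one> Z \<odot> \<aa> Y X W) \<cdot> \<aa> Z (Y \<otimes> X) W \<cdot> (\<aa> Z Y X \<odot> \<one> W) = \<aa> Z Y (X \<otimes> W) \<cdot> \<aa> (Z \<otimes> Y) X W"
  using pentagon[of W "src B W" "trg B W" X "trg B X" Y "trg B Y" Z "trg B Z"] assms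
  by (auto simp: hom1_def)

lemma triangle_eq:
  assumes "X \<in> Mor B" "Y \<in> Mor B" "src B Y = trg B X" "b = trg B X"
  shows "(\<one> Y \<odot> \<ll> X) \<cdot> \<aa> Y (\<I> b) X = \<rr> Y \<odot> \<one> X"
  using triangle[of X "src B X" "trg B X" Y "trg B Y"] assms
  by (auto simp: hom1_def)

text \<open>Naturality of \<open>\<ll>\<close> exhibits \<open>f\<close> as
  \<open>\<one> (\<I> a) \<odot> f\<close> conjugated by isomorphisms. The identity
  \<open>lunit_tensor\<close> becomes accessible to the pentagon only after tensoring with such a
  unit.\<close>

lemma unit_tensor_faithful:
  assumes "f \<in> Cell B" "g \<in> Cell B" "dom2 B f = dom2 B g" "cod2 B f = cod2 B g" "a = trg B (dom2 B g)"
    "\<one> (\<I> a) \<odot> f = \<one> (\<I> a) \<odot> g"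
  shows "f = g"
proof -
  have "f \<cdot> \<ll> (dom2 B f) = \<ll> (cod2 B f) \<cdot> (\<one> (\<I> a) \<odot> f)"
    by (rule lunit_nat[symmetric]) (simp_all add: assms(1,3,5))
  also have "\<dots> = g \<cdot> \<ll> (dom2 B f)"
    unfolding assms(3,4,6) by (rule lunit_nat) (simp_all add: assms(2,5))
  finally show ?thesis
    by (rule iso2_cancel_right[rotated -1]) (simp_all add: assms(1-4))
qed

lemma tensor_unit_faithful:
  assumes "f \<in> Cell B" "g \<in> Cell B" "dom2 B f = dom2 B g" "cod2 B f = cod2 B g" "a = src B (dom2 B g)"
    "f \<odot> \<one> (\<I> a) = g \<odot> \<one> (\<I> a)"
  shows "f = g"
proof -
  have "f \<cdot> \<rr> (dom2 B f) = \<rr> (cod2 B f) \<cdot> (f \<odot> \<one> (\<I> a))"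
    by (rule runit_nat[symmetric]) (simp_all add: assms(1,3,5))
  also have "\<dots> = g \<cdot> \<rr> (dom2 B f)"
    unfolding assms(3,4,6) by (rule runit_nat) (simp_all add: assms(2,5))
  finally show ?thesis
    by (rule iso2_cancel_right[rotated -1]) (simp_all add: assms(1-4))
qed

lemma iso2I:
  assumes "f \<in> Cell B" "g \<in> Cell B" "dom2 B g = cod2 B f" "cod2 B g = dom2 B f"
    "g \<cdot> f = \<one> (dom2 B f)" "f \<cdot> g = \<one> (cod2 B f)"
  shows "iso2 B f"
  using assms by (auto simp: iso2_def inverse2_def hom2_def)

lemma iso2_tensor:
  assumes "iso2 B f" "iso2 B g" "src B (dom2 B g) = trg B (dom2 B f)"
  shows "iso2 B (g \<odot> f)"
  using assms by (intro iso2I[of _ "inv2 g \<odot> inv2 f"]) (simp_all add: iso2_Cell tensor_comp)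

lemma iso2_comp:
  assumes "iso2 B f" "iso2 B g" "dom2 B g = cod2 B f"
  shows "iso2 B (g \<cdot> f)"
  using assms by (intro iso2I[of _ "inv2 f \<cdot> inv2 g"]) (simp_all add: iso2_Cell vcomp_assoc_cell)

lemma iso2_ident: "X \<in> Mor B \<Longrightarrow> iso2 B (\<one> X)"
  by (intro iso2I[of _ "\<one> X"]) simp_all

text \<open>Kelly's classical consequence of pentagon and triangle. After tensoring with the unit
  and precomposing with associators, the pentagon for \<open>\<I>\<close>, \<open>\<I>\<close>,
  \<open>X\<close>, \<open>Z\<close> reduces both sides to triangles, and the isomorphisms
  cancel.\<close>

lemma lunit_tensor:
  assumes X: "X \<in> Mor B" "Z \<in> Mor B" "src B X = trg B Z" "a = trg B X"
  shows "\<ll> (X \<otimes> Z) \<cdot> \<aa> (\<I> a) X Z = \<ll> X \<odot> \<one> Z"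
proof (rule unit_tensor_faithful[where a = a])
  let ?I = "\<I> a"
  note t = X(1-3) X(4)
  have 1: "(\<one> ?I \<odot> (\<ll> (X \<otimes> Z) \<cdot> \<aa> ?I X Z)) \<cdot> (\<aa> ?I (?I \<otimes> X) Z \<cdot> (\<aa> ?I ?I X \<odot> \<one> Z))
     = (\<one> ?I \<odot> \<ll> (X \<otimes> Z)) \<cdot> ((\<one> ?I \<odot> \<aa> ?I X Z) \<cdot> \<aa> ?I (?I \<otimes> X) Z \<cdot> (\<aa> ?I ?I X \<odot> \<one> Z))"
    using t tensor_comp[of "\<aa> ?I X Z" "\<ll> (X \<otimes> Z)" "\<one> ?I" "\<one> ?I"] by (simp flip: vcomp_assoc_cell)
  also have "\<dots> = ((\<one> ?I \<odot> \<ll> (X \<otimes> Z)) \<cdot> \<aa> ?I ?I (X \<otimes> Z)) \<cdot> \<aa> (?I \<otimes> ?I) X Z"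
    using t by (simp add: pentagon_eq vcomp_assoc_cell)
  also have "\<dots> = \<aa> ?I X Z \<cdot> ((\<rr> ?I \<odot> \<one> X) \<odot> \<one> Z)"
    using t assoc_nat[of "\<one> Z" "\<one> X" "\<rr> ?I" Z X ?I] by (simp add: triangle_eq)
  also have "\<dots> = \<aa> ?I X Z \<cdot> ((\<one> ?I \<odot> \<ll> X) \<odot> \<one> Z) \<cdot> (\<aa> ?I ?I X \<odot> \<one> Z)"
    using t triangle_eq[of X ?I a] by (simp add: tensor_comp)
  also have "\<dots> = (\<one> ?I \<odot> (\<ll> X \<odot> \<one> Z)) \<cdot> (\<aa> ?I (?I \<otimes> X) Z \<cdot> (\<aa> ?I ?I X \<odot> \<one> Z))"
    using t assoc_nat[of "\<one> Z" "\<ll> X" "\<one> ?I" Z X ?I] by (simp flip: vcomp_assoc_cell)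
  finally have e: "(\<one> ?I \<odot> (\<ll> (X \<otimes> Z) \<cdot> \<aa> ?I X Z)) \<cdot> (\<aa> ?I (?I \<otimes> X) Z \<cdot> (\<aa> ?I ?I X \<odot> \<one> Z))
     = (\<one> ?I \<odot> (\<ll> X \<odot> \<one> Z)) \<cdot> (\<aa> ?I (?I \<otimes> X) Z \<cdot> (\<aa> ?I ?I X \<odot> \<one> Z))" .
  have i: "iso2 B (\<aa> ?I (?I \<otimes> X) Z \<cdot> (\<aa> ?I ?I X \<odot> \<one> Z))"
    using t by (intro iso2_comp iso2_tensor iso2_ident) simp_all
  show "\<one> ?I \<odot> (\<ll> (X \<otimes> Z) \<cdot> \<aa> ?I X Z) = \<one> ?I \<odot> (\<ll> X \<odot> \<one> Z)"
    by (rule iso2_cancel_right[OF i _ _ _ _ e]) (use t in simp_all)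
qed (use X in simp_all)

end

section \<open>Strict cells and whiskering\<close>

text \<open>\<open>Nul\<close> is the result of every ill-typed operation and is absorbing under
  composition. It makes composition and whiskering total functions whose laws carry no typing
  hypotheses. Source and target objects are stored because an empty word does not determine
  them.\<close>

datatype ('o, 'f, 'm) scell =
  Nul | SC (so: 'o) (tg: 'o) (dm: "'f list") (cd: "'f list") (fam: "'f \<Rightarrow> 'm")

context bicategory begin

text \<open>The leftmost letter is applied last, as in a composite formed with
  \<open>\<otimes>\<close>. Every object has its own empty path, which plays the part of the unit
  1-morphism.\<close>

primrec pth :: "'o \<Rightarrow> 'f list \<Rightarrow> 'o \<Rightarrow> bool" where
  "pth a [] c \<longleftrightarrow> a = c \<and> a \<in> Obj B"
| "pth a (Y # ws) c \<longleftrightarrow> Y \<in> Mor B \<and> trg B Y = c \<and> pth a ws (src B Y)"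

definition act :: "'f list \<Rightarrow> 'f \<Rightarrow> 'f" where
  "act ws Z = foldr (\<otimes>) ws Z"

definition act2 :: "'f list \<Rightarrow> 'm \<Rightarrow> 'm" where
  "act2 ws h = foldr (\<lambda>X k. \<one> X \<odot> k) ws h"

lemma act_simps [simp]:
  "act [] Z = Z" "act (X # ws) Z = X \<otimes> act ws Z" "act (ws @ vs) Z = act ws (act vs Z)"
  by (simp_all add: act_def)

lemma act2_simps [simp]:
  "act2 [] h = h" "act2 (X # ws) h = \<one> X \<odot> act2 ws h" "act2 (ws @ vs) h = act2 ws (act2 vs h)"
  by (simp_all add: act2_def)

lemma pth_append [simp]: "pth a (ws @ vs) c \<longleftrightarrow> (\<exists>b. pth b ws c \<and> pth a vs b)"
  by (induction ws arbitrary: c) (auto, (induction vs, auto)+)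

lemma pth_Obj: "pth a ws c \<Longrightarrow> a \<in> Obj B \<and> c \<in> Obj B"
  by (induction ws arbitrary: c) auto

lemma pth_unique_trg: "pth a ws b \<Longrightarrow> pth a ws c \<Longrightarrow> b = c"
  by (cases ws) auto

lemma pth_unique_src: "pth a ws c \<Longrightarrow> pth b ws c \<Longrightarrow> a = b"
  by (induction ws arbitrary: c) auto

lemma act_typ:
  assumes "pth a ws b" "Z \<in> Mor B" "trg B Z = a"
  shows "act ws Z \<in> Mor B \<and> src B (act ws Z) = src B Z \<and> trg B (act ws Z) = b"
  using assms by (induction ws arbitrary: b) auto

lemma act2_typ:
  assumes "pth a ws b" "h \<in> Cell B" "trg B (dom2 B h) = a"
  shows "act2 ws h \<in> Cell B \<and> dom2 B (act2 ws h) = act ws (dom2 B h) \<and>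
    cod2 B (act2 ws h) = act ws (cod2 B h)"
  using assms
proof (induction ws arbitrary: b)
  case (Cons X ws)
  then show ?case using act_typ[of a ws "src B X" "dom2 B h"] by auto
qed auto

lemma act2_comp:
  assumes "pth a ws b" "h \<in> Cell B" "k \<in> Cell B" "dom2 B k = cod2 B h" "trg B (dom2 B h) = a"
  shows "act2 ws (k \<cdot> h) = act2 ws k \<cdot> act2 ws h"
  using assms
proof (induction ws arbitrary: b)
  case (Cons X ws)
  then show ?case
    using act2_typ[of a ws "src B X" h] act2_typ[of a ws "src B X" k]
        act_typ[of a ws "src B X" "dom2 B h"]
    by (auto simp: tensor_comp)
qed auto

lemma act2_ident:
  assumes "pth a ws b" "Z \<in> Mor B" "trg B Z = a"
  shows "act2 ws (\<one> Z) = \<one> (act ws Z)"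
  using assms
proof (induction ws arbitrary: b)
  case (Cons X ws)
  then show ?case using act_typ[of a ws "src B X" Z] by auto
qed auto

text \<open>Naturality in \<open>Z\<close> is exactly what the interchange law will need. Outside
  its range the family is pinned to \<open>undefined\<close>, so that equality of strict cells can
  be tested on the relevant \<open>Z\<close> alone.\<close>

definition valid :: "('o, 'f, 'm) scell \<Rightarrow> bool" where
  "valid F \<longleftrightarrow> F \<noteq> Nul \<and> pth (so F) (dm F) (tg F) \<and> pth (so F) (cd F) (tg F) \<and>
     (\<forall>Z. if Z \<in> Mor B \<and> trg B Z = so F then fam F Z \<in> hom2 B (act (dm F) Z) (act (cd F) Z)
          else fam F Z = undefined) \<and>
     (\<forall>h \<in> Cell B. trg B (dom2 B h) = so F \<longrightarrow>
        fam F (cod2 B h) \<cdot> act2 (dm F) h = act2 (cd F) h \<cdot> fam F (dom2 B h))"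

definition mkfam :: "'o \<Rightarrow> ('f \<Rightarrow> 'm) \<Rightarrow> 'f \<Rightarrow> 'm" where
  "mkfam a \<phi> Z = (if Z \<in> Mor B \<and> trg B Z = a then \<phi> Z else undefined)"

definition scomp :: "('o, 'f, 'm) scell \<Rightarrow> ('o, 'f, 'm) scell \<Rightarrow> ('o, 'f, 'm) scell"
    (infixr \<open>\<star>\<close> 60) where
  "G \<star> F = (if valid G \<and> valid F \<and> so G = so F \<and> tg G = tg F \<and> dm G = cd F
     then SC (so F) (tg F) (dm F) (cd G) (mkfam (so F) (\<lambda>Z. fam G Z \<cdot> fam F Z)) else Nul)"

text \<open>
  Whiskering of \<open>F\<close> by the words \<open>rev w\<close> on the left and \<open>v\<close> on the right.  Both words are
  thus stored with the letter next to \<open>F\<close> first, so that nested whiskerings match by list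
  constructors alone.
\<close>

definition W :: "'f list \<Rightarrow> ('o, 'f, 'm) scell \<Rightarrow> 'f list \<Rightarrow> ('o, 'f, 'm) scell" where
  "W w F v = (if valid F \<and> (\<exists>a. pth a v (so F)) \<and> (\<exists>b. pth (tg F) (rev w) b)
     then SC (THE a. pth a v (so F)) (THE b. pth (tg F) (rev w) b) (rev w @ dm F @ v) (rev w @ cd F @ v)
        (mkfam (THE a. pth a v (so F)) (\<lambda>Z. act2 (rev w) (fam F (act v Z)))) else Nul)"

text \<open>The object \<open>a\<close> is an argument because the empty word has no source of its
  own.\<close>

definition idc :: "'f list \<Rightarrow> 'o \<Rightarrow> ('o, 'f, 'm) scell" where
  "idc ws a = (if \<exists>b. pth a ws b then SC a (THE b. pth a ws b) ws ws (mkfam a (\<lambda>Z. \<one> (act ws Z)))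
     else Nul)"

lemma the_src: "pth a v c \<Longrightarrow> (THE a. pth a v c) = a"
  by (rule the_equality) (auto dest: pth_unique_src)

lemma the_trg: "pth a v c \<Longrightarrow> (THE c. pth a v c) = c"
  by (rule the_equality) (auto dest: pth_unique_trg)

lemma not_valid_Nul [simp]: "\<not> valid Nul"
  by (simp add: valid_def)

lemma scomp_Nul [simp]: "Nul \<star> F = Nul" "F \<star> Nul = Nul"
  by (simp_all add: scomp_def)

lemma valid_fam:
  assumes "valid F" "Z \<in> Mor B" "trg B Z = so F"
  shows "fam F Z \<in> Cell B" "dom2 B (fam F Z) = act (dm F) Z" "cod2 B (fam F Z) = act (cd F) Z"
  using assms by (auto simp: valid_def hom2_def dest!: spec[of _ Z])

lemma valid_pth: "valid F \<Longrightarrow> pth (so F) (dm F) (tg F) \<and> pth (so F) (cd F) (tg F)"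
  by (simp add: valid_def)

lemma valid_nat:
  assumes "valid F" "h \<in> Cell B" "trg B (dom2 B h) = so F"
  shows "fam F (cod2 B h) \<cdot> act2 (dm F) h = act2 (cd F) h \<cdot> fam F (dom2 B h)"
  using assms by (auto simp: valid_def)

lemma valid_undef:
  assumes "valid F" "\<not> (Z \<in> Mor B \<and> trg B Z = so F)"
  shows "fam F Z = undefined"
  using assms by (auto simp: valid_def dest!: spec[of _ Z])

lemma validI:
  assumes "pth a ws b" "pth a vs b"
    "\<And>Z. Z \<in> Mor B \<Longrightarrow> trg B Z = a \<Longrightarrow>
       \<phi> Z \<in> Cell B \<and> dom2 B (\<phi> Z) = act ws Z \<and> cod2 B (\<phi> Z) = act vs Z"
    "\<And>h. h \<in> Cell B \<Longrightarrow> trg B (dom2 B h) = a \<Longrightarrow>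
        \<phi> (cod2 B h) \<cdot> act2 ws h = act2 vs h \<cdot> \<phi> (dom2 B h)"
  shows "valid (SC a b ws vs (mkfam a \<phi>))"
  using assms by (auto simp: valid_def mkfam_def hom2_def)

lemma scell_eqI:
  assumes "valid F" "valid G" "so F = so G" "tg F = tg G" "dm F = dm G" "cd F = cd G"
    "\<And>Z. Z \<in> Mor B \<Longrightarrow> trg B Z = so F \<Longrightarrow> fam F Z = fam G Z"
  shows "F = G"
proof -
  have "fam F = fam G"
  proof
    fix Z show "fam F Z = fam G Z"
      using assms valid_undef[OF assms(1), of Z] valid_undef[OF assms(2), of Z]
      by (cases "Z \<in> Mor B \<and> trg B Z = so F") auto
  qed
  then show ?thesis using assms by (cases F; cases G) auto
qed

lemma scomp_valid:
  "valid (G \<star> F) \<longleftrightarrow> valid G \<and> valid F \<and> so G = so F \<and> tg G = tg F \<and> dm G = cd F"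
proof (cases "valid G \<and> valid F \<and> so G = so F \<and> tg G = tg F \<and> dm G = cd F")
  case True
  then have "valid (SC (so F) (tg F) (dm F) (cd G) (mkfam (so F) (\<lambda>Z. fam G Z \<cdot> fam F Z)))"
  proof (intro validI)
    fix h assume h: "h \<in> Cell B" "trg B (dom2 B h) = so F"
    note t = valid_fam[of F "dom2 B h"] valid_fam[of F "cod2 B h"] valid_fam[of G "dom2 B h"]
      valid_fam[of G "cod2 B h"] act2_typ[of "so F" "cd F" "tg F" h] act2_typ[of "so F" "dm F" "tg F" h]
      act2_typ[of "so F" "cd G" "tg F" h]
    have "(fam G (cod2 B h) \<cdot> fam F (cod2 B h)) \<cdot> act2 (dm F) h
        = fam G (cod2 B h) \<cdot> (fam F (cod2 B h) \<cdot> act2 (dm F) h)"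
      using True h t valid_pth[of F] valid_pth[of G] by (intro vcomp_assoc_cell) auto
    also have "\<dots> = fam G (cod2 B h) \<cdot> (act2 (dm G) h \<cdot> fam F (dom2 B h))"
      using valid_nat[of F h] True h by simp
    also have "\<dots> = (fam G (cod2 B h) \<cdot> act2 (dm G) h) \<cdot> fam F (dom2 B h)"
      using True h t valid_pth[of F] valid_pth[of G] by (intro vcomp_assoc_cell[symmetric]) auto
    also have "\<dots> = (act2 (cd G) h \<cdot> fam G (dom2 B h)) \<cdot> fam F (dom2 B h)"
      using valid_nat[of G h] True h by simp
    also have "\<dots> = act2 (cd G) h \<cdot> (fam G (dom2 B h) \<cdot> fam F (dom2 B h))"
      using True h t valid_pth[of F] valid_pth[of G] by (intro vcomp_assoc_cell) auto
    finally show "(fam G (cod2 B h) \<cdot> fam F (cod2 B h)) \<cdot> act2 (dm F) h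
       = act2 (cd G) h \<cdot> fam G (dom2 B h) \<cdot> fam F (dom2 B h)" .
  qed (auto dest: valid_pth simp: valid_fam)
  then show ?thesis using True by (simp add: scomp_def)
qed (auto simp: scomp_def)

lemma scomp_sel:
  assumes "valid (G \<star> F)"
  shows "so (G \<star> F) = so F" "tg (G \<star> F) = tg F" "dm (G \<star> F) = dm F" "cd (G \<star> F) = cd G"
    "\<And>Z. Z \<in> Mor B \<Longrightarrow> trg B Z = so F \<Longrightarrow> fam (G \<star> F) Z = fam G Z \<cdot> fam F Z"
  using assms[unfolded scomp_valid] by (auto simp: scomp_def mkfam_def)

lemma not_valid_scomp: "\<not> valid (G \<star> F) \<Longrightarrow> G \<star> F = Nul"
  unfolding scomp_valid by (auto simp: scomp_def)

text \<open>If one bracketing is well typed then so is the other; otherwise both are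
  \<open>Nul\<close>. Hence no hypotheses.\<close>

lemma scomp_assoc: "(H \<star> G) \<star> F = H \<star> (G \<star> F)"
proof (cases "valid (H \<star> (G \<star> F))")
  case True
  then have v: "valid (G \<star> F)" by (simp add: scomp_valid)
  have v2: "valid (H \<star> G)" using True v scomp_sel[OF v] by (simp add: scomp_valid)
  have v3: "valid ((H \<star> G) \<star> F)" using v v2 scomp_sel[OF v2] by (simp add: scomp_valid)
  show ?thesis
  proof (rule scell_eqI[OF v3 True])
    fix Z assume "Z \<in> Mor B" "trg B Z = so ((H \<star> G) \<star> F)"
    then show "fam ((H \<star> G) \<star> F) Z = fam (H \<star> G \<star> F) Z"
      using v v2 v3 True unfolding scomp_valid
      by (simp add: scomp_sel scomp_valid vcomp_assoc_cell valid_fam)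
  qed (use v v2 v3 True in \<open>simp_all add: scomp_sel\<close>)
next
  case False
  have "\<not> valid ((H \<star> G) \<star> F)"
  proof
    assume a: "valid ((H \<star> G) \<star> F)"
    then have v2: "valid (H \<star> G)" by (simp add: scomp_valid)
    have v: "valid (G \<star> F)" using a v2 scomp_sel[OF v2] by (simp add: scomp_valid)
    have "valid (H \<star> (G \<star> F))" using v v2 scomp_sel[OF v] by (simp add: scomp_valid)
    then show False using False by simp
  qed
  then show ?thesis using False by (simp add: not_valid_scomp)
qed

lemma W_valid:
  "valid (W w F v) \<longleftrightarrow> valid F \<and> (\<exists>a. pth a v (so F)) \<and> (\<exists>b. pth (tg F) (rev w) b)"
proof (cases "valid F \<and> (\<exists>a. pth a v (so F)) \<and> (\<exists>b. pth (tg F) (rev w) b)")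
  case True
  then obtain a b where ab: "pth a v (so F)" "pth (tg F) (rev w) b" and F: "valid F" by auto
  have "valid (SC a b (rev w @ dm F @ v) (rev w @ cd F @ v)
     (mkfam a (\<lambda>Z. act2 (rev w) (fam F (act v Z)))))"
  proof (rule validI)
    show "pth a (rev w @ dm F @ v) b" "pth a (rev w @ cd F @ v) b"
      using ab valid_pth[OF F] by auto
  next
    fix Z assume "Z \<in> Mor B" "trg B Z = a"
    then show "act2 (rev w) (fam F (act v Z)) \<in> Cell B \<and>
         dom2 B (act2 (rev w) (fam F (act v Z))) = act (rev w @ dm F @ v) Z \<and>
         cod2 B (act2 (rev w) (fam F (act v Z))) = act (rev w @ cd F @ v) Z"
      using act_typ[OF ab(1), of Z] valid_fam[OF F, of "act v Z"] valid_pth[OF F]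
        act2_typ[OF ab(2), of "fam F (act v Z)"] act_typ[of "so F" "dm F" "tg F" "act v Z"] by auto
  next
    fix h assume h: "h \<in> Cell B" "trg B (dom2 B h) = a"
    note t = act2_typ[OF ab(1) h] act_typ[OF ab(1), of "dom2 B h"] act_typ[OF ab(1), of "cod2 B h"]
    note n = valid_nat[OF F, of "act2 v h"]
    note t2 = valid_fam[OF F, of "act v (dom2 B h)"] valid_fam[OF F, of "act v (cod2 B h)"]
      act2_typ[of "so F" "dm F" "tg F" "act2 v h"] act2_typ[of "so F" "cd F" "tg F" "act2 v h"]
      act_typ[of "so F" "dm F" "tg F" "act v (dom2 B h)"]
    have "act2 (rev w) (fam F (act v (cod2 B h)) \<cdot> act2 (dm F) (act2 v h))
       = act2 (rev w) (act2 (cd F) (act2 v h) \<cdot> fam F (act v (dom2 B h)))"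
      using n t h by simp
    then show "act2 (rev w) (fam F (act v (cod2 B h))) \<cdot> act2 (rev w @ dm F @ v) h
       = act2 (rev w @ cd F @ v) h \<cdot> act2 (rev w) (fam F (act v (dom2 B h)))"
      using t t2 h valid_pth[OF F]
        act2_comp[OF ab(2), of "act2 (dm F) (act2 v h)" "fam F (act v (cod2 B h))"]
        act2_comp[OF ab(2), of "fam F (act v (dom2 B h))" "act2 (cd F) (act2 v h)"] by simp
  qed
  then show ?thesis using True ab by (simp add: W_def the_src the_trg)
qed (auto simp: W_def)

lemma W_sel:
  assumes "valid F" "pth a v (so F)" "pth (tg F) (rev w) b"
  shows "so (W w F v) = a" "tg (W w F v) = b" "dm (W w F v) = rev w @ dm F @ v"
    "cd (W w F v) = rev w @ cd F @ v"
    "\<And>Z. Z \<in> Mor B \<Longrightarrow> trg B Z = a \<Longrightarrow> fam (W w F v) Z = act2 (rev w) (fam F (act v Z))"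
  using assms by (auto simp: W_def the_src the_trg mkfam_def)

lemma not_valid_W: "\<not> valid (W w F v) \<Longrightarrow> W w F v = Nul"
  unfolding W_valid by (auto simp: W_def)

text \<open>The inner words stand next to the cell and therefore come first in both
  concatenations.\<close>

lemma W_W: "W w (W w' F v') v = W (w' @ w) F (v' @ v)"
proof (cases "valid F \<and> (\<exists>a1 a2 b1 b2. pth a1 v' (so F) \<and> pth a2 v a1 \<and> pth (tg F) (rev w') b1
    \<and> pth b1 (rev w) b2)")
  case True
  then obtain a1 a2 b1 b2 where p: "valid F" "pth a1 v' (so F)" "pth a2 v a1" "pth (tg F) (rev w') b1"
    "pth b1 (rev w) b2" by auto
  have q: "valid (W w' F v')" using p by (auto simp: W_valid)
  note s = W_sel[OF p(1,2,4)]
  have q': "pth a2 v (so (W w' F v'))" "pth (tg (W w' F v')) (rev w) b2" using s p by auto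
  have r: "pth a2 (v' @ v) (so F)" "pth (tg F) (rev (w' @ w)) b2" using p by auto
  show ?thesis
  proof (rule scell_eqI)
    show "valid (W w (W w' F v') v)" using q' q by (auto simp: W_valid)
    show "valid (W (w' @ w) F (v' @ v))" using r p by (auto simp: W_valid)
    fix Z assume "Z \<in> Mor B" "trg B Z = so (W w (W w' F v') v)"
    then show "fam (W w (W w' F v') v) Z = fam (W (w' @ w) F (v' @ v)) Z"
      using W_sel[OF q q'] W_sel[OF p(1) r] s act_typ[of a2 v a1 Z] p by simp
  qed (use W_sel[OF q q'] W_sel[OF p(1) r] s in simp_all)
next
  case False
  have "\<not> valid (W w (W w' F v') v)"
  proof
    assume "valid (W w (W w' F v') v)"
    then obtain a2 b2 where 1: "valid (W w' F v')" "pth a2 v (so (W w' F v'))"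
        "pth (tg (W w' F v')) (rev w) b2"
      by (auto simp: W_valid)
    then obtain a1 b1 where 2: "valid F" "pth a1 v' (so F)" "pth (tg F) (rev w') b1"
        by (auto simp: W_valid)
    show False using W_sel[OF 2] 1 2 False by auto
  qed
  moreover have "\<not> valid (W (w' @ w) F (v' @ v))" using False by (auto simp: W_valid)
  ultimately show ?thesis by (simp add: not_valid_W)
qed

lemma W_scomp: "W w (G \<star> F) v = W w G v \<star> W w F v"
proof (cases "valid (G \<star> F) \<and> (\<exists>a. pth a v (so F)) \<and> (\<exists>b. pth (tg F) (rev w) b)")
  case True
  then obtain a b where p: "valid (G \<star> F)" "pth a v (so F)" "pth (tg F) (rev w) b" by auto
  note g = p(1)[unfolded scomp_valid] note s = scomp_sel[OF p(1)]
  have f: "valid F" "valid G" "pth a v (so G)" "pth (tg G) (rev w) b" using g p by auto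
  have p': "pth a v (so (G \<star> F))" "pth (tg (G \<star> F)) (rev w) b" using p s by auto
  note S = W_sel[OF p(1) p'] note SF = W_sel[OF f(1) p(2,3)] note SG = W_sel[OF f(2-4)]
  have v: "valid (W w G v)" "valid (W w F v)" using f p by (auto simp: W_valid)
  have V: "valid (W w G v \<star> W w F v)" using v g SF SG by (auto simp: scomp_valid)
  show ?thesis
  proof (rule scell_eqI)
    show "valid (W w (G \<star> F) v)" using p p' by (auto simp: W_valid)
    fix Z assume Z: "Z \<in> Mor B" "trg B Z = so (W w (G \<star> F) v)"
    have Z': "act v Z \<in> Mor B" "trg B (act v Z) = so F" using act_typ[of a v "so F" Z] S Z p by auto
    have "act2 (rev w) (fam G (act v Z) \<cdot> fam F (act v Z))
        = act2 (rev w) (fam G (act v Z)) \<cdot> act2 (rev w) (fam F (act v Z))"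
      using valid_fam[of F "act v Z"] valid_fam[of G "act v Z"] Z' g p
      by (intro act2_comp[OF p(3)]) (use act_typ[of "so F" "dm F" "tg F" "act v Z"] valid_pth[OF f(1)]
          in simp_all)
    then show "fam (W w (G \<star> F) v) Z = fam (W w G v \<star> W w F v) Z"
      using Z Z' S SF SG scomp_sel[OF V] s by simp
  qed (use V S SF SG s scomp_sel[OF V] in simp_all)
next
  case False
  have "\<not> valid (W w (G \<star> F) v)" using False scomp_sel[of G F] by (auto simp: W_valid)
  moreover have "\<not> valid (W w G v \<star> W w F v)"
  proof
    assume V: "valid (W w G v \<star> W w F v)"
    then obtain a b c d where 1: "valid F" "valid G" "pth a v (so F)" "pth (tg F) (rev w) b"
        "pth c v (so G)"
       "pth (tg G) (rev w) d"
      by (auto simp: scomp_valid W_valid)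
    note SF = W_sel[OF 1(1,3,4)] note SG = W_sel[OF 1(2,5,6)]
    have e: "a = c" "b = d" "dm G = cd F" using V SF SG by (auto simp: scomp_valid)
    \<comment> \<open>A word and one of its endpoints determine the other endpoint. The outer
      endpoints agree for the two whiskered cells, hence so do the inner ones: whiskering cannot
      make a non-composable pair composable.\<close>
    have "so G = so F" using 1 e by (metis pth_unique_trg)
    moreover have "tg G = tg F" using 1 e by (metis pth_unique_src)
    ultimately have "valid (G \<star> F)" using 1 e by (simp add: scomp_valid)
    then show False using False 1 by auto
  qed
  ultimately show ?thesis by (simp add: not_valid_W not_valid_scomp)
qed

lemma W_unit [simp]: "valid F \<Longrightarrow> W [] F [] = F"
proof (rule scell_eqI)
  assume F: "valid F"
  then have p: "pth (so F) [] (so F)" "pth (tg F) (rev []) (tg F)" using pth_Obj valid_pth by auto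
  show "valid (W [] F [])" using F p by (auto simp: W_valid)
  note s = W_sel[OF F p]
  fix Z assume "Z \<in> Mor B" "trg B Z = so (W [] F [])"
  then show "fam (W [] F []) Z = fam F Z" using s by simp
qed (use pth_Obj valid_pth W_sel[of F "so F" "[]" "[]" "tg F"] in auto)

text \<open>Interchange is naturality of the family of \<open>F\<close> along the cell that
  \<open>G\<close> induces. The word \<open>g\<close> is the gap between the two cells, so one
  equation covers adjacent as well as distant cells. An ill-typed gap makes both sides
  \<open>Nul\<close>.\<close>

lemma whisker_exchange:
  assumes F: "valid F" and G: "valid G"
  shows "W w F (g @ cd G @ v) \<star> W (rev g @ rev (dm F) @ w) G v
     = W (rev g @ rev (cd F) @ w) G v \<star> W w F (g @ dm G @ v)"
proof (cases "(\<exists>b. pth (tg F) (rev w) b) \<and> pth (tg G) g (so F) \<and> (\<exists>a. pth a v (so G))")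
  case True
  then obtain a b where p: "pth (tg F) (rev w) b" "pth (tg G) g (so F)" "pth a v (so G)" by auto
  note vp = valid_pth[OF F] valid_pth[OF G]
  have q: "pth a (g @ cd G @ v) (so F)" "pth a (g @ dm G @ v) (so F)"
    "pth (tg G) (rev (rev g @ rev (dm F) @ w)) b" "pth (tg G) (rev (rev g @ rev (cd F) @ w)) b"
    using vp p by auto
  note s = W_sel[OF F q(1) p(1)] W_sel[OF F q(2) p(1)] W_sel[OF G p(3) q(3)] W_sel[OF G p(3) q(4)]
  have vs: "valid (W w F (g @ cd G @ v))" "valid (W w F (g @ dm G @ v))"
    "valid (W (rev g @ rev (dm F) @ w) G v)" "valid (W (rev g @ rev (cd F) @ w) G v)"
    using q p F G unfolding W_valid by blast+
  have V: "valid (W w F (g @ cd G @ v) \<star> W (rev g @ rev (dm F) @ w) G v)"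
    "valid (W (rev g @ rev (cd F) @ w) G v \<star> W w F (g @ dm G @ v))"
    using vs s unfolding scomp_valid by simp_all
  show ?thesis
  proof (rule scell_eqI[OF V])
    fix Z assume "Z \<in> Mor B" "trg B Z = so (W w F (g @ cd G @ v) \<star> W (rev g @ rev (dm F) @ w) G v)"
    then have Z: "Z \<in> Mor B" "trg B Z = a" using scomp_sel[OF V(1)] s by auto
    have Z1: "act v Z \<in> Mor B" "trg B (act v Z) = so G" using act_typ[OF p(3), of Z] Z by auto
    \<comment> \<open>The cell along which naturality of \<open>F\<close> is used: \<open>G\<close>
      together with the strands of the gap on its left.\<close>
    let ?h = "act2 g (fam G (act v Z))"
    note f = valid_fam[OF G Z1]
    have Z3: "act (dm G) (act v Z) \<in> Mor B \<and> trg B (act (dm G) (act v Z)) = tg G"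
      "act (cd G) (act v Z) \<in> Mor B \<and> trg B (act (cd G) (act v Z)) = tg G"
      using act_typ[of "so G" _ "tg G" "act v Z"] vp Z1 by auto
    have h: "?h \<in> Cell B" "dom2 B ?h = act g (act (dm G) (act v Z))"
        "cod2 B ?h = act g (act (cd G) (act v Z))"
      using act2_typ[OF p(2), of "fam G (act v Z)"] f Z3 by auto
    have Z4: "act g (act (dm G) (act v Z)) \<in> Mor B" "trg B (act g (act (dm G) (act v Z))) = so F"
      "act g (act (cd G) (act v Z)) \<in> Mor B" "trg B (act g (act (cd G) (act v Z))) = so F"
      using act_typ[OF p(2)] Z3 by auto
    note n = valid_nat[OF F h(1)]
    have t: "act2 (dm F) ?h \<in> Cell B" "act2 (cd F) ?h \<in> Cell B"
      "dom2 B (act2 (dm F) ?h) = act (dm F) (dom2 B ?h)"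
          "cod2 B (act2 (dm F) ?h) = act (dm F) (cod2 B ?h)"
      "dom2 B (act2 (cd F) ?h) = act (cd F) (dom2 B ?h)"
          "cod2 B (act2 (cd F) ?h) = act (cd F) (cod2 B ?h)"
      using act2_typ[of "so F" _ "tg F" ?h] vp h Z4 by auto
    have t5: "trg B (act (dm F) (act g (act (dm G) (act v Z)))) = tg F"
      using act_typ[of "so F" "dm F" "tg F"] vp Z4 by auto
    note fF = valid_fam[OF F Z4(1,2)] valid_fam[OF F Z4(3,4)]
    have "act2 (rev w) (fam F (act g (act (cd G) (act v Z)))) \<cdot> act2 (rev w) (act2 (dm F) ?h)
       = act2 (rev w) (act2 (cd F) ?h) \<cdot> act2 (rev w) (fam F (act g (act (dm G) (act v Z))))"
      using n fF t h Z4 t5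
        act2_comp[OF p(1), of "act2 (dm F) ?h" "fam F (act g (act (cd G) (act v Z)))"]
        act2_comp[OF p(1), of "fam F (act g (act (dm G) (act v Z)))" "act2 (cd F) ?h"] by simp
    then show "fam (W w F (g @ cd G @ v) \<star> W (rev g @ rev (dm F) @ w) G v) Z
       = fam (W (rev g @ rev (cd F) @ w) G v \<star> W w F (g @ dm G @ v)) Z"
      using scomp_sel[OF V(1)] scomp_sel[OF V(2)] s Z by simp
  qed (use scomp_sel[OF V(1)] scomp_sel[OF V(2)] s in simp_all)
next
  case False
  \<comment> \<open>Validity of either composite would force \<open>g\<close> to be a path from the
    target of \<open>G\<close> to the source of \<open>F\<close>, and the outer words to be paths as
    well. As one of these conditions fails, both sides are \<open>Nul\<close>.\<close>
  have A: "\<not> valid (W w F (g @ X @ v) \<star> W (rev g @ rev Y @ w) G v)"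
    if "pth (so G) X (tg G)" "pth (so F) Y (tg F)" for X Y
  proof
    assume "valid (W w F (g @ X @ v) \<star> W (rev g @ rev Y @ w) G v)"
    then obtain a b c d where 1: "pth (tg F) (rev w) a" "pth b (g @ X @ v) (so F)"
      "pth (tg G) (rev (rev g @ rev Y @ w)) c" "pth d v (so G)"
      "so (W w F (g @ X @ v)) = so (W (rev g @ rev Y @ w) G v)"
      "tg (W w F (g @ X @ v)) = tg (W (rev g @ rev Y @ w) G v)"
      by (auto simp: scomp_valid W_valid simp del: pth_append rev_append)
    then have "b = d" "a = c" using W_sel[OF F 1(2,1)] W_sel[OF G 1(4,3)] by auto
    with 1 that have "pth (tg G) g (so F)"
      by (auto) (metis pth_unique_trg)
    then show False using False 1 by auto
  qed
  have C: "\<not> valid (W (rev g @ rev Y @ w) G v \<star> W w F (g @ X @ v))"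
    if "pth (so G) X (tg G)" "pth (so F) Y (tg F)" for X Y
  proof
    assume "valid (W (rev g @ rev Y @ w) G v \<star> W w F (g @ X @ v))"
    then obtain a b c d where 1: "pth (tg F) (rev w) a" "pth b (g @ X @ v) (so F)"
      "pth (tg G) (rev (rev g @ rev Y @ w)) c" "pth d v (so G)"
      "so (W w F (g @ X @ v)) = so (W (rev g @ rev Y @ w) G v)"
      "tg (W w F (g @ X @ v)) = tg (W (rev g @ rev Y @ w) G v)"
      by (auto simp: scomp_valid W_valid simp del: pth_append rev_append)
    then have "b = d" "a = c" using W_sel[OF F 1(2,1)] W_sel[OF G 1(4,3)] by auto
    with 1 that have "pth (tg G) g (so F)"
      by (auto) (metis pth_unique_trg)
    then show False using False 1 by auto
  qed
  show ?thesis using A C valid_pth[OF F] valid_pth[OF G] by (simp add: not_valid_scomp)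
qed

lemma idc_valid: "valid (idc ws a) \<longleftrightarrow> (\<exists>b. pth a ws b)"
proof (cases "\<exists>b. pth a ws b")
  case True
  then obtain b where b: "pth a ws b" by auto
  have "valid (SC a b ws ws (mkfam a (\<lambda>Z. \<one> (act ws Z))))"
  proof (rule validI[OF b b])
    fix Z assume "Z \<in> Mor B" "trg B Z = a"
    then show "\<one> (act ws Z) \<in> Cell B \<and> dom2 B (\<one> (act ws Z)) = act ws Z \<and> cod2 B (\<one> (act ws Z))
        = act ws Z"
      using act_typ[OF b, of Z] by auto
  next
    fix h assume "h \<in> Cell B" "trg B (dom2 B h) = a"
    then show "\<one> (act ws (cod2 B h)) \<cdot> act2 ws h = act2 ws h \<cdot> \<one> (act ws (dom2 B h))"
      using act2_typ[OF b, of h] by auto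
  qed
  then show ?thesis using b by (auto simp: idc_def the_trg)
qed (auto simp: idc_def)

lemma idc_sel:
  assumes "pth a ws b"
  shows "so (idc ws a) = a" "tg (idc ws a) = b" "dm (idc ws a) = ws" "cd (idc ws a) = ws"
    "\<And>Z. Z \<in> Mor B \<Longrightarrow> trg B Z = a \<Longrightarrow> fam (idc ws a) Z = \<one> (act ws Z)"
  using assms by (auto simp: idc_def the_trg mkfam_def)

lemma scomp_idc:
  assumes F: "valid F"
  shows "F \<star> idc (dm F) (so F) = F" "idc (cd F) (so F) \<star> F = F"
proof -
  note p = valid_pth[OF F]
  have v: "valid (F \<star> idc (dm F) (so F))" "valid (idc (cd F) (so F) \<star> F)"
    using F p by (auto simp: scomp_valid idc_valid idc_sel)
  show "F \<star> idc (dm F) (so F) = F"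
    by (rule scell_eqI[OF v(1) F]) (use scomp_sel[OF v(1)] idc_sel[of "so F" "dm F" "tg F"] p F in
        \<open>simp_all add: valid_fam\<close>)
  show "idc (cd F) (so F) \<star> F = F"
    by (rule scell_eqI[OF v(2) F]) (use scomp_sel[OF v(2)] idc_sel[of "so F" "cd F" "tg F"] p F in
        \<open>simp_all add: valid_fam\<close>)
qed

lemma W_idc:
  assumes "pth a v b" "pth b ws c" "pth c (rev w) d"
  shows "W w (idc ws b) v = idc (rev w @ ws @ v) a"
proof -
  have q: "valid (idc ws b)" "pth a (rev w @ ws @ v) d" using assms by (auto simp: idc_valid)
  have r: "pth a v (so (idc ws b))" "pth (tg (idc ws b)) (rev w) d"
    using assms idc_sel[of b ws c] by auto
  have v: "valid (W w (idc ws b) v)" using q r by (auto simp: W_valid)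
  show ?thesis
  proof (rule scell_eqI[OF v])
    show "valid (idc (rev w @ ws @ v) a)" using q by (auto simp: idc_valid simp del: pth_append)
    fix Z assume "Z \<in> Mor B" "trg B Z = so (W w (idc ws b) v)"
    then show "fam (W w (idc ws b) v) Z = fam (idc (rev w @ ws @ v) a) Z"
      using W_sel[OF q(1) r] idc_sel[OF q(2)] idc_sel[of b ws c] assms act_typ[OF assms(1), of Z]
        act_typ[OF assms(2), of "act v Z"] act2_ident[OF assms(3)] by (simp del: pth_append)
  qed (use W_sel[OF q(1) r] idc_sel[OF q(2)] idc_sel[of b ws c] assms in simp_all)
qed

end

section \<open>Strictification\<close>

text \<open>
  A tree is a bracketing of a composite 1-morphism; units (\<open>Em\<close>) disappear in its word.  A
  1-morphism does not determine its bracketing, so the strictification \<open>S s t f\<close> is indexed by trees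
  for the domain and the codomain of \<open>f\<close>.
\<close>

datatype ('o, 'f) tree = Lf 'f | Em 'o | Nd "('o, 'f) tree" "('o, 'f) tree"

primrec word :: "('o, 'f) tree \<Rightarrow> 'f list" where
  "word (Lf X) = [X]"
| "word (Em c) = []"
| "word (Nd s t) = word s @ word t"

context bicategory begin

primrec ev :: "('o, 'f) tree \<Rightarrow> 'f" where
  "ev (Lf X) = X"
| "ev (Em c) = \<I> c"
| "ev (Nd s t) = ev s \<otimes> ev t"

primrec wt :: "('o, 'f) tree \<Rightarrow> bool" where
  "wt (Lf X) \<longleftrightarrow> X \<in> Mor B"
| "wt (Em c) \<longleftrightarrow> c \<in> Obj B"
| "wt (Nd s t) \<longleftrightarrow> wt s \<and> wt t \<and> src B (ev s) = trg B (ev t)"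

text \<open>The coherence isomorphism from \<open>ev t \<otimes> Z\<close> to
  \<open>act (word t) Z\<close>: it opens all brackets of \<open>t\<close> and removes its units.
  \<open>bet\<close> is its inverse, given by a recursion of its own so that no inverse of a
  composite has to be computed.\<close>

primrec alp :: "('o, 'f) tree \<Rightarrow> 'f \<Rightarrow> 'm" where
  "alp (Lf X) Z = \<one> (X \<otimes> Z)"
| "alp (Em c) Z = \<ll> Z"
| "alp (Nd s t) Z = alp s (act (word t) Z) \<cdot> (\<one> (ev s) \<odot> alp t Z) \<cdot> \<aa> (ev s) (ev t) Z"

primrec bet :: "('o, 'f) tree \<Rightarrow> 'f \<Rightarrow> 'm" where
  "bet (Lf X) Z = \<one> (X \<otimes> Z)"
| "bet (Em c) Z = inv2 (\<ll> Z)"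
| "bet (Nd s t) Z = inv2 (\<aa> (ev s) (ev t) Z) \<cdot> (\<one> (ev s) \<odot> bet t Z) \<cdot> bet s (act (word t) Z)"

lemma wt_ev: "wt t \<Longrightarrow> ev t \<in> Mor B \<and> pth (src B (ev t)) (word t) (trg B (ev t))"
  by (induction t) auto

lemma act_word:
  assumes "wt t" "Z \<in> Mor B" "trg B Z = src B (ev t)"
  shows "act (word t) Z \<in> Mor B" "src B (act (word t) Z) = src B Z"
      "trg B (act (word t) Z) = trg B (ev t)"
  using act_typ[of "src B (ev t)" "word t" "trg B (ev t)" Z] wt_ev assms by auto

lemma alp_bet_typ:
  assumes "wt t" "Z \<in> Mor B" "trg B Z = src B (ev t)"
  shows "alp t Z \<in> Cell B \<and> dom2 B (alp t Z) = ev t \<otimes> Z \<and> cod2 B (alp t Z) = act (word t) Z \<and>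
    bet t Z \<in> Cell B \<and> cod2 B (bet t Z) = ev t \<otimes> Z \<and> dom2 B (bet t Z) = act (word t) Z"
  using assms
proof (induction t arbitrary: Z)
  case (Nd s t)
  then show ?case using act_word[of t Z] wt_ev[of s] wt_ev[of t] by simp
qed simp_all

lemma tensor_comp_left:
  assumes "f \<in> Cell B" "g \<in> Cell B" "dom2 B g = cod2 B f" "X \<in> Mor B" "src B X = trg B (dom2 B f)"
  shows "\<one> X \<odot> (g \<cdot> f) = (\<one> X \<odot> g) \<cdot> (\<one> X \<odot> f)"
  using assms by (simp add: tensor_comp)

lemma tensor_comp_right:
  assumes "f \<in> Cell B" "g \<in> Cell B" "dom2 B g = cod2 B f" "X \<in> Mor B" "trg B X = src B (dom2 B f)"
  shows "(g \<cdot> f) \<odot> \<one> X = (g \<odot> \<one> X) \<cdot> (f \<odot> \<one> X)"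
  using assms by (simp add: tensor_comp)

lemma vassoc_cancel:
  assumes "g \<cdot> f = \<one> (dom2 B f)" "f \<in> Cell B" "g \<in> Cell B" "h \<in> Cell B"
    "dom2 B g = cod2 B f" "cod2 B h = dom2 B f"
  shows "g \<cdot> (f \<cdot> h) = h"
  using assms vcomp_assoc_cell[of h f g] by simp

lemma alp_bet_inv:
  assumes "wt t" "Z \<in> Mor B" "trg B Z = src B (ev t)"
  shows "alp t Z \<cdot> bet t Z = \<one> (act (word t) Z) \<and> bet t Z \<cdot> alp t Z = \<one> (ev t \<otimes> Z)"
  using assms
proof (induction t arbitrary: Z)
  case (Nd s t)
  let ?U = "act (word t) Z" let ?A = "\<aa> (ev s) (ev t) Z"
  have m: "ev s \<in> Mor B" "ev t \<in> Mor B" "src B (ev s) = trg B (ev t)" "Z \<in> Mor B"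
      "trg B Z = src B (ev t)"
    "wt s" "wt t" using Nd wt_ev by auto
  note U = act_word[OF m(7,4,5)]
  note ts = alp_bet_typ[OF m(6) U(1), unfolded U, OF m(3)[symmetric]] alp_bet_typ[OF m(7,4,5)]
  have i1: "alp s ?U \<cdot> bet s ?U = \<one> (act (word s) ?U)" "bet s ?U \<cdot> alp s ?U = \<one> (ev s \<otimes> ?U)"
    using Nd.IH(1)[of ?U] U m by auto
  have i2: "alp t Z \<cdot> bet t Z = \<one> ?U" "bet t Z \<cdot> alp t Z = \<one> (ev t \<otimes> Z)"
    using Nd.IH(2)[of Z] m by auto
  have e: "(\<one> (ev s) \<odot> alp t Z) \<cdot> (\<one> (ev s) \<odot> bet t Z) = \<one> (ev s \<otimes> ?U)"
    "(\<one> (ev s) \<odot> bet t Z) \<cdot> (\<one> (ev s) \<odot> alp t Z) = \<one> (ev s \<otimes> (ev t \<otimes> Z))"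
    using ts i2 m U by (simp_all flip: tensor_comp_left)
  have "alp (Nd s t) Z \<cdot> bet (Nd s t) Z = alp s ?U
      \<cdot> ((\<one> (ev s) \<odot> alp t Z) \<cdot> ((\<one> (ev s) \<odot> bet t Z) \<cdot> bet s ?U))"
    using ts m U by (simp add: vcomp_assoc_cell)
  also have "\<dots> = alp s ?U \<cdot> bet s ?U"
    using ts m U e by (subst vassoc_cancel) simp_all
  finally have 1: "alp (Nd s t) Z \<cdot> bet (Nd s t) Z = \<one> (act (word (Nd s t)) Z)" using i1 by simp
  have "bet (Nd s t) Z \<cdot> alp (Nd s t) Z = inv2 ?A
      \<cdot> ((\<one> (ev s) \<odot> bet t Z) \<cdot> (bet s ?U \<cdot> (alp s ?U \<cdot> ((\<one> (ev s) \<odot> alp t Z) \<cdot> ?A))))"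
    using ts m U by (simp add: vcomp_assoc_cell)
  also have "\<dots> = inv2 ?A \<cdot> ((\<one> (ev s) \<odot> bet t Z) \<cdot> ((\<one> (ev s) \<odot> alp t Z) \<cdot> ?A))"
    using ts m U i1 by (subst vassoc_cancel[of "bet s ?U"]) simp_all
  also have "\<dots> = inv2 ?A \<cdot> ?A"
    using ts m U e by (subst vassoc_cancel) simp_all
  finally show ?case using 1 m by simp
qed simp_all

lemma alp_nat:
  assumes "wt t" "h \<in> Cell B" "trg B (dom2 B h) = src B (ev t)"
  shows "alp t (cod2 B h) \<cdot> (\<one> (ev t) \<odot> h) = act2 (word t) h \<cdot> alp t (dom2 B h)"
  using assms
proof (induction t arbitrary: h)
  case (Lf X)
  then show ?case by simp
next
  case (Em c)
  then show ?case by (simp add: lunit_nat)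
next
  case (Nd s t)
  let ?Z = "dom2 B h" and ?Z' = "cod2 B h"
  let ?U = "act (word t) ?Z" let ?U' = "act (word t) ?Z'"
  have m: "ev s \<in> Mor B" "ev t \<in> Mor B" "src B (ev s) = trg B (ev t)"
    "?Z \<in> Mor B" "trg B ?Z = src B (ev t)" "?Z' \<in> Mor B" "trg B ?Z' = src B (ev t)"
    "wt s" "wt t" "h \<in> Cell B" using Nd wt_ev by auto
  note U = act_word[OF m(9,4,5)] act_word[OF m(9,6,7)]
  have h: "act2 (word t) h \<in> Cell B" "dom2 B (act2 (word t) h) = ?U" "cod2 B (act2 (word t) h) = ?U'"
    using act2_typ[of "src B (ev t)" "word t" "trg B (ev t)" h] wt_ev[OF m(9)] m by auto
  have h2: "act2 (word s) (act2 (word t) h) \<in> Cell B"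
     "dom2 B (act2 (word s) (act2 (word t) h)) = act (word s) ?U"
    "cod2 B (act2 (word s) (act2 (word t) h)) = act (word s) ?U'"
    using act2_typ[of "src B (ev s)" "word s" "trg B (ev s)" "act2 (word t) h"] wt_ev[OF m(8)] m h U
        by auto
  have ts: "alp s ?U \<in> Cell B" "dom2 B (alp s ?U) = ev s \<otimes> ?U" "cod2 B (alp s ?U) = act (word s) ?U"
    "alp s ?U' \<in> Cell B" "dom2 B (alp s ?U') = ev s \<otimes> ?U'" "cod2 B (alp s ?U') = act (word s) ?U'"
    "alp t ?Z \<in> Cell B" "dom2 B (alp t ?Z) = ev t \<otimes> ?Z" "cod2 B (alp t ?Z) = ?U"
    "alp t ?Z' \<in> Cell B" "dom2 B (alp t ?Z') = ev t \<otimes> ?Z'" "cod2 B (alp t ?Z') = ?U'"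
    using alp_bet_typ m U by auto
  have "alp (Nd s t) ?Z' \<cdot> (\<one> (ev (Nd s t)) \<odot> h)
     = alp s ?U' \<cdot> ((\<one> (ev s) \<odot> alp t ?Z') \<cdot> (\<aa> (ev s) (ev t) ?Z' \<cdot> ((\<one> (ev s) \<odot> \<one> (ev t)) \<odot> h)))"
    using ts m U by (simp add: vcomp_assoc_cell)
  also have "\<dots> = alp s ?U' \<cdot> ((\<one> (ev s) \<odot> alp t ?Z')
      \<cdot> ((\<one> (ev s) \<odot> (\<one> (ev t) \<odot> h)) \<cdot> \<aa> (ev s) (ev t) ?Z))"
    using assoc_nat[of h "\<one> (ev t)" "\<one> (ev s)" ?Z' "ev t" "ev s"] m by simp
  also have "\<dots> = alp s ?U' \<cdot> ((\<one> (ev s) \<odot> (alp t ?Z' \<cdot> (\<one> (ev t) \<odot> h))) \<cdot> \<aa> (ev s) (ev t) ?Z)"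
    using ts m U by (simp add: tensor_comp_left vcomp_assoc_cell)
  also have "\<dots> = alp s ?U' \<cdot> ((\<one> (ev s) \<odot> (act2 (word t) h \<cdot> alp t ?Z)) \<cdot> \<aa> (ev s) (ev t) ?Z)"
    using Nd.IH(2)[of h] m by simp
  also have "\<dots> = (alp s ?U' \<cdot> (\<one> (ev s) \<odot> act2 (word t) h)) \<cdot> (\<one> (ev s) \<odot> alp t ?Z)
      \<cdot> \<aa> (ev s) (ev t) ?Z"
    using ts m U h by (simp add: tensor_comp_left vcomp_assoc_cell)
  also have "alp s ?U' \<cdot> (\<one> (ev s) \<odot> act2 (word t) h) = act2 (word s) (act2 (word t) h) \<cdot> alp s ?U"
    using Nd.IH(1)[of "act2 (word t) h"] m h U by simp
  finally show ?case using ts m U h h2 by (simp add: vcomp_assoc_cell)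
qed

section \<open>Strict forms of 2-cells and functoriality of strictification\<close>

definition S :: "('o, 'f) tree \<Rightarrow> ('o, 'f) tree \<Rightarrow> 'm \<Rightarrow> ('o, 'f, 'm) scell" where
  "S s t f = SC (src B (ev s)) (trg B (ev s)) (word s) (word t)
     (mkfam (src B (ev s)) (\<lambda>Z. alp t Z \<cdot> (f \<odot> \<one> Z) \<cdot> bet s Z))"

lemma S_sel [simp]:
  "so (S s t f) = src B (ev s)" "tg (S s t f) = trg B (ev s)" "dm (S s t f) = word s"
      "cd (S s t f) = word t"
  by (simp_all add: S_def)

lemma fam_S:
  "Z \<in> Mor B \<Longrightarrow> trg B Z = src B (ev s) \<Longrightarrow> fam (S s t f) Z = alp t Z \<cdot> (f \<odot> \<one> Z) \<cdot> bet s Z"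
  by (simp add: S_def mkfam_def)

text \<open>Packs the typing of \<open>f\<close>, the well-formedness of the two bracketings and the
  strict form into one judgement. Its closure rules follow the syntax of the 2-cell, so a strict
  form is computed by resolution with the fourth argument left schematic.\<close>

definition rep :: "('o, 'f) tree \<Rightarrow> ('o, 'f) tree \<Rightarrow> 'm \<Rightarrow> ('o, 'f, 'm) scell \<Rightarrow> bool" where
  "rep s t f F \<longleftrightarrow> wt s \<and> wt t \<and> f \<in> hom2 B (ev s) (ev t) \<and> F = S s t f"

lemma bet_nat:
  assumes "wt t" "h \<in> Cell B" "trg B (dom2 B h) = src B (ev t)"
  shows "bet t (cod2 B h) \<cdot> act2 (word t) h = (\<one> (ev t) \<odot> h) \<cdot> bet t (dom2 B h)"
proof -
  let ?Z = "dom2 B h" and ?Z' = "cod2 B h"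
  have m: "ev t \<in> Mor B" using wt_ev assms by auto
  note ts = alp_bet_typ[of t ?Z] alp_bet_typ[of t ?Z'] alp_bet_inv[of t ?Z] alp_bet_inv[of t ?Z']
      act_word[of t ?Z] act_word[of t ?Z']
  have h: "act2 (word t) h \<in> Cell B" "dom2 B (act2 (word t) h) = act (word t) ?Z"
      "cod2 B (act2 (word t) h) = act (word t) ?Z'"
    using act2_typ[of "src B (ev t)" "word t" "trg B (ev t)" h] wt_ev[OF assms(1)] assms by auto
  have "bet t ?Z' \<cdot> act2 (word t) h = bet t ?Z' \<cdot> ((act2 (word t) h \<cdot> alp t ?Z) \<cdot> bet t ?Z)"
    using ts h assms m by (simp add: vcomp_assoc_cell)
  also have "\<dots> = bet t ?Z' \<cdot> (alp t ?Z' \<cdot> ((\<one> (ev t) \<odot> h) \<cdot> bet t ?Z))"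
    using ts assms m by (simp add: vcomp_assoc_cell flip: alp_nat)
  also have "\<dots> = (\<one> (ev t) \<odot> h) \<cdot> bet t ?Z"
    using ts assms m by (subst vassoc_cancel) simp_all
  finally show ?thesis .
qed

lemma S_valid:
  assumes "wt s" "wt t" "f \<in> hom2 B (ev s) (ev t)"
  shows "valid (S s t f)"
  unfolding S_def
proof (rule validI)
  have f: "f \<in> Cell B" "dom2 B f = ev s" "cod2 B f = ev t" using assms by (auto simp: hom2_def)
  have e: "src B (ev t) = src B (ev s)" "trg B (ev t) = trg B (ev s)"
    using dom2_typ[OF f(1)] f by auto
  have m: "ev s \<in> Mor B" "ev t \<in> Mor B" using wt_ev assms by auto
  show "pth (src B (ev s)) (word s) (trg B (ev s))" "pth (src B (ev s)) (word t) (trg B (ev s))"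
    using wt_ev[of s] wt_ev[of t] assms e by auto
  show "alp t Z \<cdot> (f \<odot> \<one> Z) \<cdot> bet s Z \<in> Cell B \<and>
         dom2 B (alp t Z \<cdot> (f \<odot> \<one> Z) \<cdot> bet s Z) = act (word s) Z \<and>
         cod2 B (alp t Z \<cdot> (f \<odot> \<one> Z) \<cdot> bet s Z) = act (word t) Z"
    if "Z \<in> Mor B" "trg B Z = src B (ev s)" for Z
    using alp_bet_typ[OF assms(1) that] alp_bet_typ[OF assms(2) that(1)] that e f by simp
  fix h assume h: "h \<in> Cell B" "trg B (dom2 B h) = src B (ev s)"
  let ?Z = "dom2 B h" and ?Z' = "cod2 B h"
  note ts = alp_bet_typ[OF assms(1), of ?Z] alp_bet_typ[OF assms(1), of ?Z']
   alp_bet_typ[OF assms(2), of ?Z] alp_bet_typ[OF assms(2), of ?Z']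
  have hs: "act2 (word s) h \<in> Cell B" "dom2 B (act2 (word s) h) = act (word s) ?Z"
      "cod2 B (act2 (word s) h) = act (word s) ?Z'"
    using act2_typ[of "src B (ev s)" "word s" "trg B (ev s)" h] wt_ev[OF assms(1)] h by auto
  have ht: "act2 (word t) h \<in> Cell B" "dom2 B (act2 (word t) h) = act (word t) ?Z"
      "cod2 B (act2 (word t) h) = act (word t) ?Z'"
    using act2_typ[of "src B (ev t)" "word t" "trg B (ev t)" h] wt_ev[OF assms(2)] h e by auto
  have "(alp t ?Z' \<cdot> (f \<odot> \<one> ?Z') \<cdot> bet s ?Z') \<cdot> act2 (word s) h
    = alp t ?Z' \<cdot> ((f \<odot> \<one> ?Z') \<cdot> (bet s ?Z' \<cdot> act2 (word s) h))"
    using ts hs h e f by (simp add: vcomp_assoc_cell)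
  also have "\<dots> = alp t ?Z' \<cdot> ((f \<odot> \<one> ?Z') \<cdot> (\<one> (ev s) \<odot> h)) \<cdot> bet s ?Z"
    using ts hs h e f m bet_nat[OF assms(1) h] by (simp add: vcomp_assoc_cell)
  also have "(f \<odot> \<one> ?Z') \<cdot> (\<one> (ev s) \<odot> h) = (\<one> (ev t) \<odot> h) \<cdot> (f \<odot> \<one> ?Z)"
    using h f e m by (simp add: tensor_comp)
  also have "alp t ?Z' \<cdot> ((\<one> (ev t) \<odot> h) \<cdot> (f \<odot> \<one> ?Z)) \<cdot> bet s ?Z
      = (alp t ?Z' \<cdot> (\<one> (ev t) \<odot> h)) \<cdot> (f \<odot> \<one> ?Z) \<cdot> bet s ?Z"
    using ts h e f m by (simp add: vcomp_assoc_cell)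
  also have "alp t ?Z' \<cdot> (\<one> (ev t) \<odot> h) = act2 (word t) h \<cdot> alp t ?Z"
    using alp_nat[OF assms(2) h(1)] h e by simp
  finally show "(alp t ?Z' \<cdot> (f \<odot> \<one> ?Z') \<cdot> bet s ?Z') \<cdot> act2 (word s) h
     = act2 (word t) h \<cdot> alp t ?Z \<cdot> (f \<odot> \<one> ?Z) \<cdot> bet s ?Z"
    using ts ht h e f by (simp add: vcomp_assoc_cell)
qed

lemma alp_cancel:
  assumes "wt t" "Z \<in> Mor B" "trg B Z = src B (ev t)" "h \<in> Cell B" "k \<in> Cell B"
    "cod2 B h = ev t \<otimes> Z" "cod2 B k = ev t \<otimes> Z" "dom2 B h = dom2 B k"
    "alp t Z \<cdot> h = alp t Z \<cdot> k"
  shows "h = k"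
proof -
  note ts = alp_bet_typ[OF assms(1-3)] alp_bet_inv[OF assms(1-3)]
  have "h = bet t Z \<cdot> (alp t Z \<cdot> h)" using ts assms(4,6) by (subst vassoc_cancel) simp_all
  also have "\<dots> = k" unfolding assms(9) using ts assms(5,7) by (subst vassoc_cancel) simp_all
  finally show ?thesis .
qed

lemma bet_cancel:
  assumes "wt t" "Z \<in> Mor B" "trg B Z = src B (ev t)" "h \<in> Cell B" "k \<in> Cell B"
    "dom2 B h = ev t \<otimes> Z" "dom2 B k = ev t \<otimes> Z"
    "h \<cdot> bet t Z = k \<cdot> bet t Z"
  shows "h = k"
proof -
  note ts = alp_bet_typ[OF assms(1-3)] alp_bet_inv[OF assms(1-3)]
  have "h = (h \<cdot> bet t Z) \<cdot> alp t Z" using ts assms(4,6) by (simp add: vcomp_assoc_cell)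
  also have "\<dots> = k" unfolding assms(8) using ts assms(5,7) by (simp add: vcomp_assoc_cell)
  finally show ?thesis .
qed

lemma S_faithful:
  assumes "wt s" "wt t" "f \<in> hom2 B (ev s) (ev t)" "g \<in> hom2 B (ev s) (ev t)" "S s t f = S s t g"
  shows "f = g"
proof -
  have f: "f \<in> Cell B" "dom2 B f = ev s" "cod2 B f = ev t" "g \<in> Cell B" "dom2 B g = ev s"
      "cod2 B g = ev t"
    using assms by (auto simp: hom2_def)
  have e: "src B (ev t) = src B (ev s)" "trg B (ev t) = trg B (ev s)"
    using dom2_typ[OF f(1)] f by auto
  have m: "ev s \<in> Mor B" "ev t \<in> Mor B" using wt_ev assms by auto
  let ?Z = "\<I> (src B (ev s))"
  have Z: "?Z \<in> Mor B" "trg B ?Z = src B (ev s)" "src B ?Z = src B (ev s)" using m by auto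
  note ts = alp_bet_typ[OF assms(1) Z(1,2)] alp_bet_typ[OF assms(2) Z(1)]
  have "alp t ?Z \<cdot> ((f \<odot> \<one> ?Z) \<cdot> bet s ?Z) = alp t ?Z \<cdot> ((g \<odot> \<one> ?Z) \<cdot> bet s ?Z)"
    using fam_S[OF Z(1,2)] assms(5) by metis
  then have "(f \<odot> \<one> ?Z) \<cdot> bet s ?Z = (g \<odot> \<one> ?Z) \<cdot> bet s ?Z"
    by (rule alp_cancel[rotated -1]) (use ts assms(2) f Z e in simp_all)
  then have "f \<odot> \<one> ?Z = g \<odot> \<one> ?Z"
    by (rule bet_cancel[rotated -1]) (use ts assms(1) f Z e in simp_all)
  then show ?thesis
    by (rule tensor_unit_faithful[rotated -1]) (use f in simp_all)
qed

text \<open>The comparison maps of the middle bracketing \<open>t\<close> meet and cancel.\<close>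

lemma S_comp:
  assumes "wt s" "wt t" "wt u" "f \<in> hom2 B (ev s) (ev t)" "g \<in> hom2 B (ev t) (ev u)"
  shows "S s u (g \<cdot> f) = S t u g \<star> S s t f"
proof -
  have f: "f \<in> Cell B" "dom2 B f = ev s" "cod2 B f = ev t" "g \<in> Cell B" "dom2 B g = ev t"
      "cod2 B g = ev u"
    using assms by (auto simp: hom2_def)
  have e: "src B (ev t) = src B (ev s)" "trg B (ev t) = trg B (ev s)" "src B (ev u) = src B (ev s)"
      "trg B (ev u) = trg B (ev s)"
    using dom2_typ[OF f(1)] dom2_typ[OF f(4)] f by auto
  have V: "valid (S t u g \<star> S s t f)"
    using S_valid assms e by (simp add: scomp_valid)
  show ?thesis
  proof (rule scell_eqI[OF S_valid V])
    fix Z assume "Z \<in> Mor B" "trg B Z = so (S s u (g \<cdot> f))"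
    then have Z: "Z \<in> Mor B" "trg B Z = src B (ev s)" by auto
    note ts = alp_bet_typ[OF assms(1) Z] alp_bet_typ[OF assms(2) Z(1)] alp_bet_typ[OF assms(3) Z(1)]
     alp_bet_inv[OF assms(2) Z(1)]
    have "fam (S t u g \<star> S s t f) Z = alp u Z \<cdot>
        ((g \<odot> \<one> Z) \<cdot> (bet t Z \<cdot> (alp t Z \<cdot> ((f \<odot> \<one> Z) \<cdot> bet s Z))))"
      using scomp_sel[OF V] Z ts e f by (simp add: fam_S vcomp_assoc_cell)
    also have "\<dots> = alp u Z \<cdot> ((g \<odot> \<one> Z) \<cdot> ((f \<odot> \<one> Z) \<cdot> bet s Z))"
      using Z ts e f by (subst vassoc_cancel) simp_all
    finally show "fam (S s u (g \<cdot> f)) Z = fam (S t u g \<star> S s t f) Z"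
      using Z ts e f by (simp add: fam_S tensor_comp_right vcomp_assoc_cell)
  qed (use assms f scomp_sel[OF V] in \<open>simp_all add: vcomp_in\<close>)
qed

text \<open>Naturality of the associator turns the action of \<open>f\<close> beside
  \<open>ev x\<close> and \<open>Z\<close> into its action beside the single factor
  \<open>ev x \<otimes> Z\<close>; there the comparison maps of \<open>x\<close> cancel by
  functoriality of the tensor product.\<close>

lemma S_right:
  assumes "wt s" "wt t" "wt x" "f \<in> hom2 B (ev s) (ev t)" "src B (ev s) = trg B (ev x)"
  shows "S (Nd s x) (Nd t x) (f \<odot> \<one> (ev x)) = W [] (S s t f) (word x)"
proof -
  have f: "f \<in> Cell B" "dom2 B f = ev s" "cod2 B f = ev t" using assms by (auto simp: hom2_def)
  have e: "src B (ev t) = src B (ev s)" "trg B (ev t) = trg B (ev s)" "src B (ev s) = trg B (ev x)"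
    using dom2_typ[OF f(1)] f assms by auto
  have m: "ev s \<in> Mor B" "ev t \<in> Mor B" "ev x \<in> Mor B" using wt_ev assms by auto
  have p: "pth (src B (ev x)) (word x) (so (S s t f))" "pth (tg (S s t f)) (rev []) (trg B (ev s))"
    using wt_ev assms e by auto
  note v = S_valid[OF assms(1,2,4)]
  note w = W_sel[OF v p]
  show ?thesis
  proof (rule scell_eqI)
    show "valid (S (Nd s x) (Nd t x) (f \<odot> \<one> (ev x)))"
      using assms f e m by (intro S_valid) (auto simp: hom2_def)
    show "valid (W [] (S s t f) (word x))" using v p by (auto simp: W_valid)
    fix Z assume "Z \<in> Mor B" "trg B Z = so (S (Nd s x) (Nd t x) (f \<odot> \<one> (ev x)))"
    then have Z: "Z \<in> Mor B" "trg B Z = src B (ev x)" using e m by auto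
    let ?U = "act (word x) Z"
    note U = act_word[OF assms(3) Z]
    note ts = alp_bet_typ[OF assms(3) Z] alp_bet_inv[OF assms(3) Z] alp_bet_typ[OF assms(1) U(1)]
        alp_bet_typ[OF assms(2) U(1)]
    have "fam (S (Nd s x) (Nd t x) (f \<odot> \<one> (ev x))) Z
      = alp t ?U \<cdot> ((\<one> (ev t) \<odot> alp x Z) \<cdot> ((\<aa> (ev t) (ev x) Z \<cdot> ((f \<odot> \<one> (ev x)) \<odot> \<one> Z))
          \<cdot> (inv2 (\<aa> (ev s) (ev x) Z) \<cdot> ((\<one> (ev s) \<odot> bet x Z) \<cdot> bet s ?U))))"
      using Z ts e f m U by (simp add: fam_S vcomp_assoc_cell)
    also have "\<aa> (ev t) (ev x) Z \<cdot> ((f \<odot> \<one> (ev x)) \<odot> \<one> Z) = (f \<odot> \<one> (ev x \<otimes> Z)) \<cdot> \<aa> (ev s) (ev x) Z"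
      using assoc_nat[of "\<one> Z" "\<one> (ev x)" f Z "ev x" "ev t"] f Z m e by simp
    also have "alp t ?U \<cdot> ((\<one> (ev t) \<odot> alp x Z) \<cdot> (((f \<odot> \<one> (ev x \<otimes> Z)) \<cdot> \<aa> (ev s) (ev x) Z)
          \<cdot> (inv2 (\<aa> (ev s) (ev x) Z) \<cdot> ((\<one> (ev s) \<odot> bet x Z) \<cdot> bet s ?U))))
      = alp t ?U \<cdot> (((\<one> (ev t) \<odot> alp x Z) \<cdot> (f \<odot> \<one> (ev x \<otimes> Z)) \<cdot> (\<one> (ev s) \<odot> bet x Z)) \<cdot> bet s ?U)"
      using Z ts e f m U by (simp add: vcomp_assoc_cell)
    also have "(\<one> (ev t) \<odot> alp x Z) \<cdot> (f \<odot> \<one> (ev x \<otimes> Z)) \<cdot> (\<one> (ev s) \<odot> bet x Z) = f \<odot> \<one> ?U"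
      using Z ts e f m U by (simp add: tensor_comp)
    finally show "fam (S (Nd s x) (Nd t x) (f \<odot> \<one> (ev x))) Z = fam (W [] (S s t f) (word x)) Z"
      using w(5)[OF Z] U e by (simp add: fam_S)
  qed (use w m e in simp_all)
qed

text \<open>Here the comparison maps of \<open>x\<close> are separated by the component
  \<open>k\<close> of \<open>f\<close>. By \<open>alp_nat\<close> they can be moved past it, which
  turns \<open>\<one> (ev x) \<odot> k\<close> into the letterwise action
  \<open>act2\<close>.\<close>

lemma S_left:
  assumes "wt s" "wt t" "wt x" "f \<in> hom2 B (ev s) (ev t)" "src B (ev x) = trg B (ev s)"
  shows "S (Nd x s) (Nd x t) (\<one> (ev x) \<odot> f) = W (rev (word x)) (S s t f) []"
proof -
  have f: "f \<in> Cell B" "dom2 B f = ev s" "cod2 B f = ev t" using assms by (auto simp: hom2_def)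
  have e: "src B (ev t) = src B (ev s)" "trg B (ev t) = trg B (ev s)" "src B (ev x) = trg B (ev s)"
    using dom2_typ[OF f(1)] f assms by auto
  have m: "ev s \<in> Mor B" "ev t \<in> Mor B" "ev x \<in> Mor B" using wt_ev assms by auto
  have p: "pth (src B (ev s)) [] (so (S s t f))"
      "pth (tg (S s t f)) (rev (rev (word x))) (trg B (ev x))"
    using wt_ev[of x] assms e m by auto
  note v = S_valid[OF assms(1,2,4)]
  note w = W_sel[OF v p]
  show ?thesis
  proof (rule scell_eqI)
    show "valid (S (Nd x s) (Nd x t) (\<one> (ev x) \<odot> f))"
      using assms f e m by (intro S_valid) (auto simp: hom2_def)
    show "valid (W (rev (word x)) (S s t f) [])" using v p by (auto simp: W_valid)
    fix Z assume "Z \<in> Mor B" "trg B Z = so (S (Nd x s) (Nd x t) (\<one> (ev x) \<odot> f))"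
    then have Z: "Z \<in> Mor B" "trg B Z = src B (ev s)" using e m by auto
    let ?U = "act (word s) Z" let ?V = "act (word t) Z"
    have Zt: "trg B Z = src B (ev t)" using Z e by simp
    note U = act_word[OF assms(1) Z] act_word[OF assms(2) Z(1) Zt]
    have Us: "trg B ?U = src B (ev x)" "trg B ?V = src B (ev x)" using U e by simp_all
    note ts = alp_bet_typ[OF assms(1) Z] alp_bet_typ[OF assms(2) Z(1) Zt]
        alp_bet_typ[OF assms(3) U(1) Us(1)]
       alp_bet_typ[OF assms(3) U(4) Us(2)] alp_bet_inv[OF assms(3) U(1) Us(1)]
    define k where "k = alp t Z \<cdot> (f \<odot> \<one> Z) \<cdot> bet s Z"
    have k: "k \<in> Cell B" "dom2 B k = ?U" "cod2 B k = ?V"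
      unfolding k_def using ts f Z e by simp_all
    have "fam (S (Nd x s) (Nd x t) (\<one> (ev x) \<odot> f)) Z
      = alp x ?V \<cdot> ((\<one> (ev x) \<odot> alp t Z) \<cdot> ((\<aa> (ev x) (ev t) Z \<cdot> ((\<one> (ev x) \<odot> f) \<odot> \<one> Z))
          \<cdot> (inv2 (\<aa> (ev x) (ev s) Z) \<cdot> ((\<one> (ev x) \<odot> bet s Z) \<cdot> bet x ?U))))"
      using Z ts e f m U by (simp add: fam_S vcomp_assoc_cell)
    also have "\<aa> (ev x) (ev t) Z \<cdot> ((\<one> (ev x) \<odot> f) \<odot> \<one> Z) = (\<one> (ev x) \<odot> (f \<odot> \<one> Z)) \<cdot> \<aa> (ev x) (ev s) Z"
      using assoc_nat[of "\<one> Z" f "\<one> (ev x)" Z "ev t" "ev x"] f Z m e by simp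
    also have "alp x ?V \<cdot> ((\<one> (ev x) \<odot> alp t Z) \<cdot> (((\<one> (ev x) \<odot> (f \<odot> \<one> Z)) \<cdot> \<aa> (ev x) (ev s) Z)
          \<cdot> (inv2 (\<aa> (ev x) (ev s) Z) \<cdot> ((\<one> (ev x) \<odot> bet s Z) \<cdot> bet x ?U))))
      = alp x ?V \<cdot> ((\<one> (ev x) \<odot> k) \<cdot> bet x ?U)"
      unfolding k_def using Z ts e f m U by (simp add: vcomp_assoc_cell tensor_comp_left)
    also have "\<dots> = (alp x ?V \<cdot> (\<one> (ev x) \<odot> k)) \<cdot> bet x ?U"
      using Z ts e f m U k by (simp add: vcomp_assoc_cell)
    also have "alp x ?V \<cdot> (\<one> (ev x) \<odot> k) = act2 (word x) k \<cdot> alp x ?U"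
      using alp_nat[OF assms(3) k(1)] k U Us by simp
    also have "(act2 (word x) k \<cdot> alp x ?U) \<cdot> bet x ?U = act2 (word x) k"
      using act2_typ[of "src B (ev x)" "word x" "trg B (ev x)" k] wt_ev[OF assms(3)] k U Us ts
          by (simp add: vcomp_assoc_cell)
    finally show "fam (S (Nd x s) (Nd x t) (\<one> (ev x) \<odot> f)) Z = fam (W (rev (word x)) (S s t f) []) Z"
      using w(5)[OF Z] Z by (simp add: fam_S k_def)
  qed (use w m e in simp_all)
qed

lemma S_ident: "wt t \<Longrightarrow> S t t (\<one> (ev t)) = idc (word t) (src B (ev t))"
proof -
  assume t: "wt t"
  note e = wt_ev[OF t]
  note i = idc_sel[of "src B (ev t)" "word t" "trg B (ev t)"]
  show ?thesis
  proof (rule scell_eqI)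
    show "valid (S t t (\<one> (ev t)))" using t e by (intro S_valid) (auto simp: ident2_in)
    show "valid (idc (word t) (src B (ev t)))" using e by (auto simp: idc_valid)
    fix Z assume "Z \<in> Mor B" "trg B Z = so (S t t (\<one> (ev t)))"
    then have Z: "Z \<in> Mor B" "trg B Z = src B (ev t)" by auto
    show "fam (S t t (\<one> (ev t))) Z = fam (idc (word t) (src B (ev t))) Z"
      using alp_bet_typ[OF t Z] alp_bet_inv[OF t Z] Z i e by (simp add: fam_S)
  qed (use e i in simp_all)
qed

text \<open>The criterion by which a coherence cell becomes invisible: compatibility with the
  comparison maps \<open>alp\<close>. For the associator it rests on the pentagon, for the left
  unitor on \<open>lunit_tensor\<close>, for the right unitor on the triangle.\<close>

lemma S_cohI:
  assumes "wt s" "wt t" "f \<in> hom2 B (ev s) (ev t)" "word s = word t"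
    "\<And>Z. Z \<in> Mor B \<Longrightarrow> trg B Z = src B (ev s) \<Longrightarrow> alp t Z \<cdot> (f \<odot> \<one> Z) = alp s Z"
  shows "S s t f = idc (word s) (src B (ev s))"
proof -
  have f: "f \<in> Cell B" "dom2 B f = ev s" "cod2 B f = ev t" using assms by (auto simp: hom2_def)
  have e: "src B (ev t) = src B (ev s)" "trg B (ev t) = trg B (ev s)"
    using dom2_typ[OF f(1)] f by auto
  note w = wt_ev[OF assms(1)]
  note i = idc_sel[of "src B (ev s)" "word s" "trg B (ev s)"]
  show ?thesis
  proof (rule scell_eqI)
    show "valid (S s t f)" using assms by (intro S_valid)
    show "valid (idc (word s) (src B (ev s)))" using w by (auto simp: idc_valid)
    fix Z assume "Z \<in> Mor B" "trg B Z = so (S s t f)"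
    then have Z: "Z \<in> Mor B" "trg B Z = src B (ev s)" "trg B Z = src B (ev t)" using e by auto
    have "alp t Z \<cdot> (f \<odot> \<one> Z) \<cdot> bet s Z = (alp t Z \<cdot> (f \<odot> \<one> Z)) \<cdot> bet s Z"
      using alp_bet_typ[OF assms(1) Z(1,2)] alp_bet_typ[OF assms(2) Z(1,3)] f Z e
          by (simp add: vcomp_assoc_cell)
    then show "fam (S s t f) Z = fam (idc (word s) (src B (ev s))) Z"
      using alp_bet_inv[OF assms(1) Z(1,2)] assms(5)[OF Z(1,2)] Z i w by (simp add: fam_S)
  qed (use w i assms in simp_all)
qed

lemma S_assoc:
  assumes "wt x" "wt y" "wt z" "src B (ev x) = trg B (ev y)" "src B (ev y) = trg B (ev z)"
  shows "S (Nd (Nd x y) z) (Nd x (Nd y z)) (\<aa> (ev x) (ev y) (ev z))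
      = idc (word x @ word y @ word z) (src B (ev z))"
proof -
  have m: "ev x \<in> Mor B" "ev y \<in> Mor B" "ev z \<in> Mor B" using wt_ev assms by auto
  have "S (Nd (Nd x y) z) (Nd x (Nd y z)) (\<aa> (ev x) (ev y) (ev z))
     = idc (word (Nd (Nd x y) z)) (src B (ev (Nd (Nd x y) z)))"
  proof (rule S_cohI)
    fix Z assume "Z \<in> Mor B" "trg B Z = src B (ev (Nd (Nd x y) z))"
    then have Z: "Z \<in> Mor B" "trg B Z = src B (ev z)" using m assms by auto
    let ?U = "act (word z) Z"
    note U = act_word[OF assms(3) Z]
    have Uy: "trg B ?U = src B (ev y)" using U assms by simp
    let ?V = "act (word y) ?U"
    note V = act_word[OF assms(2) U(1) Uy]
    have Vx: "trg B ?V = src B (ev x)" using V assms by simp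
    note ts = alp_bet_typ[OF assms(3) Z] alp_bet_typ[OF assms(2) U(1) Uy]
        alp_bet_typ[OF assms(1) V(1) Vx]
    let ?az = "alp z Z" and ?ay = "alp y ?U" and ?ax = "alp x ?V"
    let ?X = "ev x" and ?Y = "ev y" and ?Q = "ev z"
    note t = ts m Z U V assms(4,5)
    have "alp (Nd x (Nd y z)) Z \<cdot> (\<aa> ?X ?Y ?Q \<odot> \<one> Z)
       = ?ax \<cdot> ((\<one> ?X \<odot> ?ay) \<cdot> ((\<one> ?X \<odot> (\<one> ?Y \<odot> ?az)) \<cdot>
           ((\<one> ?X \<odot> \<aa> ?Y ?Q Z) \<cdot> \<aa> ?X (?Y \<otimes> ?Q) Z \<cdot> (\<aa> ?X ?Y ?Q \<odot> \<one> Z))))"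
      using t by (simp add: vcomp_assoc_cell tensor_comp_left)
    also have "(\<one> ?X \<odot> \<aa> ?Y ?Q Z) \<cdot> \<aa> ?X (?Y \<otimes> ?Q) Z \<cdot> (\<aa> ?X ?Y ?Q \<odot> \<one> Z)
        = \<aa> ?X ?Y (?Q \<otimes> Z) \<cdot> \<aa> (?X \<otimes> ?Y) ?Q Z"
      using t by (intro pentagon_eq) auto
    also have "?ax \<cdot> ((\<one> ?X \<odot> ?ay) \<cdot> ((\<one> ?X \<odot> (\<one> ?Y \<odot> ?az)) \<cdot> (\<aa> ?X ?Y (?Q \<otimes> Z) \<cdot> \<aa> (?X \<otimes> ?Y) ?Q Z)))
      = ?ax \<cdot> ((\<one> ?X \<odot> ?ay) \<cdot> (((\<one> ?X \<odot> (\<one> ?Y \<odot> ?az)) \<cdot> \<aa> ?X ?Y (?Q \<otimes> Z)) \<cdot> \<aa> (?X \<otimes> ?Y) ?Q Z))"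
      using t by (simp add: vcomp_assoc_cell)
    also have "(\<one> ?X \<odot> (\<one> ?Y \<odot> ?az)) \<cdot> \<aa> ?X ?Y (?Q \<otimes> Z) = \<aa> ?X ?Y ?U \<cdot> ((\<one> ?X \<odot> \<one> ?Y) \<odot> ?az)"
      using assoc_nat[of ?az "\<one> ?Y" "\<one> ?X" ?U ?Y ?X] t by simp
    finally show "alp (Nd x (Nd y z)) Z \<cdot> (\<aa> ?X ?Y ?Q \<odot> \<one> Z) = alp (Nd (Nd x y) z) Z"
      using t by (simp add: vcomp_assoc_cell)
  qed (use assms m in \<open>auto simp: hom2_def\<close>)
  then show ?thesis using m assms by simp
qed

lemma S_lunit:
  assumes "wt x" "c = trg B (ev x)"
  shows "S (Nd (Em c) x) x (\<ll> (ev x)) = idc (word x) (src B (ev x))"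
proof -
  have m: "ev x \<in> Mor B" using wt_ev assms by auto
  have "S (Nd (Em c) x) x (\<ll> (ev x)) = idc (word (Nd (Em c) x)) (src B (ev (Nd (Em c) x)))"
  proof (rule S_cohI)
    fix Z assume "Z \<in> Mor B" "trg B Z = src B (ev (Nd (Em c) x))"
    then have Z: "Z \<in> Mor B" "trg B Z = src B (ev x)" using m assms by auto
    note t = alp_bet_typ[OF assms(1) Z] act_word[OF assms(1) Z] m Z assms
    have "alp (Nd (Em c) x) Z = (\<ll> (act (word x) Z) \<cdot> (\<one> (\<I> c) \<odot> alp x Z)) \<cdot> \<aa> (\<I> c) (ev x) Z"
      using t by (simp add: vcomp_assoc_cell)
    also have "\<ll> (act (word x) Z) \<cdot> (\<one> (\<I> c) \<odot> alp x Z) = alp x Z \<cdot> \<ll> (ev x \<otimes> Z)"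
      using lunit_nat[of "alp x Z" "act (word x) Z" c] t by simp
    finally show "alp x Z \<cdot> (\<ll> (ev x) \<odot> \<one> Z) = alp (Nd (Em c) x) Z"
      using t lunit_tensor[of "ev x" Z c] by (simp add: vcomp_assoc_cell)
  qed (use assms m in \<open>auto simp: hom2_def\<close>)
  then show ?thesis using m assms by simp
qed

lemma S_runit:
  assumes "wt x" "c = src B (ev x)"
  shows "S (Nd x (Em c)) x (\<rr> (ev x)) = idc (word x) (src B (ev x))"
proof -
  have m: "ev x \<in> Mor B" using wt_ev assms by auto
  have "S (Nd x (Em c)) x (\<rr> (ev x)) = idc (word (Nd x (Em c))) (src B (ev (Nd x (Em c))))"
  proof (rule S_cohI)
    fix Z assume "Z \<in> Mor B" "trg B Z = src B (ev (Nd x (Em c)))"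
    then have Z: "Z \<in> Mor B" "trg B Z = src B (ev x)" using m assms by auto
    note t = alp_bet_typ[OF assms(1) Z] act_word[OF assms(1) Z] m Z assms
    show "alp x Z \<cdot> (\<rr> (ev x) \<odot> \<one> Z) = alp (Nd x (Em c)) Z"
      using t triangle_eq[of Z "ev x" c] by simp
  qed (use assms m in \<open>auto simp: hom2_def\<close>)
  then show ?thesis using m assms by simp
qed


section \<open>Computation of strict forms by resolution\<close>

lemma repD:
  assumes "rep s t f F"
  shows "wt s" "wt t" "f \<in> hom2 B (ev s) (ev t)" "F = S s t f"
  using assms by (auto simp: rep_def)

lemma rep_prim: "wt s \<Longrightarrow> wt t \<Longrightarrow> f \<in> hom2 B (ev s) (ev t) \<Longrightarrow> rep s t f (S s t f)"
  by (simp add: rep_def)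

lemma rep_ends:
  assumes "rep s t f F"
  shows "ev s \<in> Mor B" "ev t \<in> Mor B" "src B (ev t) = src B (ev s)" "trg B (ev t) = trg B (ev s)"
    "f \<in> Cell B" "dom2 B f = ev s" "cod2 B f = ev t"
  using repD[OF assms] wt_ev dom_cod[of f] by (auto simp: hom2_def)

lemma rep_valid: "rep s t f F \<Longrightarrow> valid F"
  by (auto simp: rep_def S_valid)

text \<open>Lets the rules build the strict form as a schematic cell \<open>F'\<close>, which is
  compared with the intended \<open>F\<close> only at the end.\<close>

lemma rep_cong: "rep s t f F' \<Longrightarrow> F' = F \<Longrightarrow> rep s t f F"
  by simp

lemma rep_iff: "rep s t f F \<Longrightarrow> rep s t g G \<Longrightarrow> f = g \<longleftrightarrow> F = G"
  by (auto simp: rep_def intro: S_faithful)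

lemma rep_comp: "rep s t f F \<Longrightarrow> rep t u g G \<Longrightarrow> rep s u (g \<cdot> f) (G \<star> F)"
  by (auto simp: rep_def S_comp intro: vcomp_in)

lemma rep_right:
  assumes "rep s t f F" "wt x" "src B (ev s) = trg B (ev x)" "ev x = X"
  shows "rep (Nd s x) (Nd t x) (f \<odot> \<one> X) (W [] F (word x))"
  using repD[OF assms(1)] rep_ends[OF assms(1)] assms(2-4) wt_ev[OF assms(2)]
  by (auto simp: rep_def S_right hom2_def)

lemma rep_left:
  assumes "rep s t f F" "wt x" "src B (ev x) = trg B (ev s)" "ev x = X"
  shows "rep (Nd x s) (Nd x t) (\<one> X \<odot> f) (W (rev (word x)) F [])"
  using repD[OF assms(1)] rep_ends[OF assms(1)] assms(2-4) wt_ev[OF assms(2)]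
  by (auto simp: rep_def S_left hom2_def)

lemma rep_tensor:
  assumes "rep s t g G" "rep x y f F" "src B (ev s) = trg B (ev x)"
  shows "rep (Nd s x) (Nd t y) (g \<odot> f) (W [] G (word y) \<star> W (rev (word s)) F [])"
proof -
  note e = rep_ends[OF assms(1)] rep_ends[OF assms(2)]
  have "g \<odot> f = (g \<odot> \<one> (ev y)) \<cdot> (\<one> (ev s) \<odot> f)"
    using e assms(3) by (simp add: tensor_comp)
  then show ?thesis
    using rep_comp[OF rep_left[OF assms(2), of s "ev s"] rep_right[OF assms(1), of y "ev y"]]
      e assms(3) repD[OF assms(1)] repD[OF assms(2)] by simp
qed

lemma rep_ident: "wt t \<Longrightarrow> ev t = X \<Longrightarrow> rep t t (\<one> X) (idc (word t) (src B (ev t)))"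
  using wt_ev[of t] by (auto simp: rep_def S_ident ident2_in)

text \<open>Since \<open>f \<cdot> inv2 f\<close> is an identity and \<open>f\<close> strictifies to
  one, so does \<open>inv2 f\<close>. This settles the inverse associators and unitors at
  once.\<close>

lemma rep_inv:
  assumes "rep s t f (idc (word s) (src B (ev s)))" "word s = word t" "iso2 B f"
  shows "rep t s (inv2 f) (idc (word s) (src B (ev s)))"
proof -
  note e = rep_ends[OF assms(1)] note d = repD[OF assms(1)]
  have i: "inv2 f \<in> hom2 B (ev t) (ev s)" using inv2_typ[OF assms(3)] e by (simp add: hom2_def)
  then have r: "rep t s (inv2 f) (S t s (inv2 f))" using d by (intro rep_prim)
  have "S t t (f \<cdot> inv2 f) = S s t f \<star> S t s (inv2 f)"
    using d i by (intro S_comp) auto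
  then have "idc (word t) (src B (ev t)) = S s t f \<star> S t s (inv2 f)"
    using assms(3) e d by (simp add: S_ident)
  also have "\<dots> = idc (word s) (src B (ev s)) \<star> S t s (inv2 f)" using d by simp
  also have "\<dots> = S t s (inv2 f)"
    using scomp_idc(2)[OF rep_valid[OF r]] e by simp
  finally show ?thesis using r assms(2) e by simp
qed

text \<open>Absorbs a coherence cell into its neighbour instead of composing with its identity
  strict form, so that the computed strict forms are not cluttered with identities.\<close>

lemma rep_pre_id:
  assumes "rep s t f (idc (word s) (src B (ev s)))" "word s = word t" "rep t u g G"
  shows "rep s u (g \<cdot> f) G"
  using rep_comp[OF assms(1,3)] scomp_idc(1)[OF rep_valid[OF assms(3)]] assms(2)
    repD(4)[OF assms(3)] rep_ends[OF assms(1)] by simp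

lemma rep_post_id:
  assumes "rep s t f (idc (word s) (src B (ev s)))" "word s = word t" "rep u s g G"
  shows "rep u t (f \<cdot> g) G"
  using rep_comp[OF assms(3,1)] scomp_idc(2)[OF rep_valid[OF assms(3)]] assms(2)
    repD(4)[OF assms(3)] rep_ends[OF assms(3)] by simp

lemma rep_assoc:
  assumes "wt x" "wt y" "wt z" "src B (ev x) = trg B (ev y)" "src B (ev y) = trg B (ev z)"
    "ev x = X" "ev y = Y" "ev z = Z"
  shows "rep (Nd (Nd x y) z) (Nd x (Nd y z)) (\<aa> X Y Z)
      (idc (word (Nd (Nd x y) z)) (src B (ev (Nd (Nd x y) z))))"
  using assms wt_ev[of x] wt_ev[of y] wt_ev[of z] S_assoc[of x y z]
  by (auto simp: rep_def hom2_def)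

lemma rep_assoc_inv:
  assumes "wt x" "wt y" "wt z" "src B (ev x) = trg B (ev y)" "src B (ev y) = trg B (ev z)"
    "ev x = X" "ev y = Y" "ev z = Z"
  shows "rep (Nd x (Nd y z)) (Nd (Nd x y) z) (inv2 (\<aa> X Y Z))
      (idc (word (Nd x (Nd y z))) (src B (ev (Nd x (Nd y z)))))"
  using rep_inv[OF rep_assoc[OF assms]] assms wt_ev[of x] wt_ev[of y] wt_ev[of z] by simp

lemma rep_lunit:
  assumes "wt x" "c = trg B (ev x)" "ev x = X"
  shows "rep (Nd (Em c) x) x (\<ll> X) (idc (word (Nd (Em c) x)) (src B (ev (Nd (Em c) x))))"
  using assms wt_ev[of x] S_lunit[of x c] by (auto simp: rep_def hom2_def)

lemma rep_lunit_inv: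
  assumes "wt x" "c = trg B (ev x)" "ev x = X"
  shows "rep x (Nd (Em c) x) (inv2 (\<ll> X)) (idc (word x) (src B (ev x)))"
  using rep_inv[OF rep_lunit[OF assms]] assms wt_ev[of x] by simp

lemma rep_runit:
  assumes "wt x" "c = src B (ev x)" "ev x = X"
  shows "rep (Nd x (Em c)) x (\<rr> X) (idc (word (Nd x (Em c))) (src B (ev (Nd x (Em c)))))"
  using assms wt_ev[of x] S_runit[of x c] by (auto simp: rep_def hom2_def)

lemma rep_runit_inv:
  assumes "wt x" "c = src B (ev x)" "ev x = X"
  shows "rep x (Nd x (Em c)) (inv2 (\<rr> X)) (idc (word x) (src B (ev x)))"
  using rep_inv[OF rep_runit[OF assms]] assms wt_ev[of x] by simp

lemmas rep_post =
  rep_post_id[OF rep_assoc, simplified word.simps append.assoc, OF _ _ _ _ _ _ _ _ refl, rotated -1]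
  rep_post_id[OF rep_assoc_inv, simplified word.simps append.assoc, OF _ _ _ _ _ _ _ _ refl, rotated -1]
  rep_post_id[OF rep_lunit, simplified word.simps append.simps, OF _ _ _ refl, rotated -1]
  rep_post_id[OF rep_lunit_inv, simplified word.simps append.simps, OF _ _ _ refl, rotated -1]
  rep_post_id[OF rep_runit, simplified word.simps append_Nil2, OF _ _ _ refl, rotated -1]
  rep_post_id[OF rep_runit_inv, simplified word.simps append_Nil2, OF _ _ _ refl, rotated -1]

lemmas rep_pre =
  rep_pre_id[OF rep_assoc, simplified word.simps append.assoc, OF _ _ _ _ _ _ _ _ refl]
  rep_pre_id[OF rep_assoc_inv, simplified word.simps append.assoc, OF _ _ _ _ _ _ _ _ refl]
  rep_pre_id[OF rep_lunit, simplified word.simps append.simps, OF _ _ _ refl]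
  rep_pre_id[OF rep_lunit_inv, simplified word.simps append.simps, OF _ _ _ refl]
  rep_pre_id[OF rep_runit, simplified word.simps append_Nil2, OF _ _ _ refl]
  rep_pre_id[OF rep_runit_inv, simplified word.simps append_Nil2, OF _ _ _ refl]

text \<open>The order matters: the absorbing rules stand before \<open>rep_comp\<close>, and
  tensoring with an identity stands before the general \<open>rep_tensor\<close>, so that the short
  strict form is found.\<close>

lemmas rep_rules = rep_post rep_pre rep_comp rep_right rep_left rep_tensor rep_ident
  rep_assoc rep_assoc_inv rep_lunit rep_lunit_inv rep_runit rep_runit_inv

section \<open>Strict forms of the axioms of algebras, modules and adjunctions\<close>

lemma algebra_iff:
  assumes t: "ev t = A" "src B A = a" "trg B A = a"
    and r: "rep (Nd t t) t m M" "rep (Em a) t u U"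
  shows "algebra B a A m u \<longleftrightarrow>
    M \<star> W [] M (word t) = M \<star> W (rev (word t)) M [] \<and>
    M \<star> W [] U (word t) = idc (word t) a \<and> M \<star> W (rev (word t)) U [] = idc (word t) a"
proof -
  have w: "wt t" "A \<in> Mor B" "a \<in> Obj B" using repD[OF r(1)] repD[OF r(2)] wt_ev[of t] t by auto
  have 1: "m \<cdot> (m \<odot> \<one> A) = m \<cdot> (\<one> A \<odot> m) \<cdot> \<aa> A A A \<longleftrightarrow>
     M \<star> W [] M (word t) = M \<star> W (rev (word t)) M []"
    by (rule rep_iff[of "Nd (Nd t t) t" t]; (rule rep_cong,
        ((rule rep_rules r | (simp add: t w; fail))+)))
  have 2: "m \<cdot> (u \<odot> \<one> A) = \<ll> A \<longleftrightarrow> M \<star> W [] U (word t) = idc (word t) a"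
    by (rule rep_iff[of "Nd (Em a) t" t]; (rule rep_cong,
        ((rule rep_rules r | (simp add: t w; fail))+)))
  have 3: "m \<cdot> (\<one> A \<odot> u) = \<rr> A \<longleftrightarrow> M \<star> W (rev (word t)) U [] = idc (word t) a"
    by (rule rep_iff[of "Nd t (Em a)" t]; (rule rep_cong,
        ((rule rep_rules r | (simp add: t w; fail))+)))
  show ?thesis
    using 1 2 3 w t repD(3)[OF r(1)] repD(3)[OF r(2)] by (simp add: algebra_def hom1_def)
qed

lemma coalgebra_iff:
  assumes t: "ev t = A" "src B A = a" "trg B A = a"
    and r: "rep t (Nd t t) d D" "rep t (Em a) e E"
  shows "coalgebra B a A d e \<longleftrightarrow>
    W [] D (word t) \<star> D = W (rev (word t)) D [] \<star> D \<and>
    W [] E (word t) \<star> D = idc (word t) a \<and> W (rev (word t)) E [] \<star> D = idc (word t) a"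
proof -
  have w: "wt t" "A \<in> Mor B" "a \<in> Obj B" using repD[OF r(1)] repD[OF r(2)] wt_ev[of t] t by auto
  have 1: "\<aa> A A A \<cdot> (d \<odot> \<one> A) \<cdot> d = (\<one> A \<odot> d) \<cdot> d \<longleftrightarrow>
     W [] D (word t) \<star> D = W (rev (word t)) D [] \<star> D"
    by (rule rep_iff[of t "Nd t (Nd t t)"]; (rule rep_cong,
        ((rule rep_rules r | (simp add: t w; fail))+)))
  have 2: "\<ll> A \<cdot> (e \<odot> \<one> A) \<cdot> d = \<one> A \<longleftrightarrow> W [] E (word t) \<star> D = idc (word t) a"
    by (rule rep_iff[of t t]; (rule rep_cong, ((rule rep_rules r | (simp add: t w; fail))+)))
  have 3: "\<rr> A \<cdot> (\<one> A \<odot> e) \<cdot> d = \<one> A \<longleftrightarrow> W (rev (word t)) E [] \<star> D = idc (word t) a"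
    by (rule rep_iff[of t t]; (rule rep_cong, ((rule rep_rules r | (simp add: t w; fail))+)))
  show ?thesis
    using 1 2 3 w t repD(3)[OF r(1)] repD(3)[OF r(2)] by (simp add: coalgebra_def hom1_def)
qed

text \<open>The carrier is an arbitrary tree, here as in the module criteria below: it will be a
  single letter for an abstract algebra, the empty word for the unit algebra, and two letters for
  \<open>Y \<otimes> X\<close>.\<close>

lemma separable_frobenius_iff:
  assumes t: "ev t = fcar F" "src B (fcar F) = a" "trg B (fcar F) = a"
    and r: "rep (Nd t t) t (mult F) M" "rep (Em a) t (unit F) U"
      "rep t (Nd t t) (comult F) D" "rep t (Em a) (counit F) E"
  shows "separable_frobenius B a F \<longleftrightarrow>
    M \<star> W [] M (word t) = M \<star> W (rev (word t)) M [] \<and>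
    M \<star> W [] U (word t) = idc (word t) a \<and> M \<star> W (rev (word t)) U [] = idc (word t) a \<and>
    W [] D (word t) \<star> D = W (rev (word t)) D [] \<star> D \<and>
    W [] E (word t) \<star> D = idc (word t) a \<and> W (rev (word t)) E [] \<star> D = idc (word t) a \<and>
    W (rev (word t)) M [] \<star> W [] D (word t) = D \<star> M \<and>
    W [] M (word t) \<star> W (rev (word t)) D [] = D \<star> M \<and>
    M \<star> D = idc (word t) a"
proof -
  let ?A = "fcar F" let ?m = "mult F" let ?d = "comult F"
  have w: "wt t" "?A \<in> Mor B" "a \<in> Obj B" using repD[OF r(1)] repD[OF r(2)] wt_ev[of t] t by auto
  have 1: "(\<one> ?A \<odot> ?m) \<cdot> \<aa> ?A ?A ?A \<cdot> (?d \<odot> \<one> ?A) = ?d \<cdot> ?m \<longleftrightarrow>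
     W (rev (word t)) M [] \<star> W [] D (word t) = D \<star> M"
    by (rule rep_iff[of "Nd t t" "Nd t t"]; (rule rep_cong,
        ((rule rep_rules r | (simp add: t w; fail))+)))
  have 2: "(?m \<odot> \<one> ?A) \<cdot> inv2 (\<aa> ?A ?A ?A) \<cdot> (\<one> ?A \<odot> ?d) = ?d \<cdot> ?m \<longleftrightarrow>
     W [] M (word t) \<star> W (rev (word t)) D [] = D \<star> M"
    by (rule rep_iff[of "Nd t t" "Nd t t"]; (rule rep_cong,
        ((rule rep_rules r | (simp add: t w; fail))+)))
  have 3: "?m \<cdot> ?d = \<one> ?A \<longleftrightarrow> M \<star> D = idc (word t) a"
    by (rule rep_iff[of t t]; (rule rep_cong, ((rule rep_rules r | (simp add: t w; fail))+)))
  show ?thesis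
    unfolding separable_frobenius_def frobenius_def Let_def
      algebra_iff[OF t r(1,2)] coalgebra_iff[OF t r(3,4)] 1 2 3 by blast
qed

lemma left_module_iff:
  assumes t: "ev t = fcar F" "ev n = N" "src B (fcar F) = b" "trg B (fcar F) = b" "src B N = a"
    and r: "rep (Nd t t) t (mult F) M" "rep (Em b) t (unit F) U" "rep (Nd t n) n l L"
  shows "left_module B F N l \<longleftrightarrow>
    L \<star> W [] M (word n) = L \<star> W (rev (word t)) L [] \<and> L \<star> W [] U (word n) = idc (word n) a"
proof -
  let ?A = "fcar F" let ?m = "mult F"
  have w: "wt t" "wt n" "?A \<in> Mor B" "N \<in> Mor B" "a \<in> Obj B" "b \<in> Obj B" "trg B N = b"
    using repD[OF r(1)] repD[OF r(2)] repD[OF r(3)] wt_ev[of t] wt_ev[of n] t by auto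
  have 1: "l \<cdot> (?m \<odot> \<one> N) = l \<cdot> (\<one> ?A \<odot> l) \<cdot> \<aa> ?A ?A N \<longleftrightarrow> L \<star> W [] M (word n)
      = L \<star> W (rev (word t)) L []"
    by (rule rep_iff[of "Nd (Nd t t) n" n]; (rule rep_cong,
        ((rule rep_rules r | (simp add: t w; fail))+)))
  have 2: "l \<cdot> (unit F \<odot> \<one> N) = \<ll> N \<longleftrightarrow> L \<star> W [] U (word n) = idc (word n) a"
    by (rule rep_iff[of "Nd (Em b) n" n]; (rule rep_cong,
        ((rule rep_rules r | (simp add: t w; fail))+)))
  show ?thesis unfolding left_module_def Let_def 1 2 using repD(3)[OF r(3)] t by simp
qed

lemma right_module_iff:
  assumes t: "ev t = fcar F" "ev n = N" "src B (fcar F) = a" "trg B (fcar F) = a"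
    and r: "rep (Nd t t) t (mult F) M" "rep (Em a) t (unit F) U" "rep (Nd n t) n l R"
  shows "right_module B F N l \<longleftrightarrow>
    R \<star> W [] R (word t) = R \<star> W (rev (word n)) M [] \<and> R \<star> W (rev (word n)) U [] = idc (word n) a"
proof -
  let ?A = "fcar F" let ?m = "mult F"
  have w: "wt t" "wt n" "?A \<in> Mor B" "N \<in> Mor B" "a \<in> Obj B" "src B N = a"
    using repD[OF r(1)] repD[OF r(2)] repD[OF r(3)] wt_ev[of t] wt_ev[of n] t by auto
  have 1: "l \<cdot> (l \<odot> \<one> ?A) = l \<cdot> (\<one> N \<odot> ?m) \<cdot> \<aa> N ?A ?A \<longleftrightarrow> R \<star> W [] R (word t)
      = R \<star> W (rev (word n)) M []"
    by (rule rep_iff[of "Nd (Nd n t) t" n]; (rule rep_cong,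
        ((rule rep_rules r | (simp add: t w; fail))+)))
  have 2: "l \<cdot> (\<one> N \<odot> unit F) = \<rr> N \<longleftrightarrow> R \<star> W (rev (word n)) U [] = idc (word n) a"
    by (rule rep_iff[of "Nd n (Em a)" n]; (rule rep_cong,
        ((rule rep_rules r | (simp add: t w; fail))+)))
  show ?thesis unfolding right_module_def Let_def 1 2 using repD(3)[OF r(3)] t by simp
qed

lemma bimodule_compat_iff:
  assumes t: "ev s = G" "ev x = X" "ev t = F"
    and r: "rep (Nd s x) x l L" "rep (Nd x t) x r R"
  shows "r \<cdot> (l \<odot> \<one> F) = l \<cdot> (\<one> G \<odot> r) \<cdot> \<aa> G X F \<longleftrightarrow>
    R \<star> W [] L (word t) = L \<star> W (rev (word s)) R []"
proof -
  have w: "wt s" "wt x" "wt t" "G \<in> Mor B" "X \<in> Mor B" "F \<in> Mor B" "src B X = trg B F"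
      "src B G = trg B X"
    using repD[OF r(1)] repD[OF r(2)] wt_ev[of s] wt_ev[of x] wt_ev[of t] t by auto
  show ?thesis
    by (rule rep_iff[of "Nd (Nd s x) t" x]; (rule rep_cong,
        ((rule rep_rules r | (simp add: t w; fail))+)))
qed

text \<open>Without associators and unitors the two conditions are the straightening of a bent
  strand \<open>L\<close> or \<open>R\<close>, with \<open>H\<close> as cup and \<open>E\<close> as
  cap.\<close>

lemma adjunction_iff:
  assumes r: "rep (Em a) (Nd (Lf R) (Lf L)) \<eta> H" "rep (Nd (Lf L) (Lf R)) (Em b) \<epsilon> E"
    and L: "L \<in> hom1 B a b" and R: "R \<in> hom1 B b a"
  shows "adjunction B a b L R \<eta> \<epsilon> \<longleftrightarrow>
     W [] E [L] \<star> W [L] H [] = idc [L] a \<and> W [R] E [] \<star> W [] H [R] = idc [R] b"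
proof -
  have w: "L \<in> Mor B" "R \<in> Mor B" "src B L = a" "trg B L = b" "src B R = b" "trg B R = a" "a \<in> Obj B"
      "b \<in> Obj B"
    using L R src_typ[of L] by (auto simp: hom1_def)
  have 1: "\<ll> L \<cdot> (\<epsilon> \<odot> \<one> L) \<cdot> inv2 (\<aa> L R L) \<cdot> (\<one> L \<odot> \<eta>) = \<rr> L \<longleftrightarrow> W [] E [L] \<star> W [L] H [] = idc [L] a"
    by (rule rep_iff[of "Nd (Lf L) (Em a)" "Lf L"];
        (rule rep_cong, ((rule rep_rules r | (simp add: w; fail))+)))
  have 2: "\<rr> R \<cdot> (\<one> R \<odot> \<epsilon>) \<cdot> \<aa> R L R \<cdot> (\<eta> \<odot> \<one> R) = \<ll> R \<longleftrightarrow> W [R] E [] \<star> W [] H [R] = idc [R] b"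
    by (rule rep_iff[of "Nd (Em a) (Lf R)" "Lf R"];
        (rule rep_cong, ((rule rep_rules r | (simp add: w; fail))+)))
  show ?thesis unfolding adjunction_def 1 2 using L R repD(3)[OF r(1)] repD(3)[OF r(2)] by simp
qed


subsection \<open>Algebras and bimodules\<close>

definition obj :: "'o \<times> ('f, 'm) frob \<Rightarrow> bool" where
  "obj p \<longleftrightarrow> fst p \<in> Obj B \<and> separable_frobenius B (fst p) (snd p)"

definition bim :: "('o, 'f, 'm) bimod \<Rightarrow> bool" where
  "bim X \<longleftrightarrow> obj (bsrc X) \<and> obj (btrg X) \<and> bimodule B X"

definition sM :: "'o \<times> ('f, 'm) frob \<Rightarrow> ('o, 'f, 'm) scell" where
  "sM p = S (Nd (Lf (fcar (snd p))) (Lf (fcar (snd p)))) (Lf (fcar (snd p))) (mult (snd p))"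

definition sU :: "'o \<times> ('f, 'm) frob \<Rightarrow> ('o, 'f, 'm) scell" where
  "sU p = S (Em (fst p)) (Lf (fcar (snd p))) (unit (snd p))"

definition sD :: "'o \<times> ('f, 'm) frob \<Rightarrow> ('o, 'f, 'm) scell" where
  "sD p = S (Lf (fcar (snd p))) (Nd (Lf (fcar (snd p))) (Lf (fcar (snd p)))) (comult (snd p))"

definition sC :: "'o \<times> ('f, 'm) frob \<Rightarrow> ('o, 'f, 'm) scell" where
  "sC p = S (Lf (fcar (snd p))) (Em (fst p)) (counit (snd p))"

definition sL :: "('o, 'f, 'm) bimod \<Rightarrow> ('o, 'f, 'm) scell" where
  "sL X = S (Nd (Lf (fcar (talg X))) (Lf (bcar X))) (Lf (bcar X)) (lact X)"

definition sR :: "('o, 'f, 'm) bimod \<Rightarrow> ('o, 'f, 'm) scell" where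
  "sR X = S (Nd (Lf (bcar X)) (Lf (fcar (salg X)))) (Lf (bcar X)) (ract X)"

lemma s_dom_cod [simp]:
  "dm (sM p) = [fcar (snd p), fcar (snd p)]" "cd (sM p) = [fcar (snd p)]"
  "dm (sU p) = []" "cd (sU p) = [fcar (snd p)]"
  "dm (sD p) = [fcar (snd p)]" "cd (sD p) = [fcar (snd p), fcar (snd p)]"
  "dm (sC p) = [fcar (snd p)]" "cd (sC p) = []"
  "dm (sL X) = [fcar (talg X), bcar X]" "cd (sL X) = [bcar X]"
  "dm (sR X) = [bcar X, fcar (salg X)]" "cd (sR X) = [bcar X]"
  by (simp_all add: sM_def sU_def sD_def sC_def sL_def sR_def)

lemma obj_mem:
  assumes "obj p"
  defines "A \<equiv> fcar (snd p)"
  shows "A \<in> hom1 B (fst p) (fst p)" "mult (snd p) \<in> hom2 B (A \<otimes> A) A"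
      "unit (snd p) \<in> hom2 B (\<I> (fst p)) A"
    "comult (snd p) \<in> hom2 B A (A \<otimes> A)" "counit (snd p) \<in> hom2 B A (\<I> (fst p))"
proof -
  have "algebra B (fst p) A (mult (snd p)) (unit (snd p))"
      "coalgebra B (fst p) A (comult (snd p)) (counit (snd p))"
    using assms by (simp_all add: obj_def separable_frobenius_def frobenius_def Let_def)
  then show "A \<in> hom1 B (fst p) (fst p)" "mult (snd p) \<in> hom2 B (A \<otimes> A) A"
      "unit (snd p) \<in> hom2 B (\<I> (fst p)) A"
    "comult (snd p) \<in> hom2 B A (A \<otimes> A)" "counit (snd p) \<in> hom2 B A (\<I> (fst p))"
    unfolding algebra_def coalgebra_def by blast+
qed

lemma obj_typ [simp]:
  assumes "obj p"
  shows "fcar (snd p) \<in> Mor B" "src B (fcar (snd p)) = fst p" "trg B (fcar (snd p)) = fst p"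
      "fst p \<in> Obj B"
  using obj_mem(1)[OF assms] assms by (simp_all add: hom1_def obj_def)

lemma obj_rep:
  assumes "obj p"
  shows "rep (Nd (Lf (fcar (snd p))) (Lf (fcar (snd p)))) (Lf (fcar (snd p))) (mult (snd p)) (sM p)"
    "rep (Em (fst p)) (Lf (fcar (snd p))) (unit (snd p)) (sU p)"
    "rep (Lf (fcar (snd p))) (Nd (Lf (fcar (snd p))) (Lf (fcar (snd p)))) (comult (snd p)) (sD p)"
    "rep (Lf (fcar (snd p))) (Em (fst p)) (counit (snd p)) (sC p)"
  unfolding sM_def sU_def sD_def sC_def
  by (rule rep_prim; use assms obj_mem[OF assms] in simp)+

lemmas obj_valid [simp] = obj_rep[THEN rep_valid]

lemma obj_eqs:
  assumes "obj p"
  defines "A \<equiv> fcar (snd p)"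
  shows M_assoc: "sM p \<star> W [] (sM p) [A] = sM p \<star> W [A] (sM p) []"
    and M_unit: "sM p \<star> W [] (sU p) [A] = idc [A] (fst p)" "sM p \<star> W [A] (sU p) [] = idc [A] (fst p)"
    and D_counit: "W [] (sC p) [A] \<star> sD p = idc [A] (fst p)" "W [A] (sC p) [] \<star> sD p = idc [A] (fst p)"
    and frob: "W [A] (sM p) [] \<star> W [] (sD p) [A] = sD p \<star> sM p"
      "W [] (sM p) [A] \<star> W [A] (sD p) [] = sD p \<star> sM p"
    and MD: "sM p \<star> sD p = idc [A] (fst p)"
proof -
  note i = separable_frobenius_iff[of "Lf A" "snd p" "fst p", OF _ _ _
      obj_rep[OF assms(1), folded A_def], unfolded word.simps rev.simps append.simps]
  have "separable_frobenius B (fst p) (snd p)" using assms(1) by (simp add: obj_def)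
  note i[THEN iffD1, OF _ _ _ this, unfolded ev.simps A_def, OF refl obj_typ(2,3)[OF assms(1)]]
  then show "sM p \<star> W [] (sM p) [A] = sM p \<star> W [A] (sM p) []"
    "sM p \<star> W [] (sU p) [A] = idc [A] (fst p)" "sM p \<star> W [A] (sU p) [] = idc [A] (fst p)"
    "W [] (sC p) [A] \<star> sD p = idc [A] (fst p)" "W [A] (sC p) [] \<star> sD p = idc [A] (fst p)"
    "W [A] (sM p) [] \<star> W [] (sD p) [A] = sD p \<star> sM p"
    "W [] (sM p) [A] \<star> W [A] (sD p) [] = sD p \<star> sM p"
    "sM p \<star> sD p = idc [A] (fst p)"
    unfolding A_def by blast+
qed

lemma bim_mem:
  assumes "bim X"
  shows "bcar X \<in> hom1 B (fst (bsrc X)) (fst (btrg X))" "obj (bsrc X)" "obj (btrg X)"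
    "lact X \<in> hom2 B (fcar (talg X) \<otimes> bcar X) (bcar X)"
    "ract X \<in> hom2 B (bcar X \<otimes> fcar (salg X)) (bcar X)"
  using assms unfolding bim_def bimodule_def left_module_def right_module_def Let_def by blast+

lemma bim_typ [simp]:
  assumes "bim X"
  shows "bcar X \<in> Mor B" "src B (bcar X) = fst (bsrc X)" "trg B (bcar X) = fst (btrg X)"
    "obj (bsrc X)" "obj (btrg X)"
  using bim_mem[OF assms] by (simp_all add: hom1_def)

lemma bim_rep:
  assumes "bim X"
  shows "rep (Nd (Lf (fcar (talg X))) (Lf (bcar X))) (Lf (bcar X)) (lact X) (sL X)"
    "rep (Nd (Lf (bcar X)) (Lf (fcar (salg X)))) (Lf (bcar X)) (ract X) (sR X)"
  unfolding sL_def sR_def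
  by (rule rep_prim; use assms bim_mem[OF assms] in simp)+

lemmas bim_valid [simp] = bim_rep[THEN rep_valid]

lemma bim_iff:
  assumes o: "obj (bsrc X)" "obj (btrg X)"
    and X: "bcar X \<in> Mor B" "src B (bcar X) = fst (bsrc X)" "trg B (bcar X) = fst (btrg X)"
    and l: "lact X \<in> hom2 B (fcar (talg X) \<otimes> bcar X) (bcar X)"
    and r: "ract X \<in> hom2 B (bcar X \<otimes> fcar (salg X)) (bcar X)"
  defines "A \<equiv> fcar (salg X)" and "C \<equiv> fcar (talg X)"
  shows "bim X \<longleftrightarrow>
     sL X \<star> W [] (sM (btrg X)) [bcar X] = sL X \<star> W [C] (sL X) [] \<and>
     sL X \<star> W [] (sU (btrg X)) [bcar X] = idc [bcar X] (fst (bsrc X)) \<and>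
     sR X \<star> W [] (sR X) [A] = sR X \<star> W [bcar X] (sM (bsrc X)) [] \<and>
     sR X \<star> W [bcar X] (sU (bsrc X)) [] = idc [bcar X] (fst (bsrc X)) \<and>
     sR X \<star> W [] (sL X) [A] = sL X \<star> W [C] (sR X) []"
proof -
  have R: "rep (Nd (Lf (fcar (talg X))) (Lf (bcar X))) (Lf (bcar X)) (lact X) (sL X)"
    "rep (Nd (Lf (bcar X)) (Lf (fcar (salg X)))) (Lf (bcar X)) (ract X) (sR X)"
    unfolding sL_def sR_def using l r X o by (auto intro!: rep_prim)
  note t = o X obj_typ[OF o(1)] obj_typ[OF o(2)]
  have 1: "left_module B (talg X) (bcar X) (lact X) \<longleftrightarrow>
     sL X \<star> W [] (sM (btrg X)) [bcar X] = sL X \<star> W [C] (sL X) [] \<and>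
     sL X \<star> W [] (sU (btrg X)) [bcar X] = idc [bcar X] (fst (bsrc X))"
    using left_module_iff[of "Lf C" "talg X" "Lf (bcar X)" "bcar X" "fst (btrg X)" "fst (bsrc X)",
        OF _ _ _ _ _ obj_rep(1,2)[OF o(2), folded C_def] R(1)[folded C_def]] t(3-) by (simp add: C_def)
  have 2: "right_module B (salg X) (bcar X) (ract X) \<longleftrightarrow>
     sR X \<star> W [] (sR X) [A] = sR X \<star> W [bcar X] (sM (bsrc X)) [] \<and>
     sR X \<star> W [bcar X] (sU (bsrc X)) [] = idc [bcar X] (fst (bsrc X))"
    using right_module_iff[of "Lf A" "salg X" "Lf (bcar X)" "bcar X" "fst (bsrc X)",
        OF _ _ _ _ obj_rep(1,2)[OF o(1), folded A_def] R(2)[folded A_def]] t(3-) by (simp add: A_def)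
  have 3: "ract X \<cdot> (lact X \<odot> \<one> A) = lact X \<cdot> (\<one> C \<odot> ract X) \<cdot> \<aa> C (bcar X) A \<longleftrightarrow>
     sR X \<star> W [] (sL X) [A] = sL X \<star> W [C] (sR X) []"
    using bimodule_compat_iff[of "Lf C" C "Lf (bcar X)" "bcar X" "Lf A" A,
        OF _ _ _ R[folded A_def C_def]] by simp
  show ?thesis
    unfolding bim_def bimodule_def 1 2 3[unfolded A_def C_def] using o X
        by (simp add: hom1_def A_def C_def)
qed

lemma bim_eqs:
  assumes "bim X"
  defines "A \<equiv> fcar (salg X)" and "C \<equiv> fcar (talg X)"
  shows L_assoc: "sL X \<star> W [] (sM (btrg X)) [bcar X] = sL X \<star> W [C] (sL X) []"
    and L_unit: "sL X \<star> W [] (sU (btrg X)) [bcar X] = idc [bcar X] (fst (bsrc X))"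
    and R_assoc: "sR X \<star> W [] (sR X) [A] = sR X \<star> W [bcar X] (sM (bsrc X)) []"
    and R_unit: "sR X \<star> W [bcar X] (sU (bsrc X)) [] = idc [bcar X] (fst (bsrc X))"
    and RL: "sR X \<star> W [] (sL X) [A] = sL X \<star> W [C] (sR X) []"
proof -
  note bim_iff[of X, THEN iffD1, OF bim_typ(4,5,1,2,3)[OF assms(1)]
      repD(3)[OF bim_rep(1)[OF assms(1)], unfolded ev.simps]
          repD(3)[OF bim_rep(2)[OF assms(1)], unfolded ev.simps] assms(1)]
  then show "sL X \<star> W [] (sM (btrg X)) [bcar X] = sL X \<star> W [C] (sL X) []"
     "sL X \<star> W [] (sU (btrg X)) [bcar X] = idc [bcar X] (fst (bsrc X))"
     "sR X \<star> W [] (sR X) [A] = sR X \<star> W [bcar X] (sM (bsrc X)) []"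
     "sR X \<star> W [bcar X] (sU (bsrc X)) [] = idc [bcar X] (fst (bsrc X))"
     "sR X \<star> W [] (sL X) [A] = sL X \<star> W [C] (sR X) []"
    unfolding A_def C_def by blast+
qed

lemma bimodule_map_iff:
  assumes X: "bim X" and X': "bim X'" and e: "bsrc X' = bsrc X" "btrg X' = btrg X"
    and f: "f \<in> hom2 B (bcar X) (bcar X')"
  defines "F \<equiv> S (Lf (bcar X)) (Lf (bcar X')) f"
  shows "bimodule_map B X X' f \<longleftrightarrow>
     F \<star> sL X = sL X' \<star> W [fcar (talg X)] F [] \<and> F \<star> sR X = sR X' \<star> W [] F [fcar (salg X)]"
proof -
  have F: "rep (Lf (bcar X)) (Lf (bcar X')) f F" unfolding F_def using X X' f by (intro rep_prim) auto
  note R = F bim_rep[OF X] bim_rep[OF X', unfolded e]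
  have 1: "f \<cdot> lact X = lact X' \<cdot> (\<one> (fcar (talg X)) \<odot> f) \<longleftrightarrow> F \<star> sL X = sL X' \<star> W [fcar (talg X)] F []"
    by (rule rep_iff[of "Nd (Lf (fcar (talg X))) (Lf (bcar X))" "Lf (bcar X')"];
        (rule rep_cong, ((rule rep_rules R | (simp add: X; fail))+)))
  have 2: "f \<cdot> ract X = ract X' \<cdot> (f \<odot> \<one> (fcar (salg X))) \<longleftrightarrow> F \<star> sR X = sR X' \<star> W [] F [fcar (salg X)]"
    by (rule rep_iff[of "Nd (Lf (bcar X)) (Lf (fcar (salg X)))" "Lf (bcar X')"];
        (rule rep_cong, ((rule rep_rules R | (simp add: X; fail))+)))
  show ?thesis unfolding bimodule_map_def 1 2 using e f by simp
qed


section \<open>Rewriting inside whiskered composites\<close>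

lemma scomp_ctx: "F \<star> G = H \<Longrightarrow> F \<star> (G \<star> K) = H \<star> K"
  by (simp flip: scomp_assoc)

lemma whisker_eq: "F \<star> G = H \<Longrightarrow> W w F v \<star> W w G v = W w H v"
  by (simp flip: W_scomp)

text \<open>Whiskering by empty words does not change a valid cell, but it brings both sides into
  the shape to which \<open>strict_norm\<close> applies.\<close>

lemma strict_eqI:
  assumes "rep s t f F" "rep s t g G" "W [] F [] = W [] G []"
  shows "f = g"
  using assms(3) rep_iff[OF assms(1,2)] rep_valid[OF assms(1)] rep_valid[OF assms(2)] by simp

lemma strict_eqD:
  assumes "f = g" "rep s t f F" "rep s t g G"
  shows "W w F v = W w G v"
  using assms by (simp add: rep_def)

text \<open>The normal form is a right-nested composite whose factors are single generators
  whiskered by two explicit words. An equation that is general in both words matches there directly,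
  or through \<open>scomp_ctx\<close> when further factors follow.\<close>

lemmas strict_norm = W_scomp W_W scomp_assoc append.simps append_Nil2

text \<open>The identity may sit on any strand of the output, also on one that \<open>K\<close> does
  not touch; the equation between the two words says just this. An ill-typed \<open>K\<close> gives
  \<open>Nul\<close> on both sides.\<close>

lemma idc_left:
  assumes "x \<in> Mor B" "src B x = a" "valid K" "rev w @ x # v = rev w' @ cd K @ v'"
  shows "W w (idc [x] a) v \<star> W w' K v' = W w' K v'"
proof (cases "valid (W w' K v')")
  case True
  then obtain c d where cd: "pth c v' (so K)" "pth (tg K) (rev w') d" by (auto simp: W_valid)
  note s = W_sel[OF assms(3) cd]
  have "pth c (rev w @ [x] @ v) d" using valid_pth[OF True] s assms(4) by simp
  then obtain e where e: "pth c v a" "pth e (rev w) d" "e = trg B x"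
    using assms(1,2) by auto
  have "W w (idc [x] a) v = idc (rev w @ [x] @ v) c"
    using e assms(1,2) by (intro W_idc[of c v a "[x]" "trg B x" w d]) auto
  then show ?thesis using scomp_idc(2)[OF True] s assms(4) by simp
next
  case False
  then show ?thesis by (simp add: not_valid_W)
qed

lemma idc_right:
  assumes "x \<in> Mor B" "src B x = a" "valid K" "rev w @ x # v = rev w' @ dm K @ v'"
  shows "W w' K v' \<star> W w (idc [x] a) v = W w' K v'"
proof (cases "valid (W w' K v')")
  case True
  then obtain c d where cd: "pth c v' (so K)" "pth (tg K) (rev w') d" by (auto simp: W_valid)
  note s = W_sel[OF assms(3) cd]
  have "pth c (rev w @ [x] @ v) d" using valid_pth[OF True] s assms(4) by simp
  then obtain e where e: "pth c v a" "pth e (rev w) d" "e = trg B x"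
    using assms(1,2) by auto
  have "W w (idc [x] a) v = idc (rev w @ [x] @ v) c"
    using e assms(1,2) by (intro W_idc[of c v a "[x]" "trg B x" w d]) auto
  then show ?thesis using scomp_idc(1)[OF True] s assms(4) by simp
next
  case False
  then show ?thesis by (simp add: not_valid_W)
qed

lemma idc_left_ctx:
  assumes "x \<in> Mor B" "src B x = a" "valid K" "rev w @ x # v = rev w' @ cd K @ v'"
  shows "W w (idc [x] a) v \<star> W w' K v' \<star> L = W w' K v' \<star> L"
  by (rule scomp_ctx[OF idc_left[OF assms]])

section \<open>The separability element and the idempotent built from it\<close>

text \<open>The separability (Casimir) element of the algebra: a cell without input strands and with
  two output strands \<open>A\<close>.\<close>

definition sDU :: "'o \<times> ('f, 'm) frob \<Rightarrow> ('o, 'f, 'm) scell" where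
  "sDU p = sD p \<star> sU p"

lemma sDU_rep: "obj p \<Longrightarrow> rep (Em (fst p)) (Nd (Lf (fcar (snd p))) (Lf (fcar (snd p))))
    (comult (snd p) \<cdot> unit (snd p)) (sDU p)"
  unfolding sDU_def by (rule rep_comp[OF obj_rep(2) obj_rep(3)])

lemmas sDU_valid [simp] = sDU_rep[THEN rep_valid]

lemma sDU_dom_cod [simp]: "obj p \<Longrightarrow> dm (sDU p) = []" "obj p \<Longrightarrow> cd (sDU p) = [fcar (snd p), fcar (snd p)]"
  using repD(4)[OF sDU_rep] by simp_all

text \<open>Inserting the unit into the two Frobenius relations gives the first two equations; since
  both results are the comultiplication, the element is central. The third equation is separability
  and normalises it.\<close>

lemma sDU_M:
  assumes "obj p"
  defines "A \<equiv> fcar (snd p)"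
  shows "W w (sM p) (A # v) \<star> W (A # w) (sDU p) v = W w (sD p) v"
    "W (A # w) (sM p) v \<star> W w (sDU p) (A # v) = W w (sD p) v"
    "W w (sM p) v \<star> W w (sDU p) v = W w (sU p) v"
proof -
  note f = whisker_eq[OF frob(1)[OF assms(1)], of w v, simplified strict_norm]
      whisker_eq[OF frob(2)[OF assms(1)], of w v, simplified strict_norm]
  note u = whisker_eq[OF M_unit(1)[OF assms(1)], of w v, simplified strict_norm]
      whisker_eq[OF M_unit(2)[OF assms(1)], of w v, simplified strict_norm]
  note s = whisker_eq[OF MD[OF assms(1)], of w v]
  show "W w (sM p) (A # v) \<star> W (A # w) (sDU p) v = W w (sD p) v"
    unfolding sDU_def A_def using f u assms(1) by (simp add: strict_norm scomp_ctx[OF f(2)] idc_right)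
  show "W (A # w) (sM p) v \<star> W w (sDU p) (A # v) = W w (sD p) v"
    unfolding sDU_def A_def using f u assms(1) by (simp add: strict_norm scomp_ctx[OF f(1)] idc_right)
  show "W w (sM p) v \<star> W w (sDU p) v = W w (sU p) v"
    unfolding sDU_def using s assms(1) by (simp add: strict_norm scomp_ctx[OF s] idc_left)
qed

text \<open>
  The idempotent on \<open>Y \<otimes> X\<close> that projects onto the relative tensor product: insert
  \<open>\<Delta> \<circ> u\<close> in the middle and let the two legs act.
\<close>

definition bidem :: "('o, 'f, 'm) bimod \<Rightarrow> ('o, 'f, 'm) bimod \<Rightarrow> 'm" where
  "bidem Y X = (let A = fcar (talg X) in
     (ract Y \<odot> \<one> (bcar X)) \<cdot> inv2 (\<aa> (bcar Y) A (bcar X)) \<cdot>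
     (\<one> (bcar Y) \<odot> ((\<one> A \<odot> lact X) \<cdot> \<aa> A A (bcar X) \<cdot>
        ((comult (talg X) \<cdot> unit (talg X)) \<odot> \<one> (bcar X)) \<cdot> inv2 (\<ll> (bcar X)))))"

definition sE :: "('o, 'f, 'm) bimod \<Rightarrow> ('o, 'f, 'm) bimod \<Rightarrow> ('o, 'f, 'm) scell" where
  "sE Y X = S (Nd (Lf (bcar Y)) (Lf (bcar X))) (Nd (Lf (bcar Y)) (Lf (bcar X))) (bidem Y X)"

definition comp_ok :: "('o, 'f, 'm) bimod \<Rightarrow> ('o, 'f, 'm) bimod \<Rightarrow> bool" where
  "comp_ok Y X \<longleftrightarrow> bim Y \<and> bim X \<and> bsrc Y = btrg X"

lemma comp_okD [simp]:
  assumes "comp_ok Y X"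
  shows "bim Y" "bim X" "bsrc Y = btrg X"
  using assms by (auto simp: comp_ok_def)

lemma sE_rep:
  assumes "comp_ok Y X"
  shows "rep (Nd (Lf (bcar Y)) (Lf (bcar X))) (Nd (Lf (bcar Y)) (Lf (bcar X))) (bidem Y X) (sE Y X)"
    "sE Y X = W [] (sR Y) [bcar X] \<star> W [fcar (talg X), bcar Y] (sL X) []
        \<star> W [bcar Y] (sDU (btrg X)) [bcar X]"
proof -
  note c = comp_okD[OF assms]
  note t = bim_typ[OF c(1)] bim_typ[OF c(2)] obj_typ[OF bim_typ(5)[OF c(2)]]
  note r = bim_rep[OF c(1), unfolded c(3)] bim_rep[OF c(2)] sDU_rep[OF bim_typ(5)[OF c(2)]]
  have "rep (Nd (Lf (bcar Y)) (Lf (bcar X))) (Nd (Lf (bcar Y)) (Lf (bcar X))) (bidem Y X)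
    (W [] (sR Y) [bcar X] \<star> W [fcar (talg X), bcar Y] (sL X) [] \<star> W [bcar Y] (sDU (btrg X)) [bcar X])"
    unfolding bidem_def Let_def
    by (rule rep_cong, ((rule r rep_rules | (simp add: t c(3); fail))+), simp add: strict_norm)
  then show "rep (Nd (Lf (bcar Y)) (Lf (bcar X))) (Nd (Lf (bcar Y)) (Lf (bcar X))) (bidem Y X) (sE Y X)"
    "sE Y X = W [] (sR Y) [bcar X] \<star> W [fcar (talg X), bcar Y] (sL X) []
        \<star> W [bcar Y] (sDU (btrg X)) [bcar X]"
    by (auto simp: sE_def rep_def)
qed

lemma sE_expand:
  assumes "comp_ok Y X"
  shows "W w (sE Y X) v = W w (sR Y) (bcar X # v) \<star> W (fcar (talg X) # bcar Y # w) (sL X) v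
      \<star> W (bcar Y # w) (sDU (btrg X)) (bcar X # v)"
  by (simp add: sE_rep(2)[OF assms] strict_norm)

text \<open>Both sides reduce to one diagram: comultiply the middle strand and let one leg act on
  each side. Associativity merges the extra action with a leg of the separability element, and
  centrality makes the two results equal.\<close>

lemma sE_balanced:
  assumes "comp_ok Y X"
  shows "W w (sE Y X) v \<star> W w (sR Y) (bcar X # v) = W w (sE Y X) v \<star> W (bcar Y # w) (sL X) v"
proof -
  note c = comp_okD[OF assms]
  note t = bim_typ[OF c(1)] bim_typ[OF c(2)] bim_valid[OF c(1)] bim_valid[OF c(2)]
      sDU_valid[OF bim_typ(5)[OF c(2)]]
    sDU_dom_cod[OF bim_typ(5)[OF c(2)]]
  let ?A = "fcar (talg X)" let ?x = "bcar X" let ?y = "bcar Y" let ?p = "btrg X"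
  note R = whisker_eq[OF R_assoc[OF c(1)], simplified strict_norm c(3)]
  note L = whisker_eq[OF L_assoc[OF c(2)], simplified strict_norm]
  note d = sDU_M[OF bim_typ(5)[OF c(2)]]
  \<comment> \<open>The equations \<open>x1\<close> to \<open>x4\<close> are interchange laws; they
    bring the extra action next to the leg with which it is merged.\<close>
  have x1: "W (?y # w) (sDU ?p) (?x # v) \<star> W w (sR Y) (?x # v)
      = W w (sR Y) (?A # ?A # ?x # v) \<star> W (?A # ?y # w) (sDU ?p) (?x # v)" for w v
    using whisker_exchange[of "sR Y" "sDU ?p" w "[]" "?x # v"] t c by simp
  have x2: "W (?A # ?y # w) (sL X) v \<star> W w (sR Y) (?A # ?A # ?x # v)
      = W w (sR Y) (?A # ?x # v) \<star> W (?A # ?A # ?y # w) (sL X) v" for w v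
    using whisker_exchange[of "sR Y" "sL X" w "[?A]" "v"] t c by simp
  have x3: "W w (sM ?p) (?x # v) \<star> W (?A # ?A # w) (sL X) v
      = W (?A # w) (sL X) v \<star> W w (sM ?p) (?A # ?x # v)" for w v
    using whisker_exchange[of "sM ?p" "sL X" w "[]" "v"] t c by simp
  have x4: "W (?y # w) (sDU ?p) (?x # v) \<star> W (?y # w) (sL X) v
      = W (?A # ?A # ?y # w) (sL X) v \<star> W (?y # w) (sDU ?p) (?A # ?x # v)" for w v
    using whisker_exchange[of "sDU ?p" "sL X" "?y # w" "[]" "v"] t c by simp
  have "W w (sE Y X) v \<star> W w (sR Y) (?x # v) = W w (sR Y) (?x # v) \<star> W (?A # ?y # w) (sL X) v
      \<star> W (?y # w) (sD ?p) (?x # v)"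
    unfolding sE_expand[OF assms]
    by (simp only: scomp_assoc x1 x2 scomp_ctx[OF x2] R scomp_ctx[OF R] x3 scomp_ctx[OF x3] d)
  also have "\<dots> = W w (sE Y X) v \<star> W (?y # w) (sL X) v"
    unfolding sE_expand[OF assms]
    by (simp only: scomp_assoc x4 L[symmetric] scomp_ctx[OF L[symmetric]] d)
  finally show ?thesis .
qed

text \<open>If \<open>Q\<close> is balanced, both legs may be made to act on the same side. There
  associativity applies, the product of the two legs is the unit by separability, and the unit acts
  trivially.\<close>

lemma balanced_sE:
  assumes "comp_ok Y X"
    and q: "\<And>w v. W w Q v \<star> W w (sR Y) (bcar X # v) = W w Q v \<star> W (bcar Y # w) (sL X) v"
    and v: "valid Q" "dm Q = [bcar Y, bcar X]"
  shows "W w Q v \<star> W w (sE Y X) v = W w Q v"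
proof -
  note c = comp_okD[OF assms(1)]
  note L = whisker_eq[OF L_assoc[OF c(2)], simplified strict_norm]
  note d = sDU_M[OF bim_typ(5)[OF c(2)]]
  note u = whisker_eq[OF L_unit[OF c(2)], simplified strict_norm]
  show ?thesis
    unfolding sE_expand[OF assms(1)]
    by (simp only: scomp_assoc q scomp_ctx[OF q] L[symmetric] scomp_ctx[OF L[symmetric]] d u)
        (simp add: idc_right v c)
qed

lemma sE_idem:
  assumes "comp_ok Y X"
  shows "W w (sE Y X) v \<star> W w (sE Y X) v = W w (sE Y X) v"
  by (rule balanced_sE[OF assms sE_balanced[OF assms] rep_valid[OF sE_rep(1)[OF assms]]])
      (simp add: sE_def)

text \<open>The diagrams read back as equations between 2-cells of \<open>B\<close>, where the
  associator between the two actions reappears. The last item is the essential one for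
  factorisations: balanced maps absorb the idempotent.\<close>

lemma bidem_props:
  assumes "comp_ok Y X"
  defines "A \<equiv> fcar (talg X)" and "x \<equiv> bcar X" and "y \<equiv> bcar Y"
  shows "ract Y \<odot> \<one> x \<in> hom2 B ((y \<otimes> A) \<otimes> x) (y \<otimes> x)"
    "(\<one> y \<odot> lact X) \<cdot> \<aa> y A x \<in> hom2 B ((y \<otimes> A) \<otimes> x) (y \<otimes> x)"
    "bidem Y X \<in> hom2 B (y \<otimes> x) (y \<otimes> x)"
    "bidem Y X \<cdot> bidem Y X = bidem Y X"
    "bidem Y X \<cdot> (ract Y \<odot> \<one> x) = bidem Y X \<cdot> ((\<one> y \<odot> lact X) \<cdot> \<aa> y A x)"
    and balanced_bidem: "\<And>h Z. h \<in> hom2 B (y \<otimes> x) Z \<Longrightarrow> h \<cdot> (ract Y \<odot> \<one> x)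
        = h \<cdot> ((\<one> y \<odot> lact X) \<cdot> \<aa> y A x) \<Longrightarrow> h \<cdot> bidem Y X = h"
proof -
  note c = comp_okD[OF assms(1)]
  note t = bim_typ[OF c(1)] bim_typ[OF c(2)] obj_typ[OF bim_typ(5)[OF c(2)]]
  note r = bim_rep[OF c(1), unfolded c(3), folded A_def y_def] bim_rep[OF c(2), folded A_def x_def]
    sE_rep(1)[OF assms(1), folded x_def y_def]
  have 1: "rep (Nd (Nd (Lf y) (Lf A)) (Lf x)) (Nd (Lf y) (Lf x)) (ract Y \<odot> \<one> x) (W [] (sR Y) [x])"
    by (rule rep_cong, ((rule r rep_rules | (simp add: t c(3) A_def x_def y_def; fail))+))
  have 2: "rep (Nd (Nd (Lf y) (Lf A)) (Lf x)) (Nd (Lf y) (Lf x)) ((\<one> y \<odot> lact X) \<cdot> \<aa> y A x)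
      (W [y] (sL X) [])"
    by (rule rep_cong, ((rule r rep_rules | (simp add: t c(3) A_def x_def y_def; fail))+))
  note R = r(5) 1 2
  show "ract Y \<odot> \<one> x \<in> hom2 B ((y \<otimes> A) \<otimes> x) (y \<otimes> x)"
    "(\<one> y \<odot> lact X) \<cdot> \<aa> y A x \<in> hom2 B ((y \<otimes> A) \<otimes> x) (y \<otimes> x)"
    "bidem Y X \<in> hom2 B (y \<otimes> x) (y \<otimes> x)"
    using R[THEN repD(3)] by simp_all
  show "bidem Y X \<cdot> bidem Y X = bidem Y X"
    by (rule strict_eqI[OF rep_comp[OF R(1) R(1)] R(1)]) (simp add: strict_norm sE_idem[OF assms(1)])
  show "bidem Y X \<cdot> (ract Y \<odot> \<one> x) = bidem Y X \<cdot> ((\<one> y \<odot> lact X) \<cdot> \<aa> y A x)"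
    by (rule strict_eqI[OF rep_comp[OF R(2) R(1)] rep_comp[OF R(3) R(1)]])
      (simp add: strict_norm sE_balanced[OF assms(1)] x_def y_def)
  fix h Z assume h: "h \<in> hom2 B (y \<otimes> x) Z" "h \<cdot> (ract Y \<odot> \<one> x) = h \<cdot> ((\<one> y \<odot> lact X) \<cdot> \<aa> y A x)"
  have H: "rep (Nd (Lf y) (Lf x)) (Lf Z) h (S (Nd (Lf y) (Lf x)) (Lf Z) h)"
    using h(1) hom2_Mor[OF h(1)] t c by (intro rep_prim) (auto simp: x_def y_def)
  have b: "W w (S (Nd (Lf y) (Lf x)) (Lf Z) h) v \<star> W w (sR Y) (bcar X # v) =
     W w (S (Nd (Lf y) (Lf x)) (Lf Z) h) v \<star> W (bcar Y # w) (sL X) v" for w v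
    using strict_eqD[OF h(2) rep_comp[OF R(2) H] rep_comp[OF R(3) H], of w v]
        by (simp add: strict_norm x_def y_def)
  show "h \<cdot> bidem Y X = h"
    by (rule strict_eqI[OF rep_comp[OF R(1) H] H])
      (simp only: strict_norm, rule balanced_sE[OF assms(1) b rep_valid[OF H]], simp add: x_def y_def)
qed

end

section \<open>The equivariant completion\<close>

locale complete_bicategory = bicategory B for B :: "('o, 'f, 'm) bicat" (structure) +
  assumes idem_complete: "idempotent_complete B"
begin

text \<open>Idempotent completeness splits \<open>bidem\<close>. The retraction is a coequaliser
  because a map equalises the two actions exactly when it absorbs the idempotent.\<close>

lemma rel_coequaliser_ex:
  assumes "comp_ok Y X"
  shows "\<exists>q. is_coequaliser B (ract Y \<odot> \<one> (bcar X))
      ((\<one> (bcar Y) \<odot> lact X) \<cdot> \<aa> (bcar Y) (fcar (talg X)) (bcar X)) q"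
proof -
  let ?f = "ract Y \<odot> \<one> (bcar X)" and ?g = "(\<one> (bcar Y) \<odot> lact X) \<cdot> \<aa> (bcar Y) (fcar (talg X)) (bcar X)"
  let ?Q = "bcar Y \<otimes> bcar X" and ?P = "(bcar Y \<otimes> fcar (talg X)) \<otimes> bcar X"
  note p = bidem_props[OF assms]
  obtain Z r s where Z: "r \<in> hom2 B ?Q Z" "s \<in> hom2 B Z ?Q" "s \<cdot> r = bidem Y X" "r \<cdot> s = \<one> Z"
    using idem_complete p(3,4) hom2_Mor(1)[OF p(3)] unfolding idempotent_complete_def by blast
  have re: "r = r \<cdot> bidem Y X"
    using vcomp_assoc[OF Z(1,2,1)] Z(3,4) ident_vcomp[OF Z(1)] by simp
  have "is_coequaliser B ?f ?g r"
    unfolding is_coequaliser_def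
  proof (intro exI conjI allI impI)
    show "?f \<in> hom2 B ?P ?Q" "?g \<in> hom2 B ?P ?Q" "r \<in> hom2 B ?Q Z" by (rule p Z)+
    show "r \<cdot> ?f = r \<cdot> ?g"
      using re vcomp_assoc[OF p(1,3) Z(1)] vcomp_assoc[OF p(2,3) Z(1)] p(5) by metis
    fix V h assume h: "h \<in> hom2 B ?Q V \<and> h \<cdot> ?f = h \<cdot> ?g"
    \<comment> \<open>The factor is \<open>h \<cdot> s\<close>: it works because \<open>h\<close>
      absorbs the idempotent, and it is unique because \<open>r \<cdot> s\<close> is an
      identity.\<close>
    show "\<exists>!k. k \<in> hom2 B Z V \<and> k \<cdot> r = h"
    proof (rule ex1I[of _ "h \<cdot> s"])
      show "h \<cdot> s \<in> hom2 B Z V \<and> (h \<cdot> s) \<cdot> r = h"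
        using h vcomp_in[OF Z(2)] vcomp_assoc[OF Z(1,2)] Z(3) p(6) by metis
      fix k assume k: "k \<in> hom2 B Z V \<and> k \<cdot> r = h"
      then show "k = h \<cdot> s" using vcomp_assoc[OF Z(2,1)] Z(4) vcomp_ident by metis
    qed
  qed
  then show ?thesis by blast
qed

text \<open>\<open>bproj\<close> is an unspecified coequaliser and comes without a section. The
  idempotent, being balanced, factors through it, and the factor serves as section.\<close>

definition bsec :: "('o, 'f, 'm) bimod \<Rightarrow> ('o, 'f, 'm) bimod \<Rightarrow> 'm" where
  "bsec Y X = (SOME s. s \<in> hom2 B (bcar_comp B Y X) (bcar Y \<otimes> bcar X) \<and> s \<cdot> bproj B Y X = bidem Y X)"

lemma bproj_coequaliser:
  assumes "comp_ok Y X"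
  shows "is_coequaliser B (ract Y \<odot> \<one> (bcar X))
      ((\<one> (bcar Y) \<odot> lact X) \<cdot> \<aa> (bcar Y) (fcar (talg X)) (bcar X)) (bproj B Y X)"
  using someI_ex[OF rel_coequaliser_ex[OF assms]] by (simp add: bproj_def rel_proj_def)

lemma bproj_universal:
  assumes "comp_ok Y X"
  defines "f \<equiv> ract Y \<odot> \<one> (bcar X)" and "g \<equiv> (\<one> (bcar Y) \<odot> lact X)
      \<cdot> \<aa> (bcar Y) (fcar (talg X)) (bcar X)"
  shows "bproj B Y X \<in> hom2 B (bcar Y \<otimes> bcar X) (bcar_comp B Y X)"
    "bproj B Y X \<cdot> f = bproj B Y X \<cdot> g"
    "\<And>h Z. h \<in> hom2 B (bcar Y \<otimes> bcar X) Z \<Longrightarrow> h \<cdot> f = h \<cdot> g \<Longrightarrow>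
       \<exists>!k. k \<in> hom2 B (bcar_comp B Y X) Z \<and> k \<cdot> bproj B Y X = h"
proof -
  have e: "P = P' \<and> Q = Q'" if "f \<in> hom2 B P Q" "f \<in> hom2 B P' Q'" for f P Q P' Q'
    using that by (auto simp: hom2_def)
  obtain P Q T where c: "f \<in> hom2 B P Q" "bproj B Y X \<in> hom2 B Q T" "bproj B Y X \<cdot> f = bproj B Y X \<cdot> g"
    "\<And>h Z. h \<in> hom2 B Q Z \<Longrightarrow> h \<cdot> f = h \<cdot> g \<Longrightarrow> \<exists>!k. k \<in> hom2 B T Z \<and> k \<cdot> bproj B Y X = h"
    using bproj_coequaliser[OF assms(1)] unfolding is_coequaliser_def f_def g_def by blast
  have "Q = bcar Y \<otimes> bcar X" using e[OF c(1) bidem_props(1)[OF assms(1), folded f_def]] by simp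
  moreover have "T = bcar_comp B Y X" using c(2) by (simp add: hom2_def)
  ultimately show "bproj B Y X \<in> hom2 B (bcar Y \<otimes> bcar X) (bcar_comp B Y X)"
    "bproj B Y X \<cdot> f = bproj B Y X \<cdot> g"
    "\<And>h Z. h \<in> hom2 B (bcar Y \<otimes> bcar X) Z \<Longrightarrow> h \<cdot> f = h \<cdot> g \<Longrightarrow>
       \<exists>!k. k \<in> hom2 B (bcar_comp B Y X) Z \<and> k \<cdot> bproj B Y X = h"
    using c by simp_all
qed

text \<open>One composite is the idempotent by choice. For the other, both it and the identity
  become the projection after precomposition with the projection, which is epic as a
  coequaliser.\<close>

lemma bsec_props:
  assumes "comp_ok Y X"
  shows "bsec Y X \<in> hom2 B (bcar_comp B Y X) (bcar Y \<otimes> bcar X)"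
    "bsec Y X \<cdot> bproj B Y X = bidem Y X"
    "bproj B Y X \<cdot> bsec Y X = \<one> (bcar_comp B Y X)"
proof -
  note p = bidem_props[OF assms] note q = bproj_universal[OF assms]
  have "\<exists>s. s \<in> hom2 B (bcar_comp B Y X) (bcar Y \<otimes> bcar X) \<and> s \<cdot> bproj B Y X = bidem Y X"
    using q(3)[OF p(3,5)] by blast
  then have s: "bsec Y X \<in> hom2 B (bcar_comp B Y X) (bcar Y \<otimes> bcar X)"
      "bsec Y X \<cdot> bproj B Y X = bidem Y X"
    using someI_ex[of "\<lambda>s. s \<in> hom2 B (bcar_comp B Y X) (bcar Y \<otimes> bcar X) \<and> s \<cdot> bproj B Y X
        = bidem Y X"]
    unfolding bsec_def by blast+
  show "bsec Y X \<in> hom2 B (bcar_comp B Y X) (bcar Y \<otimes> bcar X)" "bsec Y X \<cdot> bproj B Y X = bidem Y X"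
    by (rule s)+
  have "(bproj B Y X \<cdot> bsec Y X) \<cdot> bproj B Y X = bproj B Y X"
    using vcomp_assoc[OF q(1) s(1) q(1)] s(2) p(6)[OF q(1,2)] by simp
  moreover have "\<one> (bcar_comp B Y X) \<cdot> bproj B Y X = bproj B Y X" by (rule ident_vcomp[OF q(1)])
  moreover have "bproj B Y X \<cdot> bsec Y X \<in> hom2 B (bcar_comp B Y X) (bcar_comp B Y X)"
    by (rule vcomp_in[OF s(1) q(1)])
  moreover have "\<one> (bcar_comp B Y X) \<in> hom2 B (bcar_comp B Y X) (bcar_comp B Y X)"
    using hom2_Mor(2)[OF q(1)] by (rule ident2_in)
  ultimately show "bproj B Y X \<cdot> bsec Y X = \<one> (bcar_comp B Y X)"
    using q(3)[OF q(1,2)] by blast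
qed


text \<open>Endpoints are read off the outermost letters, so that composability of whiskered cells
  is decided by simplification instead of by exhibiting paths.\<close>

lemma W_sel_valid:
  assumes "valid (W w F v)"
  shows "so (W w F v) = (if v = [] then so F else src B (last v))"
    "tg (W w F v) = (if w = [] then tg F else trg B (last w))"
    "dm (W w F v) = rev w @ dm F @ v" "cd (W w F v) = rev w @ cd F @ v"
proof -
  obtain a b where ab: "valid F" "pth a v (so F)" "pth (tg F) (rev w) b"
    using assms by (auto simp: W_valid)
  have src: "pth a v c \<Longrightarrow> a = (if v = [] then c else src B (last v))" for v c
    by (induction v arbitrary: c) (auto split: if_splits)
  have trg: "pth c (rev w) b \<Longrightarrow> b = (if w = [] then c else trg B (last w))" for w c
  proof (cases w rule: rev_cases)
    case (snoc ys y)
    then show "pth c (rev w) b \<Longrightarrow> ?thesis" by simp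
  qed simp
  show "so (W w F v) = (if v = [] then so F else src B (last v))"
    "tg (W w F v) = (if w = [] then tg F else trg B (last w))"
    "dm (W w F v) = rev w @ dm F @ v" "cd (W w F v) = rev w @ cd F @ v"
    using W_sel[OF ab] src[OF ab(2)] trg[OF ab(3)] by auto
qed

lemmas vsimps = scomp_valid W_valid W_sel_valid scomp_sel

lemma s_so_tg [simp]:
  "obj p \<Longrightarrow> so (sM p) = fst p" "obj p \<Longrightarrow> tg (sM p) = fst p"
  "obj p \<Longrightarrow> so (sU p) = fst p" "obj p \<Longrightarrow> tg (sU p) = fst p"
  "obj p \<Longrightarrow> so (sD p) = fst p" "obj p \<Longrightarrow> tg (sD p) = fst p"
  "obj p \<Longrightarrow> so (sC p) = fst p" "obj p \<Longrightarrow> tg (sC p) = fst p"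
  "bim X \<Longrightarrow> so (sL X) = fst (bsrc X)" "bim X \<Longrightarrow> tg (sL X) = fst (btrg X)"
  "bim X \<Longrightarrow> so (sR X) = fst (bsrc X)" "bim X \<Longrightarrow> tg (sR X) = fst (btrg X)"
  by (simp_all add: sM_def sU_def sD_def sC_def sL_def sR_def)

text \<open>Out of a split epimorphism \<open>e\<close> the only possible factor of \<open>h\<close>
  is \<open>h \<cdot> s\<close>, and it is one as soon as \<open>h\<close> absorbs
  \<open>s \<cdot> e\<close>. The descriptions of induced actions, horizontal composites and
  associators are resolved this way.\<close>

lemma the_factor:
  assumes e: "e \<in> hom2 B P Q" "s \<in> hom2 B Q P" "e \<cdot> s = \<one> Q" and h: "h \<in> hom2 B P R" "(h \<cdot> s) \<cdot> e = h"
  shows "(THE k. k \<in> hom2 B Q R \<and> k \<cdot> e = h) \<in> hom2 B Q R \<and> (THE k. k \<in> hom2 B Q R \<and> k \<cdot> e = h) \<cdot> e = h"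
proof (rule theI[where P = "\<lambda>k. k \<in> hom2 B Q R \<and> k \<cdot> e = h"])
  show "h \<cdot> s \<in> hom2 B Q R \<and> (h \<cdot> s) \<cdot> e = h" using vcomp_in[OF e(2) h(1)] h(2) by simp
  fix k assume k: "k \<in> hom2 B Q R \<and> k \<cdot> e = h"
  have "k = k \<cdot> (e \<cdot> s)" using k e(3) vcomp_ident by metis
  then show "k = h \<cdot> s" using k vcomp_assoc[OF e(2,1)] by metis
qed

text \<open>On \<open>Y\<close> the idempotent involves only the right action, which commutes with
  the left action by the bimodule law; the other cells pass by interchange. The mirror argument
  gives right linearity.\<close>

lemma sE_left_linear:
  assumes "comp_ok Y X"
  shows "W w (sE Y X) v \<star> W w (sL Y) (bcar X # v)
      = W w (sL Y) (bcar X # v) \<star> W (fcar (talg Y) # w) (sE Y X) v"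
proof -
  note c = comp_okD[OF assms]
  note t = bim_typ[OF c(1)] bim_typ[OF c(2)] bim_valid[OF c(1)] bim_valid[OF c(2)]
      sDU_valid[OF bim_typ(5)[OF c(2)]]
    sDU_dom_cod[OF bim_typ(5)[OF c(2)]]
  let ?A = "fcar (talg X)" let ?x = "bcar X" let ?y = "bcar Y" let ?p = "btrg X" let ?C
      = "fcar (talg Y)"
  note RL = whisker_eq[OF RL[OF c(1)], simplified strict_norm c(3)]
  have x1: "W (?y # w) (sDU ?p) (?x # v) \<star> W w (sL Y) (?x # v)
      = W w (sL Y) (?A # ?A # ?x # v) \<star> W (?y # ?C # w) (sDU ?p) (?x # v)" for w v
    using whisker_exchange[of "sL Y" "sDU ?p" w "[]" "?x # v"] t c by simp
  have x2: "W (?A # ?y # w) (sL X) v \<star> W w (sL Y) (?A # ?A # ?x # v)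
      = W w (sL Y) (?A # ?x # v) \<star> W (?A # ?y # ?C # w) (sL X) v" for w v
    using whisker_exchange[of "sL Y" "sL X" w "[?A]" "v"] t c by simp
  show ?thesis
    unfolding sE_expand[OF assms] by (simp only: scomp_assoc x1 x2 scomp_ctx[OF x2] RL scomp_ctx[OF RL])
qed

lemma sE_right_linear:
  assumes "comp_ok Y X"
  shows "W w (sE Y X) v \<star> W (bcar Y # w) (sR X) v
      = W (bcar Y # w) (sR X) v \<star> W w (sE Y X) (fcar (salg X) # v)"
proof -
  note c = comp_okD[OF assms]
  note t = bim_typ[OF c(1)] bim_typ[OF c(2)] bim_valid[OF c(1)] bim_valid[OF c(2)]
      sDU_valid[OF bim_typ(5)[OF c(2)]]
    sDU_dom_cod[OF bim_typ(5)[OF c(2)]]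
  let ?A = "fcar (talg X)" let ?x = "bcar X" let ?y = "bcar Y" let ?p = "btrg X" let ?C
      = "fcar (salg X)"
  note RL = whisker_eq[OF RL[OF c(2)], simplified strict_norm, symmetric]
  have x1: "W (?y # w) (sDU ?p) (?x # v) \<star> W (?y # w) (sR X) v
      = W (?A # ?A # ?y # w) (sR X) v \<star> W (?y # w) (sDU ?p) (?x # ?C # v)" for w v
    using whisker_exchange[of "sDU ?p" "sR X" "?y # w" "[]" "v"] t c by simp
  have x2: "W w (sR Y) (?x # v) \<star> W (?A # ?y # w) (sR X) v
      = W (?y # w) (sR X) v \<star> W w (sR Y) (?x # ?C # v)" for w v
    using whisker_exchange[of "sR Y" "sR X" w "[]" "v"] t c by simp
  show ?thesis
    unfolding sE_expand[OF assms] by (simp only: scomp_assoc x1 x2 scomp_ctx[OF x2] RL scomp_ctx[OF RL])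
qed


section \<open>Relative tensor products as split quotients, and their actions\<close>

definition sQ :: "('o, 'f, 'm) bimod \<Rightarrow> ('o, 'f, 'm) bimod \<Rightarrow> ('o, 'f, 'm) scell" where
  "sQ Y X = S (Nd (Lf (bcar Y)) (Lf (bcar X))) (Lf (bcar_comp B Y X)) (bproj B Y X)"

definition sS :: "('o, 'f, 'm) bimod \<Rightarrow> ('o, 'f, 'm) bimod \<Rightarrow> ('o, 'f, 'm) scell" where
  "sS Y X = S (Lf (bcar_comp B Y X)) (Nd (Lf (bcar Y)) (Lf (bcar X))) (bsec Y X)"

lemma QS_dom_cod [simp]:
  "dm (sQ Y X) = [bcar Y, bcar X]" "cd (sQ Y X) = [bcar_comp B Y X]"
  "cd (sS Y X) = [bcar Y, bcar X]" "dm (sS Y X) = [bcar_comp B Y X]"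
  by (simp_all add: sQ_def sS_def)

lemma bcar_comp_typ [simp]:
  assumes "comp_ok Y X"
  shows "bcar_comp B Y X \<in> Mor B" "src B (bcar_comp B Y X) = fst (bsrc X)"
      "trg B (bcar_comp B Y X) = fst (btrg Y)"
  using hom2_Mor[OF bproj_universal(1)[OF assms]] comp_okD[OF assms] by auto

lemma Q_rep:
  assumes "comp_ok Y X"
  shows "rep (Nd (Lf (bcar Y)) (Lf (bcar X))) (Lf (bcar_comp B Y X)) (bproj B Y X) (sQ Y X)"
    "rep (Lf (bcar_comp B Y X)) (Nd (Lf (bcar Y)) (Lf (bcar X))) (bsec Y X) (sS Y X)"
  unfolding sQ_def sS_def using bproj_universal(1)[OF assms] bsec_props(1)[OF assms] assms
  by (auto intro!: rep_prim)

lemmas Q_valid [simp] = Q_rep[THEN rep_valid]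

lemma QS_so_tg [simp]:
  assumes "comp_ok Y X"
  shows "so (sQ Y X) = fst (bsrc X)" "tg (sQ Y X) = fst (btrg Y)" "so (sS Y X) = fst (bsrc X)"
      "tg (sS Y X) = fst (btrg Y)"
  using assms by (simp_all add: sQ_def sS_def)

lemma proj_balanced:
  assumes "comp_ok Y X"
  shows "W w (sQ Y X) v \<star> W w (sR Y) (bcar X # v) = W w (sQ Y X) v \<star> W (bcar Y # w) (sL X) v"
proof -
  note c = comp_okD[OF assms]
  note t = bim_typ[OF c(1)] bim_typ[OF c(2)] obj_typ[OF bim_typ(5)[OF c(2)]]
  let ?x = "bcar X" and ?y = "bcar Y" and ?A = "fcar (talg X)"
  note r = bim_rep[OF c(1), unfolded c(3)] bim_rep[OF c(2)] Q_rep[OF assms]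
  have 1: "rep (Nd (Nd (Lf ?y) (Lf ?A)) (Lf ?x)) (Nd (Lf ?y) (Lf ?x)) (ract Y \<odot> \<one> ?x)
      (W [] (sR Y) [?x])"
    by (rule rep_cong, ((rule r rep_rules | (simp add: t c(3); fail))+))
  have 2: "rep (Nd (Nd (Lf ?y) (Lf ?A)) (Lf ?x)) (Nd (Lf ?y) (Lf ?x)) ((\<one> ?y \<odot> lact X) \<cdot> \<aa> ?y ?A ?x)
      (W [?y] (sL X) [])"
    by (rule rep_cong, ((rule r rep_rules | (simp add: t c(3); fail))+))
  show ?thesis
    using strict_eqD[OF bproj_universal(2)[OF assms] rep_comp[OF 1 r(5)] rep_comp[OF 2 r(5)], of w v]
    by (simp add: strict_norm)
qed

lemma proj_sec:
  assumes "comp_ok Y X"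
  shows "W w (sQ Y X) v \<star> W w (sS Y X) v = W w (idc [bcar_comp B Y X] (fst (bsrc X))) v"
proof -
  have i: "rep (Lf (bcar_comp B Y X)) (Lf (bcar_comp B Y X)) (\<one> (bcar_comp B Y X))
      (idc [bcar_comp B Y X] (fst (bsrc X)))"
    by (rule rep_cong[OF rep_ident]) (simp_all add: assms)
  show ?thesis
    using strict_eqD[OF bsec_props(3)[OF assms] rep_comp[OF Q_rep(2,1)[OF assms]] i, of w v]
    by (simp add: strict_norm)
qed

lemma sec_proj:
  assumes "comp_ok Y X"
  shows "W w (sS Y X) v \<star> W w (sQ Y X) v = W w (sE Y X) v"
  using strict_eqD[OF bsec_props(2)[OF assms] rep_comp[OF Q_rep(1,2)[OF assms]] sE_rep(1)[OF assms],
      of w v]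
  by (simp add: strict_norm)

lemma proj_idem:
  assumes "comp_ok Y X"
  shows "W w (sQ Y X) v \<star> W w (sE Y X) v = W w (sQ Y X) v"
  by (rule balanced_sE[OF assms proj_balanced[OF assms]]) (use assms in simp_all)

text \<open>The whiskered projection has the whiskered section as right inverse and is therefore
  epic. So an equation of maps out of a relative product may be checked on
  \<open>bcar Y \<otimes> bcar X\<close>, with arbitrary further strands on both sides.\<close>

lemma Q_cancel:
  assumes "comp_ok Y X" "valid F" "valid G"
    and "dm F = rev w @ bcar_comp B Y X # v" "dm G = rev w @ bcar_comp B Y X # v"
    and "W [] F [] \<star> W w (sQ Y X) v = W [] G [] \<star> W w (sQ Y X) v"
  shows "F = G"
proof -
  note c = comp_okD[OF assms(1)] bcar_comp_typ[OF assms(1)]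
  have "K = (W [] K [] \<star> W w (sQ Y X) v) \<star> W w (sS Y X) v"
    if "valid K" "dm K = rev w @ bcar_comp B Y X # v" for K
    using that c by (simp add: scomp_assoc proj_sec[OF assms(1)] idc_right del: W_unit) simp
  then show ?thesis using assms by metis
qed

lemma bcomp_sel [simp]:
  "bsrc (bcomp B Y X) = bsrc X" "btrg (bcomp B Y X) = btrg Y" "bcar (bcomp B Y X) = bcar_comp B Y X"
  by (simp_all add: bcomp_def Let_def)

text \<open>The two descriptions in \<open>bcomp\<close> are met because the projection stays split
  after tensoring with a carrier, and because the idempotent is linear for the outer
  actions.\<close>

lemma bcomp_act_mem:
  assumes "comp_ok Y X"
  defines "C \<equiv> fcar (talg Y)" and "A \<equiv> fcar (salg X)" and "T \<equiv> bcar_comp B Y X" and "x \<equiv> bcar X"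
      and "y \<equiv> bcar Y"
  shows "lact (bcomp B Y X) \<in> hom2 B (C \<otimes> T) T" "ract (bcomp B Y X) \<in> hom2 B (T \<otimes> A) T"
    "lact (bcomp B Y X) \<cdot> (\<one> C \<odot> bproj B Y X) = bproj B Y X \<cdot> (lact Y \<odot> \<one> x) \<cdot> inv2 (\<aa> C y x)"
    "ract (bcomp B Y X) \<cdot> (bproj B Y X \<odot> \<one> A) = bproj B Y X \<cdot> (\<one> y \<odot> ract X) \<cdot> \<aa> y x A"
proof -
  note c = comp_okD[OF assms(1)]
  note t = bim_typ[OF c(1)] bim_typ[OF c(2)] obj_typ[OF bim_typ(5)[OF c(1)]]
      obj_typ[OF bim_typ(4)[OF c(2)]] bcar_comp_typ[OF assms(1)]
  let ?q = "bproj B Y X" and ?s = "bsec Y X"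
  note r = Q_rep[OF assms(1), folded x_def y_def T_def] bim_rep(1)[OF c(1), folded C_def y_def]
      bim_rep(2)[OF c(2), folded x_def A_def]
  note S = t c(3) C_def A_def T_def x_def y_def
  have 1: "rep (Nd (Lf C) (Nd (Lf y) (Lf x))) (Nd (Lf C) (Lf T)) (\<one> C \<odot> ?q) (W [C] (sQ Y X) [])"
    by (rule rep_cong, ((rule r rep_rules | (simp add: S; fail))+))
  have 2: "rep (Nd (Lf C) (Lf T)) (Nd (Lf C) (Nd (Lf y) (Lf x))) (\<one> C \<odot> ?s) (W [C] (sS Y X) [])"
    by (rule rep_cong, ((rule r rep_rules | (simp add: S; fail))+))
  have 3: "rep (Nd (Lf C) (Nd (Lf y) (Lf x))) (Lf T) (?q \<cdot> (lact Y \<odot> \<one> x) \<cdot> inv2 (\<aa> C y x))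
      (sQ Y X \<star> W [] (sL Y) [x])"
    by (rule rep_cong, ((rule r rep_rules | (simp add: S; fail))+))
  have 4: "rep (Nd (Lf C) (Lf T)) (Nd (Lf C) (Lf T)) (\<one> (C \<otimes> T)) (idc [C, T] (fst (bsrc X)))"
    by (rule rep_cong[OF rep_ident]) (simp_all add: S)
  have idC: "W [C] (idc [T] (fst (bsrc X))) [] = idc [C, T] (fst (bsrc X))"
    using W_idc[of "fst (bsrc X)" "[]" "fst (bsrc X)" "[T]" "fst (btrg Y)" "[C]" "fst (btrg Y)"]
        by (simp add: S)
  have "lact (bcomp B Y X) = (THE k. k \<in> hom2 B (C \<otimes> T) T \<and> k \<cdot> (\<one> C \<odot> ?q)
      = ?q \<cdot> (lact Y \<odot> \<one> x) \<cdot> inv2 (\<aa> C y x))"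
    by (simp add: bcomp_def Let_def S)
  moreover have "\<dots> \<in> hom2 B (C \<otimes> T) T \<and> \<dots> \<cdot> (\<one> C \<odot> ?q) = ?q \<cdot> (lact Y \<odot> \<one> x) \<cdot> inv2 (\<aa> C y x)"
  proof (rule the_factor)
    show "\<one> C \<odot> ?q \<in> hom2 B (C \<otimes> (y \<otimes> x)) (C \<otimes> T)" "\<one> C \<odot> ?s \<in> hom2 B (C \<otimes> T) (C \<otimes> (y \<otimes> x))"
      "?q \<cdot> (lact Y \<odot> \<one> x) \<cdot> inv2 (\<aa> C y x) \<in> hom2 B (C \<otimes> (y \<otimes> x)) T"
      using repD(3)[OF 1] repD(3)[OF 2] repD(3)[OF 3] by simp_all
    show "(\<one> C \<odot> ?q) \<cdot> (\<one> C \<odot> ?s) = \<one> (C \<otimes> T)"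
      by (rule strict_eqI[OF rep_comp[OF 2 1] 4])
          (simp add: strict_norm proj_sec[OF assms(1)] idC[symmetric] flip: T_def)
    \<comment> \<open>Linearity carries the idempotent through the left action up to the projection,
      which absorbs it.\<close>
    note l = sE_left_linear[OF assms(1), symmetric, folded C_def x_def]
    show "((?q \<cdot> (lact Y \<odot> \<one> x) \<cdot> inv2 (\<aa> C y x)) \<cdot> (\<one> C \<odot> ?s)) \<cdot> (\<one> C \<odot> ?q)
        = ?q \<cdot> (lact Y \<odot> \<one> x) \<cdot> inv2 (\<aa> C y x)"
      by (rule strict_eqI[OF rep_comp[OF 1 rep_comp[OF 2 3]] 3])
       (simp only: strict_norm sec_proj[OF assms(1)] l proj_idem[OF assms(1)]
           scomp_ctx[OF proj_idem[OF assms(1)]])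
  qed
  ultimately show "lact (bcomp B Y X) \<in> hom2 B (C \<otimes> T) T"
    "lact (bcomp B Y X) \<cdot> (\<one> C \<odot> ?q) = ?q \<cdot> (lact Y \<odot> \<one> x) \<cdot> inv2 (\<aa> C y x)" by simp_all
  have 1: "rep (Nd (Nd (Lf y) (Lf x)) (Lf A)) (Nd (Lf T) (Lf A)) (?q \<odot> \<one> A) (W [] (sQ Y X) [A])"
    by (rule rep_cong, ((rule r rep_rules | (simp add: S; fail))+))
  have 2: "rep (Nd (Lf T) (Lf A)) (Nd (Nd (Lf y) (Lf x)) (Lf A)) (?s \<odot> \<one> A) (W [] (sS Y X) [A])"
    by (rule rep_cong, ((rule r rep_rules | (simp add: S; fail))+))
  have 3: "rep (Nd (Nd (Lf y) (Lf x)) (Lf A)) (Lf T) (?q \<cdot> (\<one> y \<odot> ract X) \<cdot> \<aa> y x A)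
      (sQ Y X \<star> W [y] (sR X) [])"
    by (rule rep_cong, ((rule r rep_rules | (simp add: S; fail))+))
  have 4: "rep (Nd (Lf T) (Lf A)) (Nd (Lf T) (Lf A)) (\<one> (T \<otimes> A)) (idc [T, A] (fst (bsrc X)))"
    by (rule rep_cong[OF rep_ident]) (simp_all add: S)
  have idA: "W [] (idc [T] (fst (bsrc X))) [A] = idc [T, A] (fst (bsrc X))"
    using W_idc[of "fst (bsrc X)" "[A]" "fst (bsrc X)" "[T]" "fst (btrg Y)" "[]" "fst (btrg Y)"]
        by (simp add: S)
  have "ract (bcomp B Y X) = (THE k. k \<in> hom2 B (T \<otimes> A) T \<and> k \<cdot> (?q \<odot> \<one> A)
      = ?q \<cdot> (\<one> y \<odot> ract X) \<cdot> \<aa> y x A)"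
    by (simp add: bcomp_def Let_def S)
  moreover have "\<dots> \<in> hom2 B (T \<otimes> A) T \<and> \<dots> \<cdot> (?q \<odot> \<one> A) = ?q \<cdot> (\<one> y \<odot> ract X) \<cdot> \<aa> y x A"
  proof (rule the_factor)
    show "?q \<odot> \<one> A \<in> hom2 B ((y \<otimes> x) \<otimes> A) (T \<otimes> A)" "?s \<odot> \<one> A \<in> hom2 B (T \<otimes> A) ((y \<otimes> x) \<otimes> A)"
      "?q \<cdot> (\<one> y \<odot> ract X) \<cdot> \<aa> y x A \<in> hom2 B ((y \<otimes> x) \<otimes> A) T"
      using repD(3)[OF 1] repD(3)[OF 2] repD(3)[OF 3] by simp_all
    show "(?q \<odot> \<one> A) \<cdot> (?s \<odot> \<one> A) = \<one> (T \<otimes> A)"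
      by (rule strict_eqI[OF rep_comp[OF 2 1] 4])
          (simp add: strict_norm proj_sec[OF assms(1)] idA[symmetric] flip: T_def)
    note l = sE_right_linear[OF assms(1), symmetric, folded A_def y_def]
    show "((?q \<cdot> (\<one> y \<odot> ract X) \<cdot> \<aa> y x A) \<cdot> (?s \<odot> \<one> A)) \<cdot> (?q \<odot> \<one> A) = ?q \<cdot> (\<one> y \<odot> ract X) \<cdot> \<aa> y x A"
      by (rule strict_eqI[OF rep_comp[OF 1 rep_comp[OF 2 3]] 3])
       (simp only: strict_norm sec_proj[OF assms(1)] l proj_idem[OF assms(1)]
           scomp_ctx[OF proj_idem[OF assms(1)]])
  qed
  ultimately show "ract (bcomp B Y X) \<in> hom2 B (T \<otimes> A) T"
    "ract (bcomp B Y X) \<cdot> (?q \<odot> \<one> A) = ?q \<cdot> (\<one> y \<odot> ract X) \<cdot> \<aa> y x A" by simp_all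
qed

lemma bcomp_rep:
  assumes "comp_ok Y X"
  shows "rep (Nd (Lf (fcar (talg Y))) (Lf (bcar_comp B Y X))) (Lf (bcar_comp B Y X))
      (lact (bcomp B Y X)) (sL (bcomp B Y X))"
    "rep (Nd (Lf (bcar_comp B Y X)) (Lf (fcar (salg X)))) (Lf (bcar_comp B Y X)) (ract (bcomp B Y X))
        (sR (bcomp B Y X))"
  using bcomp_act_mem(1,2)[OF assms] comp_okD[OF assms] assms
  by (auto simp: sL_def sR_def intro!: rep_prim)

lemma bcomp_act:
  assumes "comp_ok Y X"
  shows "W w (sL (bcomp B Y X)) v \<star> W (fcar (talg Y) # w) (sQ Y X) v
      = W w (sQ Y X) v \<star> W w (sL Y) (bcar X # v)"
    "W w (sR (bcomp B Y X)) v \<star> W w (sQ Y X) (fcar (salg X) # v)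
        = W w (sQ Y X) v \<star> W (bcar Y # w) (sR X) v"
proof -
  let ?C = "fcar (talg Y)" and ?A = "fcar (salg X)" and ?T = "bcar_comp B Y X" and ?x = "bcar X"
      and ?y = "bcar Y"
  note c = comp_okD[OF assms]
  note t = bim_typ[OF c(1)] bim_typ[OF c(2)] obj_typ[OF bim_typ(5)[OF c(1)]]
      obj_typ[OF bim_typ(4)[OF c(2)]] bcar_comp_typ[OF assms]
  note r = Q_rep[OF assms] bim_rep(1)[OF c(1)] bim_rep(2)[OF c(2)] bcomp_rep[OF assms]
  have 1: "rep (Nd (Lf ?C) (Nd (Lf ?y) (Lf ?x))) (Lf ?T) (lact (bcomp B Y X) \<cdot> (\<one> ?C \<odot> bproj B Y X))
      (sL (bcomp B Y X) \<star> W [?C] (sQ Y X) [])"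
    by (rule rep_cong, ((rule r rep_rules | (simp add: t c(3); fail))+))
  have 2: "rep (Nd (Lf ?C) (Nd (Lf ?y) (Lf ?x))) (Lf ?T)
      (bproj B Y X \<cdot> (lact Y \<odot> \<one> ?x) \<cdot> inv2 (\<aa> ?C ?y ?x)) (sQ Y X \<star> W [] (sL Y) [?x])"
    by (rule rep_cong, ((rule r rep_rules | (simp add: t c(3); fail))+))
  show "W w (sL (bcomp B Y X)) v \<star> W (?C # w) (sQ Y X) v = W w (sQ Y X) v \<star> W w (sL Y) (?x # v)"
    using strict_eqD[OF bcomp_act_mem(3)[OF assms] 1 2, of w v] by (simp only: strict_norm)
  have 1: "rep (Nd (Nd (Lf ?y) (Lf ?x)) (Lf ?A)) (Lf ?T) (ract (bcomp B Y X) \<cdot> (bproj B Y X \<odot> \<one> ?A))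
      (sR (bcomp B Y X) \<star> W [] (sQ Y X) [?A])"
    by (rule rep_cong, ((rule r rep_rules | (simp add: t c(3); fail))+))
  have 2: "rep (Nd (Nd (Lf ?y) (Lf ?x)) (Lf ?A)) (Lf ?T) (bproj B Y X \<cdot> (\<one> ?y \<odot> ract X) \<cdot> \<aa> ?y ?x ?A)
      (sQ Y X \<star> W [?y] (sR X) [])"
    by (rule rep_cong, ((rule r rep_rules | (simp add: t c(3); fail))+))
  show "W w (sR (bcomp B Y X)) v \<star> W w (sQ Y X) (?A # v) = W w (sQ Y X) v \<star> W (?y # w) (sR X) v"
    using strict_eqD[OF bcomp_act_mem(4)[OF assms] 1 2, of w v] by (simp only: strict_norm)
qed

lemma idc_valid_single [simp]: "x \<in> Mor B \<Longrightarrow> src B x = a \<Longrightarrow> valid (idc [x] a)"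
  using idc_valid[of "[x]" a] by auto

lemma idc_sel_single [simp]:
  assumes "x \<in> Mor B" "src B x = a"
  shows "so (idc [x] a) = a" "tg (idc [x] a) = trg B x" "dm (idc [x] a) = [x]" "cd (idc [x] a) = [x]"
  using idc_sel[of a "[x]" "trg B x"] assms by auto

text \<open>After precomposition with the projection, \<open>bcomp_act\<close> turns the left module
  axioms into those of \<open>Y\<close>, the right module axioms into those of \<open>X\<close>, and
  the compatibility of the two actions into interchange. The projection is cancelled at the
  end.\<close>

lemma bim_bcomp:
  assumes "comp_ok Y X"
  shows "bim (bcomp B Y X)"
proof -
  let ?C = "fcar (talg Y)" and ?A = "fcar (salg X)" and ?T = "bcar_comp B Y X" and ?x = "bcar X"
      and ?y = "bcar Y"
  let ?l = "sL (bcomp B Y X)" and ?r = "sR (bcomp B Y X)" and ?q = "sQ Y X"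
  let ?p = "btrg Y" and ?o = "bsrc X"
  note c = comp_okD[OF assms]
  note t = bim_typ[OF c(1)] bim_typ[OF c(2)] obj_typ[OF bim_typ(5)[OF c(1)]]
      obj_typ[OF bim_typ(4)[OF c(2)]] bcar_comp_typ[OF assms]
  have V: "valid ?l" "valid ?r" using bcomp_rep[OF assms] rep_valid by auto
  have st: "so ?l = fst ?o" "tg ?l = fst ?p" "so ?r = fst ?o" "tg ?r = fst ?p"
    using t by (simp_all add: sL_def sR_def)
  note vs = vsimps V st t assms
  note a = bcomp_act[OF assms]
  note L = whisker_eq[OF L_assoc[OF c(1)], simplified strict_norm]
      and Lu = whisker_eq[OF L_unit[OF c(1)], simplified strict_norm]
  note R = whisker_eq[OF R_assoc[OF c(2)], simplified strict_norm]
      and Ru = whisker_eq[OF R_unit[OF c(2)], simplified strict_norm]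
  have y1: "?l \<star> W [] (sM ?p) [?T] = ?l \<star> W [?C] ?l []"
  proof (rule Q_cancel[OF assms, of _ _ "[?C, ?C]" "[]"])
    have x: "W [] (sM ?p) [?T] \<star> W [?C, ?C] ?q [] = W [?C] ?q [] \<star> W [] (sM ?p) [?y, ?x]"
      using whisker_exchange[of "sM ?p" ?q "[]" "[]" "[]"] assms t by simp
    show "W [] (?l \<star> W [] (sM ?p) [?T]) [] \<star> W [?C, ?C] ?q []
        = W [] (?l \<star> W [?C] ?l []) [] \<star> W [?C, ?C] ?q []"
      by (simp only: strict_norm x a scomp_ctx[OF a(1)] L)
  qed (simp_all add: vs)
  have y2: "?l \<star> W [] (sU ?p) [?T] = idc [?T] (fst ?o)"
  proof (rule Q_cancel[OF assms, of _ _ "[]" "[]"])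
    have x: "W [] (sU ?p) [?T] \<star> W [] ?q [] = W [?C] ?q [] \<star> W [] (sU ?p) [?y, ?x]"
      using whisker_exchange[of "sU ?p" ?q "[]" "[]" "[]"] assms t by simp
    show "W [] (?l \<star> W [] (sU ?p) [?T]) [] \<star> W [] ?q [] = W [] (idc [?T] (fst ?o)) [] \<star> W [] ?q []"
      by (simp only: strict_norm x a scomp_ctx[OF a(1)] Lu)
          (simp only: idc_left idc_right t c assms Q_valid QS_dom_cod rev.simps append.simps)
  qed (simp_all add: vs)
  have y3: "?r \<star> W [] ?r [?A] = ?r \<star> W [?T] (sM ?o) []"
  proof (rule Q_cancel[OF assms, of _ _ "[]" "[?A, ?A]"])
    have x: "W [?T] (sM ?o) [] \<star> W [] ?q [?A, ?A] = W [] ?q [?A] \<star> W [?x, ?y] (sM ?o) []"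
      using whisker_exchange[of ?q "sM ?o" "[]" "[]" "[]"] assms t by simp
    show "W [] (?r \<star> W [] ?r [?A]) [] \<star> W [] ?q [?A, ?A]
        = W [] (?r \<star> W [?T] (sM ?o) []) [] \<star> W [] ?q [?A, ?A]"
      by (simp only: strict_norm x a scomp_ctx[OF a(2)] R)
  qed (simp_all add: vs)
  have y4: "?r \<star> W [?T] (sU ?o) [] = idc [?T] (fst ?o)"
  proof (rule Q_cancel[OF assms, of _ _ "[]" "[]"])
    have x: "W [?T] (sU ?o) [] \<star> W [] ?q [] = W [] ?q [?A] \<star> W [?x, ?y] (sU ?o) []"
      using whisker_exchange[of ?q "sU ?o" "[]" "[]" "[]"] assms t by simp
    show "W [] (?r \<star> W [?T] (sU ?o) []) [] \<star> W [] ?q [] = W [] (idc [?T] (fst ?o)) [] \<star> W [] ?q []"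
      by (simp only: strict_norm x a scomp_ctx[OF a(2)] Ru)
          (simp only: idc_left idc_right t c assms Q_valid QS_dom_cod rev.simps append.simps)
  qed (simp_all add: vs)
  have y5: "?r \<star> W [] ?l [?A] = ?l \<star> W [?C] ?r []"
  proof (rule Q_cancel[OF assms, of _ _ "[?C]" "[?A]"])
    have x: "W [] (sL Y) [?x] \<star> W [?y, ?C] (sR X) [] = W [?y] (sR X) [] \<star> W [] (sL Y) [?x, ?A]"
      using whisker_exchange[of "sL Y" "sR X" "[]" "[]" "[]"] c t by simp
    show "W [] (?r \<star> W [] ?l [?A]) [] \<star> W [?C] ?q [?A] = W [] (?l \<star> W [?C] ?r []) [] \<star> W [?C] ?q [?A]"
      by (simp only: strict_norm a scomp_ctx[OF a(1)] scomp_ctx[OF a(2)] x)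
  qed (simp_all add: vs)
  show ?thesis
    by (rule bim_iff[THEN iffD2])
      (use y1 y2 y3 y4 y5 t bcomp_act_mem(1,2)[OF assms] in \<open>simp_all only: bcomp_sel simp_thms\<close>)
qed


section \<open>2-morphisms and inverses in the completion\<close>

abbreviation Eq :: "('o \<times> ('f, 'm) frob, ('o, 'f, 'm) bimod, ('o, 'f, 'm) bimap) bicat" where
  "Eq \<equiv> equivariant_completion B"

lemma Eq_sel:
  "Obj Eq = {p. obj p}" "Mor Eq = {X. bim X}"
  "Cell Eq = {f. bim (mdom f) \<and> bim (mcod f) \<and> bimodule_map B (mdom f) (mcod f) (mcell f)}"
  "src Eq = bsrc" "trg Eq = btrg" "dom2 Eq = mdom" "cod2 Eq = mcod"
  "ident2 Eq X = \<lparr>mdom = X, mcod = X, mcell = \<one> (bcar X)\<rparr>"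
  "vcomp Eq g f = \<lparr>mdom = mdom f, mcod = mcod g, mcell = mcell g \<cdot> mcell f\<rparr>"
  "unit1 Eq = bunit" "tensor1 Eq = bcomp B" "tensor2 Eq = bcomp2 B" "associator Eq = bassoc B"
  "lunitor Eq = blunitor B" "runitor Eq = brunitor B"
  by (auto simp: equivariant_completion_def Let_def obj_def bim_def)

lemma hom2_Eq:
  "f \<in> hom2 Eq X Y \<longleftrightarrow> mdom f = X \<and> mcod f = Y \<and> bim X \<and> bim Y \<and> bimodule_map B X Y (mcell f)"
  by (auto simp: hom2_def Eq_sel)

lemma hom1_Eq: "X \<in> hom1 Eq p q \<longleftrightarrow> bim X \<and> bsrc X = p \<and> btrg X = q"
  by (auto simp: hom1_def Eq_sel)

lemma bimodule_map_hom2: "bimodule_map B X Y f \<Longrightarrow> f \<in> hom2 B (bcar X) (bcar Y)"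
  by (simp add: bimodule_map_def)

lemma bimodule_map_strict:
  assumes "bim X" "bim X'" "bimodule_map B X X' f"
  defines "F \<equiv> S (Lf (bcar X)) (Lf (bcar X')) f"
  shows "W w F v \<star> W w (sL X) v = W w (sL X') v \<star> W (fcar (talg X) # w) F v"
    "W w F v \<star> W w (sR X) v = W w (sR X') v \<star> W w F (fcar (salg X) # v)"
proof -
  have "bsrc X' = bsrc X" "btrg X' = btrg X" "f \<in> hom2 B (bcar X) (bcar X')"
    using assms(3) by (simp_all add: bimodule_map_def)
  note i = bimodule_map_iff[OF assms(1,2) this, THEN iffD1, OF assms(3), folded F_def]
  show "W w F v \<star> W w (sL X) v = W w (sL X') v \<star> W (fcar (talg X) # w) F v"
    using whisker_eq[OF conjunct1[OF i], of w v] by (simp only: strict_norm)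
  show "W w F v \<star> W w (sR X) v = W w (sR X') v \<star> W w F (fcar (salg X) # v)"
    using whisker_eq[OF conjunct2[OF i], of w v] by (simp only: strict_norm)
qed

lemma cell_rep:
  assumes "bim X" "bim Y" "f \<in> hom2 B (bcar X) (bcar Y)"
  shows "rep (Lf (bcar X)) (Lf (bcar Y)) f (S (Lf (bcar X)) (Lf (bcar Y)) f)"
  using assms by (intro rep_prim) auto

lemma inverse2_bimodule_map:
  assumes X: "bim X" "bim Y" "bimodule_map B X Y f" and i: "inverse2 B f g"
  shows "bimodule_map B Y X g"
proof -
  let ?F = "S (Lf (bcar X)) (Lf (bcar Y)) f" and ?G = "S (Lf (bcar Y)) (Lf (bcar X)) g"
  have f: "f \<in> hom2 B (bcar X) (bcar Y)" and e: "bsrc Y = bsrc X" "btrg Y = btrg X"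
    using X(3) by (simp_all add: bimodule_map_def)
  have g: "g \<in> hom2 B (bcar Y) (bcar X)" using i f by (auto simp: inverse2_def hom2_def)
  have gf: "g \<cdot> f = \<one> (bcar X)" "f \<cdot> g = \<one> (bcar Y)" using i f by (auto simp: inverse2_def hom2_def)
  note r = cell_rep[OF X(1,2) f] cell_rep[OF X(2,1) g]
  have i1: "rep (Lf (bcar X)) (Lf (bcar X)) (\<one> (bcar X)) (idc [bcar X] (fst (bsrc X)))"
    by (rule rep_cong[OF rep_ident]) (simp_all add: X)
  have i2: "rep (Lf (bcar Y)) (Lf (bcar Y)) (\<one> (bcar Y)) (idc [bcar Y] (fst (bsrc X)))"
    by (rule rep_cong[OF rep_ident]) (simp_all add: X e)
  note GF = strict_eqD[OF gf(1) rep_comp[OF r] i1, unfolded W_scomp]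
  note FG = strict_eqD[OF gf(2) rep_comp[OF r(2,1)] i2, unfolded W_scomp]
  note m = bimodule_map_strict[OF X]
  note V = rep_valid[OF r(1)] rep_valid[OF r(2)] bim_valid[OF X(1)] bim_valid[OF X(2)]
  note t = bim_typ[OF X(1)] bim_typ[OF X(2)] obj_typ[OF bim_typ(5)[OF X(1)]]
      obj_typ[OF bim_typ(4)[OF X(1)]]
  \<comment> \<open>An identity is inserted below the action and replaced by
    \<open>?F \<star> ?G\<close>; linearity moves \<open>?F\<close> above the action, where it
    cancels against the outer \<open>?G\<close>.\<close>
  have "W [] ?G [] \<star> W [] (sL Y) [] = W [] ?G [] \<star> W [] (sL Y) []
      \<star> W [fcar (talg X)] (idc [bcar Y] (fst (bsrc X))) []"
    using V t by (subst idc_right) (simp_all add: e)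
  also have "\<dots> = W [] (sL X) [] \<star> W [fcar (talg X)] ?G []"
    using V t X by (simp del: W_unit add: scomp_ctx[OF m(1)[symmetric]] scomp_ctx[OF GF] idc_left_ctx
        scomp_assoc flip: FG)
  finally have 1: "?G \<star> sL Y = sL X \<star> W [fcar (talg Y)] ?G []" using V by (simp add: e)
  have "W [] ?G [] \<star> W [] (sR Y) [] = W [] ?G [] \<star> W [] (sR Y) []
      \<star> W [] (idc [bcar Y] (fst (bsrc X))) [fcar (salg X)]"
    using V t by (subst idc_right) (simp_all add: e)
  also have "\<dots> = W [] (sR X) [] \<star> W [] ?G [fcar (salg X)]"
    using V t X by (simp del: W_unit add: scomp_ctx[OF m(2)[symmetric]] scomp_ctx[OF GF] idc_left_ctx
        scomp_assoc flip: FG)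
  finally have 2: "?G \<star> sR Y = sR X \<star> W [] ?G [fcar (salg Y)]" using V by (simp add: e)
  show ?thesis using 1 2 bimodule_map_iff[OF X(2,1) e[symmetric] g] by simp
qed

lemma inverse2_Eq:
  assumes "f \<in> hom2 Eq X Y" "inverse2 B (mcell f) k"
  shows "inverse2 Eq f \<lparr>mdom = Y, mcod = X, mcell = k\<rparr>"
proof -
  have f: "mdom f = X" "mcod f = Y" "bim X" "bim Y" "bimodule_map B X Y (mcell f)" using assms(1)
      by (auto simp: hom2_Eq)
  have m: "mcell f \<in> hom2 B (bcar X) (bcar Y)" using f(5) by (rule bimodule_map_hom2)
  have "bimodule_map B Y X k" by (rule inverse2_bimodule_map[OF f(3-5) assms(2)])
  then show ?thesis using f assms(2) m by (auto simp: inverse2_def hom2_Eq Eq_sel) (auto simp: hom2_def)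
qed

lemma inverse2_EqD:
  assumes "inverse2 Eq f g"
  shows "inverse2 B (mcell f) (mcell g)" "mdom g = mcod f" "mcod g = mdom f"
proof -
  have f: "bim (mdom f)" "bim (mcod f)" "bimodule_map B (mdom f) (mcod f) (mcell f)"
    "bimodule_map B (mcod f) (mdom f) (mcell g)" "mdom g = mcod f" "mcod g = mdom f"
    using assms by (auto simp: inverse2_def hom2_Eq Eq_sel)
  show "mdom g = mcod f" "mcod g = mdom f" by fact+
  show "inverse2 B (mcell f) (mcell g)"
    using assms bimodule_map_hom2[OF f(3)] bimodule_map_hom2[OF f(4)]
    by (auto simp: inverse2_def Eq_sel) (auto simp: hom2_def)
qed

text \<open>An inverse in \<open>B\<close> of a bimodule map is automatically linear, and inverses
  are unique; so inverses in the completion are computed in \<open>B\<close>.\<close>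

lemma inv2_Eq:
  assumes "f \<in> hom2 Eq X Y" "inverse2 B (mcell f) k"
  shows "inv2\<^bsub>Eq\<^esub> f = \<lparr>mdom = Y, mcod = X, mcell = k\<rparr>"
  unfolding inv2_def
proof (rule the_equality)
  show "inverse2 Eq f \<lparr>mdom = Y, mcod = X, mcell = k\<rparr>" by (rule inverse2_Eq[OF assms])
  fix g assume g: "inverse2 Eq f g"
  show "g = \<lparr>mdom = Y, mcod = X, mcell = k\<rparr>"
    using inverse2_EqD[OF g] inverse2_unique[OF assms(2)] assms(1) by (cases g) (auto simp: hom2_Eq)
qed

section \<open>Structure maps induced on relative tensor products\<close>

text \<open>The target projection after \<open>g \<odot> f\<close> is balanced, because
  \<open>f\<close> and \<open>g\<close> commute with the inner actions and the target projection is
  balanced itself. Hence it absorbs the idempotent and factors.\<close>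

lemma bcomp2_cell:
  assumes c: "comp_ok Y X" "comp_ok Y' X'"
    and g: "bimodule_map B Y Y' g" and f: "bimodule_map B X X' f"
  defines "h \<equiv> mcell (bcomp2 B \<lparr>mdom = Y, mcod = Y', mcell = g\<rparr> \<lparr>mdom = X, mcod = X', mcell = f\<rparr>)"
  shows "h \<in> hom2 B (bcar_comp B Y X) (bcar_comp B Y' X')"
    "h \<cdot> bproj B Y X = bproj B Y' X' \<cdot> (g \<odot> f)"
proof -
  note b = comp_okD[OF c(1)] comp_okD[OF c(2)]
  let ?x = "bcar X" and ?y = "bcar Y" and ?x' = "bcar X'" and ?y' = "bcar Y'" and ?A = "fcar (talg X)"
  let ?T = "bcar_comp B Y X" and ?T' = "bcar_comp B Y' X'"
  let ?F = "S (Lf ?x) (Lf ?x') f" and ?G = "S (Lf ?y) (Lf ?y') g"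
  have F: "rep (Lf ?x) (Lf ?x') f ?F" "rep (Lf ?y) (Lf ?y') g ?G"
    using cell_rep bimodule_map_hom2 f g b by auto
  have e: "bsrc Y' = bsrc Y" "btrg X' = btrg X" using f g by (simp_all add: bimodule_map_def)
  note r = F Q_rep[OF c(1)] Q_rep[OF c(2)]
  note t = bim_typ[OF b(1)] bim_typ[OF b(2)] bim_typ[OF b(4)] bim_typ[OF b(5)] b(3,6) e
  let ?H = "sQ Y' X' \<star> W [] ?G [?x'] \<star> W [?y] ?F []"
  have H: "rep (Nd (Lf ?y) (Lf ?x)) (Lf ?T') (bproj B Y' X' \<cdot> (g \<odot> f)) ?H"
    by (rule rep_cong, ((rule r rep_rules | (simp add: t; fail))+))
  note V = rep_valid[OF F(1)] rep_valid[OF F(2)] bim_valid[OF b(1)] bim_valid[OF b(2)]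
      bim_valid[OF b(4)] bim_valid[OF b(5)]
  note mf = bimodule_map_strict[OF b(2,5) f] and mg = bimodule_map_strict[OF b(1,4) g, unfolded b(3)]
  have x1: "W (?y # w) ?F v \<star> W w (sR Y) (?x # v) = W w (sR Y) (?x' # v) \<star> W (?A # ?y # w) ?F v" for w v
    using whisker_exchange[of "sR Y" ?F w "[]" v] V b(3) by simp
  have x2: "W w ?G (?x' # v) \<star> W (?y # w) (sL X') v = W (?y' # w) (sL X') v \<star> W w ?G (?A # ?x' # v)"
      for w v
    using whisker_exchange[of ?G "sL X'" w "[]" v] V e by simp
  have bal: "W w ?H v \<star> W w (sR Y) (?x # v) = W w ?H v \<star> W (?y # w) (sL X) v" for w v
    by (simp only: strict_norm x1 x2 scomp_ctx[OF x2] mf scomp_ctx[OF mf(1)] mg scomp_ctx[OF mg(2)]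
        proj_balanced[OF c(2)] scomp_ctx[OF proj_balanced[OF c(2)]])
  have HE: "W w ?H v \<star> W w (sE Y X) v = W w ?H v" for w v
    by (rule balanced_sE[OF c(1) bal rep_valid[OF H]]) (use repD(4)[OF H] in simp)
  have "h = (THE k. k \<in> hom2 B ?T ?T' \<and> k \<cdot> bproj B Y X = bproj B Y' X' \<cdot> (g \<odot> f))"
    by (simp add: h_def bcomp2_def)
  moreover have "\<dots> \<in> hom2 B ?T ?T' \<and> \<dots> \<cdot> bproj B Y X = bproj B Y' X' \<cdot> (g \<odot> f)"
  proof (rule the_factor[OF bproj_universal(1)[OF c(1)] bsec_props(1,3)[OF c(1)]])
    show "bproj B Y' X' \<cdot> (g \<odot> f) \<in> hom2 B (?y \<otimes> ?x) ?T'" using repD(3)[OF H] by simp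
    show "((bproj B Y' X' \<cdot> (g \<odot> f)) \<cdot> bsec Y X) \<cdot> bproj B Y X = bproj B Y' X' \<cdot> (g \<odot> f)"
      by (rule strict_eqI[OF rep_comp[OF r(3) rep_comp[OF r(4) H]] H])
        (simp only: strict_norm sec_proj[OF c(1)] HE[unfolded strict_norm])
  qed
  ultimately show "h \<in> hom2 B ?T ?T'" "h \<cdot> bproj B Y X = bproj B Y' X' \<cdot> (g \<odot> f)" by simp_all
qed

lemma comp_ok_bcomp:
  assumes "comp_ok Z Y" "comp_ok Y X"
  shows "comp_ok (bcomp B Z Y) X" "comp_ok Z (bcomp B Y X)"
proof -
  note b = comp_okD[OF assms(1)] comp_okD[OF assms(2)] bim_bcomp[OF assms(1)] bim_bcomp[OF assms(2)]
  show "comp_ok (bcomp B Z Y) X" "comp_ok Z (bcomp B Y X)"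
    unfolding comp_ok_def using b by simp_all
qed

text \<open>The inner action on a relative product is induced from that of the adjacent factor. The
  projection therefore intertwines the idempotent of the composite bimodule with the idempotent of
  the adjacent pair.\<close>

lemma sE_bcomp:
  assumes "comp_ok Z Y" "comp_ok Y X"
  shows "W w (sE (bcomp B Z Y) X) v \<star> W w (sQ Z Y) (bcar X # v)
      = W w (sQ Z Y) (bcar X # v) \<star> W (bcar Z # w) (sE Y X) v"
    "W w (sE Z (bcomp B Y X)) v \<star> W (bcar Z # w) (sQ Y X) v
        = W (bcar Z # w) (sQ Y X) v \<star> W w (sE Z Y) (bcar X # v)"
proof -
  note b = comp_okD[OF assms(1)] comp_okD[OF assms(2)]
  have c: "comp_ok (bcomp B Z Y) X" "comp_ok Z (bcomp B Y X)"
    by (rule comp_ok_bcomp[OF assms])+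
  note V = bim_valid[OF b(1)] bim_valid[OF b(2)] bim_valid[OF b(5)] sDU_valid[OF bim_typ(5)[OF b(2)]]
      sDU_valid[OF bim_typ(5)[OF b(5)]]
    sDU_dom_cod[OF bim_typ(5)[OF b(2)]] sDU_dom_cod[OF bim_typ(5)[OF b(5)]] b(3,6)
        Q_valid[OF assms(1)] Q_valid[OF assms(2)]
  let ?x = "bcar X" and ?y = "bcar Y" and ?z = "bcar Z" and ?A = "fcar (talg X)"
      and ?C = "fcar (talg Y)"
  have x1: "W (bcar_comp B Z Y # w) (sDU (btrg X)) (?x # v) \<star> W w (sQ Z Y) (?x # v)
      = W w (sQ Z Y) (?A # ?A # ?x # v) \<star> W (?y # ?z # w) (sDU (btrg X)) (?x # v)" for w v
    using whisker_exchange[of "sQ Z Y" "sDU (btrg X)" w "[]" "?x # v"] V by simp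
  have x2: "W (?A # bcar_comp B Z Y # w) (sL X) v \<star> W w (sQ Z Y) (?A # ?A # ?x # v)
      = W w (sQ Z Y) (?A # ?x # v) \<star> W (?A # ?y # ?z # w) (sL X) v" for w v
    using whisker_exchange[of "sQ Z Y" "sL X" w "[?A]" v] V by simp
  note a1 = bcomp_act(2)[OF assms(1), unfolded b(6)]
  show "W w (sE (bcomp B Z Y) X) v \<star> W w (sQ Z Y) (?x # v)
      = W w (sQ Z Y) (?x # v) \<star> W (?z # w) (sE Y X) v"
    unfolding sE_expand[OF c(1)] sE_expand[OF assms(2)] bcomp_sel
    by (simp only: scomp_assoc x1 x2 scomp_ctx[OF x2] a1 scomp_ctx[OF a1])
  have x3: "W (?z # w) (sDU (btrg Y)) (bcar_comp B Y X # v) \<star> W (?z # w) (sQ Y X) v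
      = W (?C # ?C # ?z # w) (sQ Y X) v \<star> W (?z # w) (sDU (btrg Y)) (?y # ?x # v)" for w v
    using whisker_exchange[of "sDU (btrg Y)" "sQ Y X" "?z # w" "[]" v] V by simp
  have x4: "W w (sR Z) (bcar_comp B Y X # v) \<star> W (?C # ?z # w) (sQ Y X) v
      = W (?z # w) (sQ Y X) v \<star> W w (sR Z) (?y # ?x # v)" for w v
    using whisker_exchange[of "sR Z" "sQ Y X" w "[]" v] V by simp
  note a2 = bcomp_act(1)[OF assms(2)]
  show "W w (sE Z (bcomp B Y X)) v \<star> W (?z # w) (sQ Y X) v
      = W (?z # w) (sQ Y X) v \<star> W w (sE Z Y) (?x # v)"
    unfolding sE_expand[OF c(2)] sE_expand[OF assms(1)] bcomp_sel
    by (simp only: scomp_assoc x3 a2 scomp_ctx[OF a2] x4 scomp_ctx[OF x4])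
qed

text \<open>The iterated projections \<open>?e1\<close> and \<open>?e2\<close> start from the two
  bracketings of the triple product, are split by \<open>?s1\<close> and \<open>?s2\<close>, and
  both absorb the idempotents of the two neighbouring pairs. They present the same quotient, so the
  associator of \<open>B\<close> descends to an isomorphism.\<close>

lemma bassoc_cell:
  assumes "comp_ok Z Y" "comp_ok Y X"
  defines "T \<equiv> bcar_comp B (bcomp B Z Y) X" and "T' \<equiv> bcar_comp B Z (bcomp B Y X)"
  shows "mcell (bassoc B Z Y X) \<in> hom2 B T T'"
    "W w (S (Lf T) (Lf T') (mcell (bassoc B Z Y X))) v \<star> W w (sQ (bcomp B Z Y) X) v
        \<star> W w (sQ Z Y) (bcar X # v) =
       W w (sQ Z (bcomp B Y X)) v \<star> W (bcar Z # w) (sQ Y X) v"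
    "\<exists>k. inverse2 B (mcell (bassoc B Z Y X)) k"
    "bassoc B Z Y X \<in> hom2 Eq (bcomp B (bcomp B Z Y) X) (bcomp B Z (bcomp B Y X))"
proof -
  note b = comp_okD[OF assms(1)] comp_okD[OF assms(2)]
  have c: "comp_ok (bcomp B Z Y) X" "comp_ok Z (bcomp B Y X)"
    by (rule comp_ok_bcomp[OF assms(1,2)])+
  let ?x = "bcar X" and ?y = "bcar Y" and ?z = "bcar Z"
  let ?ZY = "bcar_comp B Z Y" and ?YX = "bcar_comp B Y X"
  let ?e1 = "bproj B (bcomp B Z Y) X \<cdot> (bproj B Z Y \<odot> \<one> ?x)"
  let ?e2 = "bproj B Z (bcomp B Y X) \<cdot> (\<one> ?z \<odot> bproj B Y X)"
  let ?s1 = "(bsec Z Y \<odot> \<one> ?x) \<cdot> bsec (bcomp B Z Y) X"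
  let ?s2 = "(\<one> ?z \<odot> bsec Y X) \<cdot> bsec Z (bcomp B Y X)"
  note t = bim_typ[OF b(1)] bim_typ[OF b(2)] bim_typ[OF b(5)] b(3,6) bcar_comp_typ[OF assms(1)]
      bcar_comp_typ[OF assms(2)]
    bcar_comp_typ[OF c(1)] bcar_comp_typ[OF c(2)]
  note r = Q_rep[OF assms(1)] Q_rep[OF assms(2)] Q_rep[OF c(1), unfolded bcomp_sel, folded T_def]
      Q_rep[OF c(2), unfolded bcomp_sel, folded T'_def]
  let ?L = "Nd (Nd (Lf ?z) (Lf ?y)) (Lf ?x)" and ?R = "Nd (Lf ?z) (Nd (Lf ?y) (Lf ?x))"
  have e1: "rep ?L (Lf T) ?e1 (sQ (bcomp B Z Y) X \<star> W [] (sQ Z Y) [?x])"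
    by (rule rep_cong, ((rule r rep_rules | (simp add: t; fail))+))
  have e2: "rep ?R (Lf T') ?e2 (sQ Z (bcomp B Y X) \<star> W [?z] (sQ Y X) [])"
    by (rule rep_cong, ((rule r rep_rules | (simp add: t; fail))+))
  have s1: "rep (Lf T) ?L ?s1 (W [] (sS Z Y) [?x] \<star> sS (bcomp B Z Y) X)"
    by (rule rep_cong, ((rule r rep_rules | (simp add: t; fail))+))
  have s2: "rep (Lf T') ?R ?s2 (W [?z] (sS Y X) [] \<star> sS Z (bcomp B Y X))"
    by (rule rep_cong, ((rule r rep_rules | (simp add: t; fail))+))
  have h: "rep ?L (Lf T') (bproj B Z (bcomp B Y X) \<cdot> (\<one> ?z \<odot> bproj B Y X) \<cdot> \<aa> ?z ?y ?x)
      (sQ Z (bcomp B Y X) \<star> W [?z] (sQ Y X) [])"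
    by (rule rep_cong, ((rule r rep_rules | (simp add: t; fail))+))
  have k: "rep ?R (Lf T) (bproj B (bcomp B Z Y) X \<cdot> (bproj B Z Y \<odot> \<one> ?x) \<cdot> inv2 (\<aa> ?z ?y ?x))
      (sQ (bcomp B Z Y) X \<star> W [] (sQ Z Y) [?x])"
    by (rule rep_cong, ((rule r rep_rules | (simp add: t; fail))+))
  note E = sE_bcomp[OF assms(1,2)]
  note q = proj_idem[OF assms(1)] proj_idem[OF assms(2)] proj_idem[OF c(1)] proj_idem[OF c(2)]
  note sq = sec_proj[OF assms(1)] sec_proj[OF assms(2)] sec_proj[OF c(1), unfolded bcomp_sel]
      sec_proj[OF c(2), unfolded bcomp_sel]
  note ids = proj_sec[OF assms(1)] proj_sec[OF assms(2)] proj_sec[OF c(1), unfolded bcomp_sel]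
      proj_sec[OF c(2), unfolded bcomp_sel]
  \<comment> \<open>The idempotent belonging to the iterated quotient is the product of the
    idempotents of the two neighbouring pairs.\<close>
  have S1Q1: "W w (sS Z Y) (?x # v) \<star> W w (sS (bcomp B Z Y) X) v \<star> W w (sQ (bcomp B Z Y) X) v
      \<star> W w (sQ Z Y) (?x # v)
     = W w (sE Z Y) (?x # v) \<star> W (?z # w) (sE Y X) v" for w v
    by (simp only: scomp_assoc sq scomp_ctx[OF sq(3)] E scomp_ctx[OF sq(1)])
  have S2Q2: "W (?z # w) (sS Y X) v \<star> W w (sS Z (bcomp B Y X)) v \<star> W w (sQ Z (bcomp B Y X)) v
      \<star> W (?z # w) (sQ Y X) v
     = W (?z # w) (sE Y X) v \<star> W w (sE Z Y) (?x # v)" for w v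
    by (simp only: scomp_assoc sq scomp_ctx[OF sq(4)] E scomp_ctx[OF sq(2)])
  have Q1: "W w (sQ (bcomp B Z Y) X) v \<star> W w (sQ Z Y) (?x # v) \<star> W (?z # w) (sE Y X) v
      = W w (sQ (bcomp B Z Y) X) v \<star> W w (sQ Z Y) (?x # v)" for w v
    by (simp only: E[symmetric]) (simp only: scomp_ctx[OF q(3)])
  have Q2: "W w (sQ Z (bcomp B Y X)) v \<star> W (?z # w) (sQ Y X) v \<star> W w (sE Z Y) (?x # v)
      = W w (sQ Z (bcomp B Y X)) v \<star> W (?z # w) (sQ Y X) v" for w v
    by (simp only: E[symmetric]) (simp only: scomp_ctx[OF q(4)])
  have es1: "?e1 \<cdot> ?s1 = \<one> T"
    by (rule strict_eqI[OF rep_comp[OF s1 e1] rep_ident[of "Lf T"]])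
      (use t c assms(1,2) in \<open>simp_all add: T_def strict_norm scomp_ctx[OF ids(1)] ids idc_left del:
          W_unit\<close>)
  have a: "mcell (bassoc B Z Y X) = (THE k. k \<in> hom2 B T T' \<and> k \<cdot> ?e1
      = bproj B Z (bcomp B Y X) \<cdot> (\<one> ?z \<odot> bproj B Y X) \<cdot> \<aa> ?z ?y ?x)"
    by (simp add: bassoc_def T_def T'_def)
  have "\<dots> \<in> hom2 B T T' \<and> \<dots> \<cdot> ?e1 = bproj B Z (bcomp B Y X) \<cdot> (\<one> ?z \<odot> bproj B Y X) \<cdot> \<aa> ?z ?y ?x"
  proof (rule the_factor)
    show "?e1 \<in> hom2 B ((?z \<otimes> ?y) \<otimes> ?x) T" "?s1 \<in> hom2 B T ((?z \<otimes> ?y) \<otimes> ?x)"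
      "bproj B Z (bcomp B Y X) \<cdot> (\<one> ?z \<odot> bproj B Y X) \<cdot> \<aa> ?z ?y ?x \<in> hom2 B ((?z \<otimes> ?y) \<otimes> ?x) T'"
      using repD(3)[OF e1] repD(3)[OF s1] repD(3)[OF h] by simp_all
    show "?e1 \<cdot> ?s1 = \<one> T" by (rule es1)
    show "((bproj B Z (bcomp B Y X) \<cdot> (\<one> ?z \<odot> bproj B Y X) \<cdot> \<aa> ?z ?y ?x) \<cdot> ?s1) \<cdot> ?e1
        = bproj B Z (bcomp B Y X) \<cdot> (\<one> ?z \<odot> bproj B Y X) \<cdot> \<aa> ?z ?y ?x"
      by (rule strict_eqI[OF rep_comp[OF e1 rep_comp[OF s1 h]] h])
       (simp only: strict_norm S1Q1, simp only: Q2[THEN scomp_ctx, unfolded scomp_assoc] q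
           scomp_ctx[OF q(2)])
  qed
  then have h1: "mcell (bassoc B Z Y X) \<in> hom2 B T T'"
    and h2: "mcell (bassoc B Z Y X) \<cdot> ?e1 = bproj B Z (bcomp B Y X) \<cdot> (\<one> ?z \<odot> bproj B Y X) \<cdot> \<aa> ?z ?y ?x"
    by (simp_all add: a)
  show "mcell (bassoc B Z Y X) \<in> hom2 B T T'" by (rule h1)
  let ?H = "S (Lf T) (Lf T') (mcell (bassoc B Z Y X))"
  have H: "rep (Lf T) (Lf T') (mcell (bassoc B Z Y X)) ?H"
    using h1 t by (intro rep_prim) (auto simp: T_def T'_def)
  show H2: "W w ?H v \<star> W w (sQ (bcomp B Z Y) X) v \<star> W w (sQ Z Y) (?x # v) =
       W w (sQ Z (bcomp B Y X)) v \<star> W (?z # w) (sQ Y X) v" for w v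
    using strict_eqD[OF h2 rep_comp[OF e1 H] h, of w v] by (simp only: strict_norm)
  \<comment> \<open>The candidate inverse: include the other iterated quotient into the triple
    product, rebracket and project.\<close>
  let ?g = "(bproj B (bcomp B Z Y) X \<cdot> (bproj B Z Y \<odot> \<one> ?x) \<cdot> inv2 (\<aa> ?z ?y ?x)) \<cdot> ?s2"
  let ?G = "S (Lf T') (Lf T) ?g"
  have g: "rep (Lf T') (Lf T) ?g ?G" "?G = (sQ (bcomp B Z Y) X \<star> W [] (sQ Z Y) [?x])
      \<star> (W [?z] (sS Y X) [] \<star> sS Z (bcomp B Y X))"
    using rep_comp[OF s2 k] by (auto simp: rep_def)
  have G2: "W w ?G v \<star> W w (sQ Z (bcomp B Y X)) v \<star> W (?z # w) (sQ Y X) v =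
       W w (sQ (bcomp B Z Y) X) v \<star> W w (sQ Z Y) (?x # v)" for w v
    unfolding g(2) by (simp only: strict_norm S2Q2, simp only:
        Q1[THEN scomp_ctx, unfolded scomp_assoc] q scomp_ctx[OF q(1)])
  have HG: "mcell (bassoc B Z Y X) \<cdot> ?g = \<one> T'"
  proof (rule rep_iff[OF rep_comp[OF g(1) H] rep_ident[of "Lf T'"], THEN iffD2])
    \<comment> \<open>One cancellation for each layer of the iterated projection.\<close>
    show "?H \<star> ?G = idc (word (Lf T')) (src B (ev (Lf T')))"
    proof (rule Q_cancel[OF c(2), of _ _ "[]" "[]"])
      show "W [] (?H \<star> ?G) [] \<star> W [] (sQ Z (bcomp B Y X)) []
          = W [] (idc (word (Lf T')) (src B (ev (Lf T')))) [] \<star> W [] (sQ Z (bcomp B Y X)) []"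
      proof (rule Q_cancel[OF assms(2), of _ _ "[?z]" "[]"])
        show "W [] (W [] (?H \<star> ?G) [] \<star> W [] (sQ Z (bcomp B Y X)) []) [] \<star> W [?z] (sQ Y X) []
          = W [] (W [] (idc (word (Lf T')) (src B (ev (Lf T')))) [] \<star> W [] (sQ Z (bcomp B Y X)) []) []
              \<star> W [?z] (sQ Y X) []"
          using t c by (simp only: strict_norm G2 H2) (simp add: idc_left_ctx T'_def del: W_unit)
      qed (use rep_valid[OF rep_comp[OF g(1) H]] rep_valid[OF g(1)] rep_valid[OF H] t c in \<open>simp_all
          add: vsimps T'_def\<close>)
    qed (use rep_valid[OF rep_comp[OF g(1) H]] rep_valid[OF g(1)] rep_valid[OF H] t c in \<open>simp_all
        add: vsimps T'_def\<close>)
  qed (use t c in \<open>simp_all add: T'_def\<close>)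
  have GH: "?g \<cdot> mcell (bassoc B Z Y X) = \<one> T"
  proof (rule rep_iff[OF rep_comp[OF H g(1)] rep_ident[of "Lf T"], THEN iffD2])
    show "?G \<star> ?H = idc (word (Lf T)) (src B (ev (Lf T)))"
    proof (rule Q_cancel[OF c(1), of _ _ "[]" "[]"])
      show "W [] (?G \<star> ?H) [] \<star> W [] (sQ (bcomp B Z Y) X) []
          = W [] (idc (word (Lf T)) (src B (ev (Lf T)))) [] \<star> W [] (sQ (bcomp B Z Y) X) []"
      proof (rule Q_cancel[OF assms(1), of _ _ "[]" "[?x]"])
        show "W [] (W [] (?G \<star> ?H) [] \<star> W [] (sQ (bcomp B Z Y) X) []) [] \<star> W [] (sQ Z Y) [?x]
          = W [] (W [] (idc (word (Lf T)) (src B (ev (Lf T)))) [] \<star> W [] (sQ (bcomp B Z Y) X) []) [] \<star>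
              W [] (sQ Z Y) [?x]"
          using t c by (simp only: strict_norm G2 H2) (simp add: idc_left_ctx T_def del: W_unit)
      qed (use rep_valid[OF rep_comp[OF H g(1)]] rep_valid[OF g(1)] rep_valid[OF H] t c in \<open>simp_all
          add: vsimps T_def\<close>)
    qed (use rep_valid[OF rep_comp[OF H g(1)]] rep_valid[OF g(1)] rep_valid[OF H] t c in \<open>simp_all
        add: vsimps T_def\<close>)
  qed (use t c in \<open>simp_all add: T_def\<close>)
  have inv: "inverse2 B (mcell (bassoc B Z Y X)) ?g"
    using HG GH h1 repD(3)[OF g(1)] by (simp add: inverse2_def hom2_def)
  then show "\<exists>k. inverse2 B (mcell (bassoc B Z Y X)) k" by blast
  let ?T1 = "bcomp B (bcomp B Z Y) X" and ?T2 = "bcomp B Z (bcomp B Y X)"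
  have bT: "bim ?T1" "bim ?T2" using c by (simp_all add: bim_bcomp)
  let ?C = "fcar (talg Z)" and ?A = "fcar (salg X)"
  note V = bim_valid[OF bT(1)] bim_valid[OF bT(2)] bim_valid[OF b(1)] bim_valid[OF b(5)]
      rep_valid[OF H] Q_valid[OF assms(1)] Q_valid[OF assms(2)]
  note vs = vsimps V[unfolded T_def T'_def] t T_def T'_def bT c assms(1,2)
      obj_typ[OF bim_typ(5)[OF b(1)]] obj_typ[OF bim_typ(4)[OF b(5)]]
  note A1 = bcomp_act[OF c(1), unfolded bcomp_sel] and A2 = bcomp_act[OF c(2), unfolded bcomp_sel]
  note B1 = bcomp_act[OF assms(1)] and B2 = bcomp_act[OF assms(2)]
  \<comment> \<open>Linearity is checked on the triple product, where the left action is that of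
    \<open>Z\<close> and, for \<open>mR\<close>, the right action is that of
    \<open>X\<close>.\<close>
  have mL: "?H \<star> sL ?T1 = sL ?T2 \<star> W [?C] ?H []"
  proof (rule Q_cancel[OF c(1), of _ _ "[?C]" "[]"])
    show "W [] (?H \<star> sL ?T1) [] \<star> W [?C] (sQ (bcomp B Z Y) X) []
        = W [] (sL ?T2 \<star> W [?C] ?H []) [] \<star> W [?C] (sQ (bcomp B Z Y) X) []"
    proof (rule Q_cancel[OF assms(1), of _ _ "[?C]" "[?x]"])
      have x: "W w (sL Z) (?YX # v) \<star> W (?z # ?C # w) (sQ Y X) v
          = W (?z # w) (sQ Y X) v \<star> W w (sL Z) (?y # ?x # v)" for w v
        using whisker_exchange[of "sL Z" "sQ Y X" w "[]" v] V by simp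
      show "W [] (W [] (?H \<star> sL ?T1) [] \<star> W [?C] (sQ (bcomp B Z Y) X) []) [] \<star> W [?C] (sQ Z Y) [?x]
        = W [] (W [] (sL ?T2 \<star> W [?C] ?H []) [] \<star> W [?C] (sQ (bcomp B Z Y) X) []) [] \<star> W [?C] (sQ Z Y)
            [?x]"
        by (simp only: strict_norm A1 scomp_ctx[OF A1(1)] B1 scomp_ctx[OF B1(1)] H2
            H2[THEN scomp_ctx, unfolded scomp_assoc] A2 scomp_ctx[OF A2(1)] x)
    qed (simp_all add: vs)
  qed (simp_all add: vs)
  have mR: "?H \<star> sR ?T1 = sR ?T2 \<star> W [] ?H [?A]"
  proof (rule Q_cancel[OF c(1), of _ _ "[]" "[?A]"])
    show "W [] (?H \<star> sR ?T1) [] \<star> W [] (sQ (bcomp B Z Y) X) [?A]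
        = W [] (sR ?T2 \<star> W [] ?H [?A]) [] \<star> W [] (sQ (bcomp B Z Y) X) [?A]"
    proof (rule Q_cancel[OF assms(1), of _ _ "[]" "[?x, ?A]"])
      have x: "W (?ZY # w) (sR X) v \<star> W w (sQ Z Y) (?x # ?A # v)
          = W w (sQ Z Y) (?x # v) \<star> W (?y # ?z # w) (sR X) v" for w v
        using whisker_exchange[of "sQ Z Y" "sR X" w "[]" v] V by simp
      show "W [] (W [] (?H \<star> sR ?T1) [] \<star> W [] (sQ (bcomp B Z Y) X) [?A]) [] \<star> W [] (sQ Z Y) [?x, ?A]
        = W [] (W [] (sR ?T2 \<star> W [] ?H [?A]) [] \<star> W [] (sQ (bcomp B Z Y) X) [?A]) [] \<star> W [] (sQ Z Y)
            [?x, ?A]"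
        by (simp only: strict_norm A1 scomp_ctx[OF A1(2)] x scomp_ctx[OF x] H2
            H2[THEN scomp_ctx, unfolded scomp_assoc] A2 scomp_ctx[OF A2(2)] B2)
    qed (simp_all add: vs)
  qed (simp_all add: vs)
  have "bimodule_map B ?T1 ?T2 (mcell (bassoc B Z Y X))"
    using bimodule_map_iff[OF bT, of "mcell (bassoc B Z Y X)"] h1 mL mR by (simp add: T_def T'_def)
  then show "bassoc B Z Y X \<in> hom2 Eq ?T1 ?T2"
    using bT by (simp add: hom2_Eq bassoc_def)
qed


section \<open>The unit algebra, unit bimodules and unitors\<close>

lemma idc_Nil [simp]:
  assumes "b \<in> Obj B"
  shows "valid (idc [] b)" "so (idc [] b) = b" "tg (idc [] b) = b" "dm (idc [] b) = []"
      "cd (idc [] b) = []"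
  using assms idc_sel[of b "[]" b] by (auto simp: idc_valid)

text \<open>Cancelling two cells without strands, or closing a loop, leaves the identity of an empty
  word. It has to become the identity of a neighbouring letter before \<open>idc_left\<close> and
  \<open>idc_right\<close> apply.\<close>

lemma W_idc_Nil:
  assumes "x \<in> Mor B"
  shows "trg B x = b \<Longrightarrow> W w (idc [] b) (x # v) = W w (idc [x] (src B x)) v"
    "src B x = b \<Longrightarrow> W (x # w) (idc [] b) v = W w (idc [x] b) v"
proof -
  assume b: "trg B x = b"
  have "W [] (idc [] b) [x] = idc [x] (src B x)"
    using W_idc[of "src B x" "[x]" b "[]" b "[]" b] assms b src_typ[OF assms] by simp
  then show "W w (idc [] b) (x # v) = W w (idc [x] (src B x)) v"
    using W_W[of w "[]" "idc [] b" "[x]" v] by simp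
next
  assume b: "src B x = b"
  have "W [x] (idc [] b) [] = idc [x] b"
    using W_idc[of b "[]" b "[]" b "[x]" "trg B x"] assms b src_typ[OF assms] by auto
  then show "W (x # w) (idc [] b) v = W w (idc [x] b) v"
    using W_W[of w "[x]" "idc [] b" "[]" v] by simp
qed

text \<open>Read through the tree \<open>Em b\<close>, all four structure maps have the identity of
  the empty word as strict form, and every axiom collapses.\<close>

lemma unit_frob_obj:
  assumes "b \<in> Obj B"
  shows "obj (b, unit_frob B b)"
proof -
  have "rep (Nd (Em b) (Em b)) (Em b) (\<ll> (\<I> b)) (idc [] b)"
    "rep (Em b) (Em b) (\<one> (\<I> b)) (idc [] b)" "rep (Em b) (Nd (Em b) (Em b)) (inv2 (\<ll> (\<I> b))) (idc [] b)"
    by (rule rep_cong, ((rule rep_rules | (simp add: assms; fail))+))+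
  then have "separable_frobenius B b (unit_frob B b)"
    using assms scomp_idc[of "idc [] b"]
    by (subst separable_frobenius_iff[where t = "Em b" and M = "idc [] b" and U = "idc [] b"
        and D = "idc [] b" and E = "idc [] b"])
       (simp_all add: unit_frob_def)
  then show ?thesis using assms by (simp add: obj_def)
qed

lemma bim_modules:
  assumes "bim X"
  shows "left_module B (talg X) (bcar X) (lact X)" "right_module B (salg X) (bcar X) (ract X)"
  using assms unfolding bim_def bimodule_def by blast+

text \<open>The unit map of \<open>unit_frob\<close> is an identity cell, so the unit law of a
  module already determines the action.\<close>

lemma unit_act:
  assumes "bim X"
  shows "btrg X = (b, unit_frob B b) \<Longrightarrow> lact X = \<ll> (bcar X)"
    "bsrc X = (b, unit_frob B b) \<Longrightarrow> ract X = \<rr> (bcar X)"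
proof -
  note t = bim_typ[OF assms]
  assume b: "btrg X = (b, unit_frob B b)"
  have bO: "b \<in> Obj B" using obj_typ(4)[OF t(5)] b by simp
  have "left_module B (unit_frob B b) (bcar X) (lact X)" using bim_modules[OF assms] b by simp
  then have "lact X \<cdot> (\<one> (\<I> b) \<odot> \<one> (bcar X)) = \<ll> (bcar X)" "lact X \<in> hom2 B (\<I> b \<otimes> bcar X) (bcar X)"
    unfolding left_module_def Let_def unit_frob_def by simp_all
  moreover have "\<one> (\<I> b) \<odot> \<one> (bcar X) = \<one> (\<I> b \<otimes> bcar X)" using t b bO by simp
  ultimately show "lact X = \<ll> (bcar X)" using vcomp_ident by metis
next
  note t = bim_typ[OF assms]
  assume b: "bsrc X = (b, unit_frob B b)"
  have bO: "b \<in> Obj B" using obj_typ(4)[OF t(4)] b by simp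
  have "right_module B (unit_frob B b) (bcar X) (ract X)" using bim_modules[OF assms] b by simp
  then have "ract X \<cdot> (\<one> (bcar X) \<odot> \<one> (\<I> b)) = \<rr> (bcar X)" "ract X \<in> hom2 B (bcar X \<otimes> \<I> b) (bcar X)"
    unfolding right_module_def Let_def unit_frob_def by simp_all
  moreover have "\<one> (bcar X) \<odot> \<one> (\<I> b) = \<one> (bcar X \<otimes> \<I> b)" using t b bO by simp
  ultimately show "ract X = \<rr> (bcar X)" using vcomp_ident by metis
qed

lemma bunit_sel [simp]:
  "bsrc (bunit p) = p" "btrg (bunit p) = p" "bcar (bunit p) = fcar (snd p)"
      "lact (bunit p) = mult (snd p)"
  "ract (bunit p) = mult (snd p)" "sL (bunit p) = sM p" "sR (bunit p) = sM p"
  by (simp_all add: bunit_def sL_def sR_def sM_def)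

lemma bim_bunit [simp]:
  assumes "obj p"
  shows "bim (bunit p)"
proof (rule bim_iff[THEN iffD2])
  show "lact (bunit p) \<in> hom2 B (fcar (talg (bunit p)) \<otimes> bcar (bunit p)) (bcar (bunit p))"
    "ract (bunit p) \<in> hom2 B (bcar (bunit p) \<otimes> fcar (salg (bunit p))) (bcar (bunit p))"
    using obj_mem[OF assms] by simp_all
qed (simp_all only: bunit_sel M_assoc[OF assms] M_unit[OF assms] obj_typ[OF assms] assms simp_thms)


lemma comp_ok_bunit:
  assumes "bim X"
  shows "comp_ok (bunit (btrg X)) X" "comp_ok X (bunit (bsrc X))"
  unfolding comp_ok_def using assms by simp_all

text \<open>Associativity of a module says that its action is balanced over the regular bimodule;
  the universal property of the projection then meets the descriptions in the unitors.\<close>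

lemma unitor_cells:
  assumes "bim X"
  shows "mcell (blunitor B X) \<in> hom2 B (bcar_comp B (bunit (btrg X)) X) (bcar X)"
    "mcell (blunitor B X) \<cdot> bproj B (bunit (btrg X)) X = lact X"
    "mcell (brunitor B X) \<in> hom2 B (bcar_comp B X (bunit (bsrc X))) (bcar X)"
    "mcell (brunitor B X) \<cdot> bproj B X (bunit (bsrc X)) = ract X"
proof -
  note c = comp_ok_bunit[OF assms] note m = bim_mem[OF assms]
  have "left_module B (talg X) (bcar X) (lact X)" by (rule bim_modules[OF assms])
  then have "lact X \<cdot> (mult (talg X) \<odot> \<one> (bcar X))
      = lact X \<cdot> (\<one> (fcar (talg X)) \<odot> lact X) \<cdot> \<aa> (fcar (talg X)) (fcar (talg X)) (bcar X)"
    unfolding left_module_def Let_def by blast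
  then have "\<exists>!h. h \<in> hom2 B (bcar_comp B (bunit (btrg X)) X) (bcar X) \<and> h
      \<cdot> bproj B (bunit (btrg X)) X = lact X"
    using bproj_universal(3)[OF c(1), of "lact X" "bcar X", unfolded bunit_sel, OF m(4)] by blast
  from theI'[OF this] show "mcell (blunitor B X) \<in> hom2 B (bcar_comp B (bunit (btrg X)) X) (bcar X)"
    "mcell (blunitor B X) \<cdot> bproj B (bunit (btrg X)) X = lact X" by (simp_all add: blunitor_def)
  have "right_module B (salg X) (bcar X) (ract X)" by (rule bim_modules[OF assms])
  then have "ract X \<cdot> (ract X \<odot> \<one> (fcar (salg X)))
      = ract X \<cdot> (\<one> (bcar X) \<odot> mult (salg X)) \<cdot> \<aa> (bcar X) (fcar (salg X)) (fcar (salg X))"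
    unfolding right_module_def Let_def by blast
  then have "\<exists>!h. h \<in> hom2 B (bcar_comp B X (bunit (bsrc X))) (bcar X) \<and> h
      \<cdot> bproj B X (bunit (bsrc X)) = ract X"
    using bproj_universal(3)[OF c(2), of "ract X" "bcar X", unfolded bunit_sel, OF m(5)] by blast
  from theI'[OF this] show "mcell (brunitor B X) \<in> hom2 B (bcar_comp B X (bunit (bsrc X))) (bcar X)"
    "mcell (brunitor B X) \<cdot> bproj B X (bunit (bsrc X)) = ract X" by (simp_all add: brunitor_def)
qed

lemma bimodule_map_ident: "bim X \<Longrightarrow> bimodule_map B X X (\<one> (bcar X))"
proof -
  assume X: "bim X"
  note m = bim_mem[OF X] note t = bim_typ[OF X]
  have "\<one> (fcar (talg X)) \<odot> \<one> (bcar X) = \<one> (fcar (talg X) \<otimes> bcar X)"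
      "\<one> (bcar X) \<odot> \<one> (fcar (salg X)) = \<one> (bcar X \<otimes> fcar (salg X))"
    using t by simp_all
  then show ?thesis
    unfolding bimodule_map_def using m t ident_vcomp[OF m(4)] ident_vcomp[OF m(5)]
        vcomp_ident[OF m(4)] vcomp_ident[OF m(5)]
    by (simp add: ident2_in)
qed

section \<open>The zigzag equations of the completion\<close>

text \<open>The zigzags run through several chosen quotients. With \<open>f\<close> lifting the unit
  and \<open>e\<close> being the counit before passing to the quotient, precomposition with the
  projection from \<open>X \<otimes> A\<close> or \<open>A \<otimes> Y\<close> lets every structure
  map be replaced by its defining equation, and all projections disappear. The lift is kept
  arbitrary since it is an identity in one direction of the theorem and a section after the unit in
  the other.\<close>

lemma Eq_adjunction_iff:
  assumes X: "bim X" "bsrc X = p" "btrg X = o1" and Y: "bim Y" "bsrc Y = o1" "btrg Y = p"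
    and u: "u \<in> hom2 Eq (bunit p) (bcomp B Y X)" and c: "c \<in> hom2 Eq (bcomp B X Y) (bunit o1)"
    and f: "f \<in> hom2 B (fcar (snd p)) (bcar Y \<otimes> bcar X)" "mcell u = bproj B Y X \<cdot> f"
    and e: "e \<in> hom2 B (bcar X \<otimes> bcar Y) (fcar (snd o1))" "e = mcell c \<cdot> bproj B X Y"
  defines "x \<equiv> bcar X" and "y \<equiv> bcar Y"
  shows "adjunction Eq p o1 X Y u c \<longleftrightarrow>
     lact X \<cdot> (e \<odot> \<one> x) \<cdot> inv2 (\<aa> x y x) \<cdot> (\<one> x \<odot> f) = ract X \<and>
     ract Y \<cdot> (\<one> y \<odot> e) \<cdot> \<aa> y x y \<cdot> (f \<odot> \<one> y) = lact Y"
proof -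
  have ok: "comp_ok Y X" "comp_ok X Y" unfolding comp_ok_def using X Y by simp_all
  note k1 = comp_ok_bcomp[OF ok(2,1)] and k2 = comp_ok_bcomp[OF ok(1,2)]
  note cu = comp_ok_bunit[OF X(1), unfolded X] comp_ok_bunit[OF Y(1), unfolded Y]
  let ?A = "fcar (snd p)" and ?I = "fcar (snd o1)" and ?T = "bcar_comp B Y X" and ?R = "bcar_comp B X Y"
  note t = bim_typ[OF X(1)] bim_typ[OF Y(1)] X(2,3) Y(2,3) bcar_comp_typ[OF ok(1)]
      bcar_comp_typ[OF ok(2)]
  have op: "obj p" "obj o1" using t by auto
  note o = op obj_typ[OF op(1)] obj_typ[OF op(2)]
  have um: "bimodule_map B (bunit p) (bcomp B Y X) (mcell u)" "mdom u = bunit p" "mcod u = bcomp B Y X"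
    using u by (simp_all add: hom2_Eq)
  have cm: "bimodule_map B (bcomp B X Y) (bunit o1) (mcell c)" "mdom c = bcomp B X Y"
      "mcod c = bunit o1"
    using c by (simp_all add: hom2_Eq)
  have ur: "u = \<lparr>mdom = bunit p, mcod = bcomp B Y X, mcell = mcell u\<rparr>" using um by (cases u) simp
  have cr: "c = \<lparr>mdom = bcomp B X Y, mcod = bunit o1, mcell = mcell c\<rparr>" using cm by (cases c) simp
  let ?jX = "\<lparr>mdom = X, mcod = X, mcell = \<one> (bcar X)\<rparr>"
      and ?jY = "\<lparr>mdom = Y, mcod = Y, mcell = \<one> (bcar Y)\<rparr>"
  note iX = bimodule_map_ident[OF X(1)] and iY = bimodule_map_ident[OF Y(1)]
  note u1 = bcomp2_cell[OF cu(2) k1(2) iX um(1), folded ur]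
  note c1 = bcomp2_cell[OF k1(1) cu(1) cm(1) iX, folded cr]
  note u2 = bcomp2_cell[OF cu(3) k2(1) um(1) iY, folded ur]
  note c2 = bcomp2_cell[OF k2(2) cu(4) iY cm(1), folded cr]
  note lX = unitor_cells[OF X(1), unfolded X(2,3)] and lY = unitor_cells[OF Y(1), unfolded Y(2,3)]
  obtain g where g: "inverse2 B (mcell (bassoc B X Y X)) g" using bassoc_cell(3)[OF ok(2,1)] by blast
  note hX = bassoc_cell(1)[OF ok(2,1)] and hY = bassoc_cell(1)[OF ok(1,2)]
  \<comment> \<open>An inverse in the completion is again a description; it is identified here with
    the concrete cell \<open>g\<close>.\<close>
  have iv: "inv2\<^bsub>Eq\<^esub> (bassoc B X Y X) = \<lparr>mdom = bcomp B X (bcomp B Y X), mcod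
      = bcomp B (bcomp B X Y) X, mcell = g\<rparr>"
    by (rule inv2_Eq[OF bassoc_cell(4)[OF ok(2,1)] g])
  have gm: "g \<in> hom2 B (bcar_comp B X (bcomp B Y X)) (bcar_comp B (bcomp B X Y) X)"
    using g hX by (auto simp: inverse2_def hom2_def)
  have gh: "g \<cdot> mcell (bassoc B X Y X) = \<one> (bcar_comp B (bcomp B X Y) X)"
    using g hX by (auto simp: inverse2_def hom2_def)
  define U1 where "U1 = mcell (bcomp2 B ?jX u)"
  define C1 where "C1 = mcell (bcomp2 B c ?jX)"
  define U2 where "U2 = mcell (bcomp2 B u ?jY)"
  define C2 where "C2 = mcell (bcomp2 B ?jY c)"
  note u1 = u1[folded U1_def] and c1 = c1[folded C1_def] and u2 = u2[folded U2_def]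
      and c2 = c2[folded C2_def]
  \<comment> \<open>2-morphisms record their source and target bimodules. As these agree on both
    sides, the zigzags amount to two equations between underlying cells of \<open>B\<close>.\<close>
  have adj: "adjunction Eq p o1 X Y u c \<longleftrightarrow>
     mcell (blunitor B X) \<cdot> C1 \<cdot> g \<cdot> U1 = mcell (brunitor B X) \<and>
     mcell (brunitor B Y) \<cdot> C2 \<cdot> mcell (bassoc B Y X Y) \<cdot> U2 = mcell (blunitor B Y)"
  proof -
    have h: "X \<in> hom1 Eq p o1" "Y \<in> hom1 Eq o1 p" using X Y by (simp_all add: hom1_Eq)
    have b: "mdom (bcomp2 B h k) = bcomp B (mdom h) (mdom k)"
        "mcod (bcomp2 B h k) = bcomp B (mcod h) (mcod k)" for h k
      by (simp_all add: bcomp2_def)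
    have e1: "vcomp Eq (lunitor Eq X) (vcomp Eq (tensor2 Eq c (ident2 Eq X))
        (vcomp Eq (inv2\<^bsub>Eq\<^esub> (associator Eq X Y X)) (tensor2 Eq (ident2 Eq X) u)))
       = \<lparr>mdom = bcomp B X (bunit p), mcod = X, mcell = mcell (blunitor B X) \<cdot> C1 \<cdot> g \<cdot> U1\<rparr>"
      unfolding Eq_sel iv bimap.select_convs b um(2) C1_def U1_def by (simp add: blunitor_def)
    have e2: "vcomp Eq (runitor Eq Y) (vcomp Eq (tensor2 Eq (ident2 Eq Y) c)
        (vcomp Eq (associator Eq Y X Y) (tensor2 Eq u (ident2 Eq Y))))
       = \<lparr>mdom = bcomp B (bunit p) Y, mcod = Y, mcell = mcell (brunitor B Y) \<cdot> C2 \<cdot> mcell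
           (bassoc B Y X Y) \<cdot> U2\<rparr>"
      unfolding Eq_sel iv bimap.select_convs b um(2) C2_def U2_def by (simp add: brunitor_def)
    have r1: "runitor Eq X = \<lparr>mdom = bcomp B X (bunit p), mcod = X, mcell = mcell (brunitor B X)\<rparr>"
      using X(2) by (simp add: Eq_sel brunitor_def)
    have r2: "lunitor Eq Y = \<lparr>mdom = bcomp B (bunit p) Y, mcod = Y, mcell = mcell (blunitor B Y)\<rparr>"
      using Y(3) by (simp add: Eq_sel blunitor_def)
    show ?thesis
      unfolding adjunction_def e1 e2 unfolding r1 r2 unfolding Eq_sel using h u c by simp
  qed
  let ?TX = "bcar_comp B X (bunit p)" and ?TY = "bcar_comp B (bunit p) Y"
  let ?VX = "bcar_comp B (bunit o1) X" and ?VY = "bcar_comp B Y (bunit o1)"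
  let ?T1 = "bcar_comp B (bcomp B X Y) X" and ?T2 = "bcar_comp B X (bcomp B Y X)"
  let ?S1 = "bcar_comp B (bcomp B Y X) Y" and ?S2 = "bcar_comp B Y (bcomp B X Y)"
  note T = bcar_comp_typ[OF cu(1)] bcar_comp_typ[OF cu(2)] bcar_comp_typ[OF cu(3)]
      bcar_comp_typ[OF cu(4)]
    bcar_comp_typ[OF k1(1)] bcar_comp_typ[OF k1(2)] bcar_comp_typ[OF k2(1)] bcar_comp_typ[OF k2(2)]
  have R: "rep (Lf ?TX) (Lf ?T2) U1 (S (Lf ?TX) (Lf ?T2) U1)"
    "rep (Lf ?T1) (Lf ?VX) C1 (S (Lf ?T1) (Lf ?VX) C1)"
    "rep (Lf ?TY) (Lf ?S1) U2 (S (Lf ?TY) (Lf ?S1) U2)"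
    "rep (Lf ?S2) (Lf ?VY) C2 (S (Lf ?S2) (Lf ?VY) C2)"
    "rep (Lf ?T2) (Lf ?T1) g (S (Lf ?T2) (Lf ?T1) g)"
    "rep (Lf ?T1) (Lf ?T2) (mcell (bassoc B X Y X)) (S (Lf ?T1) (Lf ?T2) (mcell (bassoc B X Y X)))"
    "rep (Lf ?S1) (Lf ?S2) (mcell (bassoc B Y X Y)) (S (Lf ?S1) (Lf ?S2) (mcell (bassoc B Y X Y)))"
    "rep (Lf ?VX) (Lf x) (mcell (blunitor B X)) (S (Lf ?VX) (Lf x) (mcell (blunitor B X)))"
    "rep (Lf ?TX) (Lf x) (mcell (brunitor B X)) (S (Lf ?TX) (Lf x) (mcell (brunitor B X)))"
    "rep (Lf ?TY) (Lf y) (mcell (blunitor B Y)) (S (Lf ?TY) (Lf y) (mcell (blunitor B Y)))"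
    "rep (Lf ?VY) (Lf y) (mcell (brunitor B Y)) (S (Lf ?VY) (Lf y) (mcell (brunitor B Y)))"
    "rep (Lf ?A) (Nd (Lf y) (Lf x)) f (S (Lf ?A) (Nd (Lf y) (Lf x)) f)"
    "rep (Nd (Lf x) (Lf y)) (Lf ?I) e (S (Nd (Lf x) (Lf y)) (Lf ?I) e)"
    "rep (Lf ?A) (Lf ?T) (mcell u) (S (Lf ?A) (Lf ?T) (mcell u))"
    "rep (Lf ?R) (Lf ?I) (mcell c) (S (Lf ?R) (Lf ?I) (mcell c))"
    unfolding x_def y_def
    by (rule rep_prim; simp only: ev.simps wt.simps T t o u1(1) u2(1) c1(1) c2(1) gm hX hY lX(1,3)
        lY(1,3) f(1) e(1)
      bimodule_map_hom2[OF um(1), unfolded bunit_sel bcomp_sel]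
          bimodule_map_hom2[OF cm(1), unfolded bunit_sel bcomp_sel])+
  note q = Q_rep(1)[OF ok(1), folded x_def y_def] Q_rep(1)[OF ok(2), folded x_def y_def]
    Q_rep(1)[OF cu(1), folded x_def] Q_rep(1)[OF cu(2), folded x_def] Q_rep(1)[OF cu(3), folded y_def]
        Q_rep(1)[OF cu(4), folded y_def]
    Q_rep(1)[OF k1(1), folded x_def] Q_rep(1)[OF k1(2), folded x_def] Q_rep(1)[OF k2(1), folded y_def]
        Q_rep(1)[OF k2(2), folded y_def]
  note q = q[unfolded bunit_sel bcomp_sel]
  note act = bim_rep[OF X(1), folded x_def, unfolded X] bim_rep[OF Y(1), folded y_def, unfolded Y]
  define sU1 where "sU1 = S (Lf ?TX) (Lf ?T2) U1"
  define sC1 where "sC1 = S (Lf ?T1) (Lf ?VX) C1"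
  define sU2 where "sU2 = S (Lf ?TY) (Lf ?S1) U2"
  define sC2 where "sC2 = S (Lf ?S2) (Lf ?VY) C2"
  define sg where "sg = S (Lf ?T2) (Lf ?T1) g"
  define sh where "sh = S (Lf ?T1) (Lf ?T2) (mcell (bassoc B X Y X))"
  define sh2 where "sh2 = S (Lf ?S1) (Lf ?S2) (mcell (bassoc B Y X Y))"
  define slX where "slX = S (Lf ?VX) (Lf x) (mcell (blunitor B X))"
  define srX where "srX = S (Lf ?TX) (Lf x) (mcell (brunitor B X))"
  define slY where "slY = S (Lf ?TY) (Lf y) (mcell (blunitor B Y))"
  define srY where "srY = S (Lf ?VY) (Lf y) (mcell (brunitor B Y))"
  define sf where "sf = S (Lf ?A) (Nd (Lf y) (Lf x)) f"
  define se where "se = S (Nd (Lf x) (Lf y)) (Lf ?I) e"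
  define su where "su = S (Lf ?A) (Lf ?T) (mcell u)"
  define sc where "sc = S (Lf ?R) (Lf ?I) (mcell c)"
  note R = R[folded sU1_def sC1_def sU2_def sC2_def sg_def sh_def sh2_def slX_def srX_def slY_def
      srY_def sf_def se_def su_def sc_def]
  have xy: "x \<in> Mor B" "y \<in> Mor B" "src B x = fst p" "trg B x = fst o1" "src B y = fst o1"
      "trg B y = fst p"
    using t by (simp_all add: x_def y_def)
  note S = xy o T t
  have eU1: "W w sU1 v \<star> W w (sQ X (bunit p)) v = W w (sQ X (bcomp B Y X)) v \<star> W (x # w) su v" for w v
  proof -
    have 1: "rep (Nd (Lf x) (Lf ?A)) (Lf ?T2) (bproj B X (bcomp B Y X) \<cdot> (\<one> x \<odot> mcell u))
        (sQ X (bcomp B Y X) \<star> W [x] su [])"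
      by (rule rep_cong, ((rule R q rep_rules | (simp add: S; fail))+))
    show ?thesis
      using strict_eqD[OF u1(2)[folded x_def] rep_comp[OF q(4) R(1)] 1, of w v]
          by (simp only: strict_norm)
  qed
  have eC1: "W w sC1 v \<star> W w (sQ (bcomp B X Y) X) v = W w (sQ (bunit o1) X) v \<star> W w sc (x # v)" for w v
  proof -
    have 1: "rep (Nd (Lf ?R) (Lf x)) (Lf ?VX) (bproj B (bunit o1) X \<cdot> (mcell c \<odot> \<one> x))
        (sQ (bunit o1) X \<star> W [] sc [x])"
      by (rule rep_cong, ((rule R q rep_rules | (simp add: S; fail))+))
    show ?thesis
      using strict_eqD[OF c1(2)[folded x_def] rep_comp[OF q(7) R(2)] 1, of w v]
          by (simp only: strict_norm)
  qed
  have eU2: "W w sU2 v \<star> W w (sQ (bunit p) Y) v = W w (sQ (bcomp B Y X) Y) v \<star> W w su (y # v)" for w v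
  proof -
    have 1: "rep (Nd (Lf ?A) (Lf y)) (Lf ?S1) (bproj B (bcomp B Y X) Y \<cdot> (mcell u \<odot> \<one> y))
        (sQ (bcomp B Y X) Y \<star> W [] su [y])"
      by (rule rep_cong, ((rule R q rep_rules | (simp add: S; fail))+))
    show ?thesis
      using strict_eqD[OF u2(2)[folded y_def] rep_comp[OF q(5) R(3)] 1, of w v]
          by (simp only: strict_norm)
  qed
  have eC2: "W w sC2 v \<star> W w (sQ Y (bcomp B X Y)) v = W w (sQ Y (bunit o1)) v \<star> W (y # w) sc v" for w v
  proof -
    have 1: "rep (Nd (Lf y) (Lf ?R)) (Lf ?VY) (bproj B Y (bunit o1) \<cdot> (\<one> y \<odot> mcell c))
        (sQ Y (bunit o1) \<star> W [y] sc [])"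
      by (rule rep_cong, ((rule R q rep_rules | (simp add: S; fail))+))
    show ?thesis
      using strict_eqD[OF c2(2)[folded y_def] rep_comp[OF q(10) R(4)] 1, of w v]
          by (simp only: strict_norm)
  qed
  have elX: "W w slX v \<star> W w (sQ (bunit o1) X) v = W w (sL X) v" for w v
    using strict_eqD[OF lX(2) rep_comp[OF q(3) R(8)] act(1), of w v] by (simp only: strict_norm)
  have erX: "W w srX v \<star> W w (sQ X (bunit p)) v = W w (sR X) v" for w v
    using strict_eqD[OF lX(4) rep_comp[OF q(4) R(9)] act(2), of w v] by (simp only: strict_norm)
  have elY: "W w slY v \<star> W w (sQ (bunit p) Y) v = W w (sL Y) v" for w v
    using strict_eqD[OF lY(2) rep_comp[OF q(5) R(10)] act(3), of w v] by (simp only: strict_norm)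
  have erY: "W w srY v \<star> W w (sQ Y (bunit o1)) v = W w (sR Y) v" for w v
    using strict_eqD[OF lY(4) rep_comp[OF q(6) R(11)] act(4), of w v] by (simp only: strict_norm)
  have esu: "W w su v = W w (sQ Y X) v \<star> W w sf v" for w v
    using strict_eqD[OF f(2) R(14) rep_comp[OF R(12) q(1)], of w v] by (simp only: strict_norm)
  have ese: "W w se v = W w sc v \<star> W w (sQ X Y) v" for w v
    using strict_eqD[OF e(2) R(13) rep_comp[OF q(2) R(15)], of w v] by (simp only: strict_norm)
  have egh: "W w sg v \<star> W w sh v = W w (idc [?T1] (fst p)) v" for w v
  proof -
    have 1: "rep (Lf ?T1) (Lf ?T1) (\<one> ?T1) (idc [?T1] (fst p))"
      by (rule rep_cong, ((rule rep_ident | (simp add: S; fail))+))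
    show ?thesis
      using strict_eqD[OF gh rep_comp[OF R(6) R(5)] 1, of w v] by (simp only: strict_norm)
  qed
  note ehX = bassoc_cell(2)[OF ok(2,1), folded sh_def x_def y_def]
      and ehY = bassoc_cell(2)[OF ok(1,2), folded sh2_def x_def y_def]
  \<comment> \<open>The inverse associator has no defining equation of its own; its effect on the
    iterated projection is read off from \<open>ehX\<close> by cancelling \<open>sh\<close>.\<close>
  have egX: "W w sg v \<star> W w (sQ X (bcomp B Y X)) v \<star> W (x # w) (sQ Y X) v
      = W w (sQ (bcomp B X Y) X) v \<star> W w (sQ X Y) (x # v)" for w v
    unfolding ehX[symmetric] scomp_ctx[OF egh]
    by (rule idc_left_ctx) (use T k1 t in simp_all)
  have 1: "mcell (blunitor B X) \<cdot> C1 \<cdot> g \<cdot> U1 = mcell (brunitor B X) \<longleftrightarrow>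
    lact X \<cdot> (e \<odot> \<one> x) \<cdot> inv2 (\<aa> x y x) \<cdot> (\<one> x \<odot> f) = ract X"
  proof -
    have r1: "rep (Lf ?TX) (Lf x) (mcell (blunitor B X) \<cdot> C1 \<cdot> g \<cdot> U1) (slX \<star> sC1 \<star> sg \<star> sU1)"
      by (rule rep_cong, ((rule R rep_comp | (simp add: S; fail))+))
    have r2: "rep (Nd (Lf x) (Lf ?A)) (Lf x) (lact X \<cdot> (e \<odot> \<one> x) \<cdot> inv2 (\<aa> x y x) \<cdot> (\<one> x \<odot> f))
        (sL X \<star> W [] se [x] \<star> W [x] sf [])"
      by (rule rep_cong, ((rule R(1-13) act rep_rules | (simp add: S; fail))+))
    \<comment> \<open>The projection at the input is pushed through unit, inverse associator, counit
      and unitor, each step by the equation that defines the map; at the end only the action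
      remains.\<close>
    have k: "W [] (slX \<star> sC1 \<star> sg \<star> sU1) [] \<star> W [] (sQ X (bunit p)) []
        = W [] (sL X \<star> W [] se [x] \<star> W [x] sf []) []"
      by (simp only: strict_norm eU1 esu egX egX[THEN scomp_ctx, unfolded scomp_assoc] eC1
          scomp_ctx[OF eC1] elX scomp_ctx[OF elX] ese)
    show ?thesis
    proof
      assume "mcell (blunitor B X) \<cdot> C1 \<cdot> g \<cdot> U1 = mcell (brunitor B X)"
      then have "W [] (slX \<star> sC1 \<star> sg \<star> sU1) [] = W [] srX []"
        by (rule strict_eqD) (rule r1 R)+
      then have "W [] (sL X \<star> W [] se [x] \<star> W [x] sf []) [] = W [] (sR X) []"
        using k erX[of "[]" "[]"] by simp
      then show "lact X \<cdot> (e \<odot> \<one> x) \<cdot> inv2 (\<aa> x y x) \<cdot> (\<one> x \<odot> f) = ract X"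
        by (rule strict_eqI[OF r2 act(2)])
    next
      assume "lact X \<cdot> (e \<odot> \<one> x) \<cdot> inv2 (\<aa> x y x) \<cdot> (\<one> x \<odot> f) = ract X"
      then have "W [] (sL X \<star> W [] se [x] \<star> W [x] sf []) [] = W [] (sR X) []"
        by (rule strict_eqD[OF _ r2 act(2)])
      then have "W [] (slX \<star> sC1 \<star> sg \<star> sU1) [] \<star> W [] (sQ X (bunit p)) []
          = W [] srX [] \<star> W [] (sQ X (bunit p)) []"
        using k erX[of "[]" "[]"] by simp
      then have "slX \<star> sC1 \<star> sg \<star> sU1 = srX"
        by (rule Q_cancel[OF cu(2) rep_valid[OF r1] rep_valid[OF R(9)], rotated -1])
          (use repD(4)[OF r1] repD(4)[OF R(9)] in simp_all)
      then show "mcell (blunitor B X) \<cdot> C1 \<cdot> g \<cdot> U1 = mcell (brunitor B X)"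
        using rep_iff[OF r1 R(9)] by simp
    qed
  qed
  have 2: "mcell (brunitor B Y) \<cdot> C2 \<cdot> mcell (bassoc B Y X Y) \<cdot> U2 = mcell (blunitor B Y) \<longleftrightarrow>
    ract Y \<cdot> (\<one> y \<odot> e) \<cdot> \<aa> y x y \<cdot> (f \<odot> \<one> y) = lact Y"
  proof -
    have r1: "rep (Lf ?TY) (Lf y) (mcell (brunitor B Y) \<cdot> C2 \<cdot> mcell (bassoc B Y X Y) \<cdot> U2)
        (srY \<star> sC2 \<star> sh2 \<star> sU2)"
      by (rule rep_cong, ((rule R rep_comp | (simp add: S; fail))+))
    have r2: "rep (Nd (Lf ?A) (Lf y)) (Lf y) (ract Y \<cdot> (\<one> y \<odot> e) \<cdot> \<aa> y x y \<cdot> (f \<odot> \<one> y))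
        (sR Y \<star> W [y] se [] \<star> W [] sf [y])"
      by (rule rep_cong, ((rule R(1-13) act rep_rules | (simp add: S; fail))+))
    have k: "W [] (srY \<star> sC2 \<star> sh2 \<star> sU2) [] \<star> W [] (sQ (bunit p) Y) []
        = W [] (sR Y \<star> W [y] se [] \<star> W [] sf [y]) []"
      by (simp only: strict_norm eU2 esu ehY ehY[THEN scomp_ctx, unfolded scomp_assoc] eC2
          scomp_ctx[OF eC2] erY scomp_ctx[OF erY] ese)
    show ?thesis
    proof
      assume "mcell (brunitor B Y) \<cdot> C2 \<cdot> mcell (bassoc B Y X Y) \<cdot> U2 = mcell (blunitor B Y)"
      then have "W [] (srY \<star> sC2 \<star> sh2 \<star> sU2) [] = W [] slY []"
        by (rule strict_eqD) (rule r1 R)+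
      then have "W [] (sR Y \<star> W [y] se [] \<star> W [] sf [y]) [] = W [] (sL Y) []"
        using k elY[of "[]" "[]"] by simp
      then show "ract Y \<cdot> (\<one> y \<odot> e) \<cdot> \<aa> y x y \<cdot> (f \<odot> \<one> y) = lact Y"
        by (rule strict_eqI[OF r2 act(3)])
    next
      assume "ract Y \<cdot> (\<one> y \<odot> e) \<cdot> \<aa> y x y \<cdot> (f \<odot> \<one> y) = lact Y"
      then have "W [] (sR Y \<star> W [y] se [] \<star> W [] sf [y]) [] = W [] (sL Y) []"
        by (rule strict_eqD[OF _ r2 act(3)])
      then have "W [] (srY \<star> sC2 \<star> sh2 \<star> sU2) [] \<star> W [] (sQ (bunit p) Y) []
          = W [] slY [] \<star> W [] (sQ (bunit p) Y) []"
        using k elY[of "[]" "[]"] by simp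
      then have "srY \<star> sC2 \<star> sh2 \<star> sU2 = slY"
        by (rule Q_cancel[OF cu(3) rep_valid[OF r1] rep_valid[OF R(10)], rotated -1])
          (use repD(4)[OF r1] repD(4)[OF R(10)] in simp_all)
      then show "mcell (brunitor B Y) \<cdot> C2 \<cdot> mcell (bassoc B Y X Y) \<cdot> U2 = mcell (blunitor B Y)"
        using rep_iff[OF r1 R(10)] by simp
    qed
  qed
  show ?thesis using adj 1 2 by simp
qed


subsection \<open>From biadjunctions to equivalences\<close>

lemma adjunction_typ:
  assumes "adjunction B a b L R \<eta> \<epsilon>"
  shows "L \<in> hom1 B a b" "R \<in> hom1 B b a" "\<eta> \<in> hom2 B (\<I> a) (R \<otimes> L)" "\<epsilon> \<in> hom2 B (L \<otimes> R) (\<I> b)"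
    "L \<in> Mor B" "R \<in> Mor B" "src B L = a" "trg B L = b" "src B R = b" "trg B R = a" "a \<in> Obj B"
        "b \<in> Obj B"
proof -
  show l: "L \<in> hom1 B a b" "R \<in> hom1 B b a" and "\<eta> \<in> hom2 B (\<I> a) (R \<otimes> L)" "\<epsilon> \<in> hom2 B (L \<otimes> R) (\<I> b)"
    using assms unfolding adjunction_def by blast+
  then show "L \<in> Mor B" "R \<in> Mor B" "src B L = a" "trg B L = b" "src B R = b" "trg B R = a"
      "a \<in> Obj B" "b \<in> Obj B"
    using src_typ[of L] by (auto simp: hom1_def)
qed

lemma adjunction_rep:
  assumes "adjunction B a b L R \<eta> \<epsilon>"
  defines "H \<equiv> S (Em a) (Nd (Lf R) (Lf L)) \<eta>" and "E \<equiv> S (Nd (Lf L) (Lf R)) (Em b) \<epsilon>"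
  shows "rep (Em a) (Nd (Lf R) (Lf L)) \<eta> H" "rep (Nd (Lf L) (Lf R)) (Em b) \<epsilon> E"
    "W w E (L # v) \<star> W (L # w) H v = W w (idc [L] a) v"
        "W (R # w) E v \<star> W w H (R # v) = W w (idc [R] b) v"
proof -
  note t = adjunction_typ[OF assms(1)]
  show r: "rep (Em a) (Nd (Lf R) (Lf L)) \<eta> H" "rep (Nd (Lf L) (Lf R)) (Em b) \<epsilon> E"
    unfolding H_def E_def by (rule rep_prim; simp only: wt.simps ev.simps t)+
  note i = adjunction_iff[OF r t(1,2), THEN iffD1, OF assms(1)]
  show "W w E (L # v) \<star> W (L # w) H v = W w (idc [L] a) v"
      "W (R # w) E v \<star> W w H (R # v) = W w (idc [R] b) v"
    using whisker_eq[OF conjunct1[OF i], of w v] whisker_eq[OF conjunct2[OF i], of w v]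
        by (simp_all only: strict_norm)
qed

text \<open>Cells from \<open>\<I> b\<close> to itself carry no strands and slide freely within a
  region labelled \<open>b\<close>. In each zigzag the factor inserted into \<open>\<eta>\<close>
  meets the inverse factor inserted into \<open>\<epsilon>\<close>, while under
  \<open>\<epsilon>t\<close> it inverts the loop \<open>\<epsilon>t \<cdot> \<eta>\<close>.\<close>

lemma biadj_normalise:
  assumes adj: "adjunction B b a Y X \<eta> \<epsilon>" "adjunction B a b X Y \<eta>t \<epsilon>t" and iso: "iso2 B (\<epsilon>t \<cdot> \<eta>)"
  defines "\<phi> \<equiv> biadj_phi B X \<eta> \<epsilon>t"
  shows "adjunction B b a Y X ((\<phi> \<odot> \<one> Y) \<cdot> \<eta>) (\<epsilon> \<cdot> (\<one> Y \<odot> inv2 \<phi>))"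
    "\<epsilon>t \<cdot> ((\<phi> \<odot> \<one> Y) \<cdot> \<eta>) = \<one> (\<I> b)"
proof -
  note t = adjunction_typ[OF adj(1)]
  define H where "H = S (Em b) (Nd (Lf X) (Lf Y)) \<eta>"
  define E where "E = S (Nd (Lf Y) (Lf X)) (Em a) \<epsilon>"
  define Et where "Et = S (Nd (Lf X) (Lf Y)) (Em b) \<epsilon>t"
  note r1 = adjunction_rep[OF adj(1), folded H_def E_def]
      and r2 = adjunction_rep[OF adj(2), folded Et_def]
  let ?k = "\<epsilon>t \<cdot> \<eta>"
  have k: "rep (Em b) (Em b) ?k (Et \<star> H)" by (rule rep_comp[OF r1(1) r2(2)])
  have ki: "inv2 ?k \<in> hom2 B (\<I> b) (\<I> b)" "inv2 ?k \<cdot> ?k = \<one> (\<I> b)" "?k \<cdot> inv2 ?k = \<one> (\<I> b)"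
    using iso rep_ends[OF k] by (simp_all add: hom2_def)
  define K where "K = S (Em b) (Em b) (inv2 ?k)"
  define J where "J = Et \<star> H"
  note k = k[folded J_def]
  have K: "rep (Em b) (Em b) (inv2 ?k) K" unfolding K_def using ki(1) t by (intro rep_prim) auto
  have i: "rep (Em b) (Em b) (\<one> (\<I> b)) (idc [] b)" by (rule rep_cong[OF rep_ident]) (simp_all add: t)
  have KJ: "W w K v \<star> W w J v = W w (idc [] b) v" "W w J v \<star> W w K v = W w (idc [] b) v" for w v
    using strict_eqD[OF ki(2) rep_comp[OF k K] i, of w v]
        strict_eqD[OF ki(3) rep_comp[OF K k] i, of w v]
    by (simp_all only: strict_norm)
  have dc: "dm K = []" "cd K = []" "dm J = []" "cd J = []" "dm H = []" "cd H = [X, Y]" "dm E = [Y, X]"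
      "cd E = []"
    "dm Et = [X, Y]" "cd Et = []"
    using repD(4)[OF k] by (simp_all add: K_def H_def E_def Et_def)
  note V = rep_valid[OF K] rep_valid[OF k] rep_valid[OF r1(1)] rep_valid[OF r1(2)] rep_valid[OF r2(2)]
  \<comment> \<open>The inverse of \<open>\<phi>\<close> is the same transport applied to
    \<open>\<epsilon>t \<cdot> \<eta>\<close> itself.\<close>
  let ?f = "\<ll> X \<cdot> (?k \<odot> \<one> X) \<cdot> inv2 (\<ll> X)"
  have p: "rep (Lf X) (Lf X) \<phi> (W [] K [X])"
    unfolding \<phi>_def biadj_phi_def
    by (rule rep_cong, ((rule K rep_rules | (simp add: t; fail))+))
  have f: "rep (Lf X) (Lf X) ?f (W [] J [X])"
    by (rule rep_cong, ((rule k rep_rules | (simp add: t; fail))+))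
  have iX: "rep (Lf X) (Lf X) (\<one> X) (idc [X] a)" by (rule rep_cong[OF rep_ident]) (simp_all add: t)
  have "inverse2 B \<phi> ?f"
  proof -
    have "?f \<cdot> \<phi> = \<one> X"
      by (rule strict_eqI[OF rep_comp[OF p f] iX]) (simp only: strict_norm KJ W_idc_Nil(1) t)
    moreover have "\<phi> \<cdot> ?f = \<one> X"
      by (rule strict_eqI[OF rep_comp[OF f p] iX]) (simp only: strict_norm KJ W_idc_Nil(1) t)
    ultimately show ?thesis using repD(3)[OF p] repD(3)[OF f] by (auto simp: inverse2_def hom2_def)
  qed
  then have fi: "inv2 \<phi> = ?f" by (rule inv2_eqI)
  have e': "rep (Nd (Lf Y) (Lf X)) (Em a) (\<epsilon> \<cdot> (\<one> Y \<odot> inv2 \<phi>)) (E \<star> W [Y] J [X])"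
    unfolding fi by (rule rep_cong, ((rule rep_comp[OF rep_left[OF f] r1(2)] |
        (simp add: t strict_norm; fail))+))
  have h': "rep (Em b) (Nd (Lf X) (Lf Y)) ((\<phi> \<odot> \<one> Y) \<cdot> \<eta>) (W [] K [X, Y] \<star> H)"
    by (rule rep_cong, ((rule rep_comp[OF r1(1) rep_right[OF p]] | (simp add: t strict_norm; fail))+))
  show "\<epsilon>t \<cdot> ((\<phi> \<odot> \<one> Y) \<cdot> \<eta>) = \<one> (\<I> b)"
  proof (rule strict_eqI[OF rep_comp[OF h' r2(2)] i])
    have x: "W [] Et [] \<star> W [] K [X, Y] = W [] K [] \<star> W [] Et []"
      using whisker_exchange[of K Et "[]" "[]" "[]"] V dc by simp
    have "W [] (Et \<star> W [] K [X, Y] \<star> H) [] = W [] K [] \<star> W [] J []"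
      by (simp only: strict_norm scomp_ctx[OF x]) (simp only: J_def strict_norm)
    then show "W [] (Et \<star> W [] K [X, Y] \<star> H) [] = W [] (idc [] b) []" by (simp only: KJ)
  qed
  have z1: "W [] (E \<star> W [Y] J [X]) [Y] \<star> W [Y] (W [] K [X, Y] \<star> H) [] = idc [Y] b"
  proof -
    have "W [] (E \<star> W [Y] J [X]) [Y] \<star> W [Y] (W [] K [X, Y] \<star> H) []
       = W [] E [Y] \<star> W [Y] (idc [X] a) [Y] \<star> W [Y] H []"
      by (simp only: strict_norm scomp_ctx[OF KJ(2)] W_idc_Nil(1) t)
    also have "\<dots> = W [] E [Y] \<star> W [Y] H []"
      by (subst idc_left) (simp_all add: V dc t)
    finally show ?thesis using t by (simp add: r1(3))
  qed
  \<comment> \<open>The two factors start in different regions. \<open>K\<close> slides up past the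
    cap and \<open>J\<close> down past the cup; straightening the strand \<open>X\<close> makes them
    adjacent.\<close>
  have z2: "W [X] (E \<star> W [Y] J [X]) [] \<star> W [] (W [] K [X, Y] \<star> H) [X] = idc [X] a"
  proof -
    have x1: "W [Y, X] J [X] \<star> W [] K [X, Y, X] = W [] K [X, Y, X] \<star> W [Y, X] J [X]"
      using whisker_exchange[of K J "[]" "[X, Y]" "[X]"] V dc by simp
    have x2: "W [X] E [] \<star> W [] K [X, Y, X] = W [] K [X] \<star> W [X] E []"
      using whisker_exchange[of K E "[]" "[X]" "[]"] V dc by simp
    have x3: "W [Y, X] J [X] \<star> W [] H [X] = W [] H [X] \<star> W [] J [X]"
      using whisker_exchange[of H J "[]" "[]" "[X]"] V dc by simp
    have "W [X] (E \<star> W [Y] J [X]) [] \<star> W [] (W [] K [X, Y] \<star> H) [X]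
      = W [] K [X] \<star> W [X] E [] \<star> W [Y, X] J [X] \<star> W [] H [X]"
      by (simp only: strict_norm scomp_ctx[OF x1]) (simp only: scomp_assoc scomp_ctx[OF x2])
    also have "\<dots> = W [] K [X] \<star> W [] (idc [X] a) [] \<star> W [] J [X]"
      by (simp only: x3 scomp_ctx[OF r1(4)] scomp_assoc)
    also have "\<dots> = W [] K [X] \<star> W [] J [X]"
      by (subst idc_left) (simp_all add: V dc t)
    finally show ?thesis using t by (simp add: KJ W_idc_Nil(1))
  qed
  show "adjunction B b a Y X ((\<phi> \<odot> \<one> Y) \<cdot> \<eta>) (\<epsilon> \<cdot> (\<one> Y \<odot> inv2 \<phi>))"
    using adjunction_iff[OF h' e' t(1,2)] z1 z2 by simp
qed

section \<open>Bimodules over the unit algebra and the equivalence of a split biadjunction\<close>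

text \<open>Over the unit algebra the two actions agree by the triangle, so the identity is balanced
  and the idempotent is trivial.\<close>

lemma unit_bproj_inverse:
  assumes "comp_ok Y X" "btrg X = (b, unit_frob B b)"
  shows "inverse2 B (bproj B Y X) (bsec Y X)"
proof -
  note c = comp_okD[OF assms(1)]
  note t = bim_typ[OF c(1)] bim_typ[OF c(2)]
  have b: "b \<in> Obj B" using obj_typ(4)[OF bim_typ(5)[OF c(2)]] assms(2) by simp
  have y: "ract Y = \<rr> (bcar Y)" using unit_act(2)[OF c(1)] c(3) assms(2) by simp
  have x: "lact X = \<ll> (bcar X)" by (rule unit_act(1)[OF c(2) assms(2)])
  have f: "fcar (talg X) = \<I> b" using assms(2) by (simp add: unit_frob_def)
  have i: "\<one> (bcar Y \<otimes> bcar X) \<in> hom2 B (bcar Y \<otimes> bcar X) (bcar Y \<otimes> bcar X)"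
    using t c(3) by (intro ident2_in) simp
  have "ract Y \<odot> \<one> (bcar X) = (\<one> (bcar Y) \<odot> lact X) \<cdot> \<aa> (bcar Y) (fcar (talg X)) (bcar X)"
    unfolding x y f using t c(3) assms(2) by (intro triangle_eq[symmetric]) simp_all
  from balanced_bidem[OF assms(1) i, unfolded this, OF refl]
  have "bidem Y X = \<one> (bcar Y \<otimes> bcar X)" using ident_vcomp[OF bidem_props(3)[OF assms(1)]] by simp
  then show ?thesis
    using bsec_props[OF assms(1)] bproj_universal(1)[OF assms(1)] by (auto simp: inverse2_def hom2_def)
qed

text \<open>All actions involved are unitors, and these are natural.\<close>

lemma unit_bimodule_map:
  assumes Z: "bim Z" "bsrc Z = (b, unit_frob B b)" "btrg Z = (b, unit_frob B b)"
    and Z': "bim Z'" "bsrc Z' = (b, unit_frob B b)" "btrg Z' = (b, unit_frob B b)"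
    and k: "k \<in> hom2 B (bcar Z) (bcar Z')"
  shows "bimodule_map B Z Z' k"
proof -
  have f: "fcar (unit_frob B b) = \<I> b" by (simp add: unit_frob_def)
  have kk: "k \<in> Cell B" "dom2 B k = bcar Z" "cod2 B k = bcar Z'" using k by (auto simp: hom2_def)
  note l = unit_act(1)[OF Z(1,3)] unit_act(1)[OF Z'(1,3)] unit_act(2)[OF Z(1,2)] unit_act(2)[OF Z'(1,2)]
  show ?thesis
    unfolding bimodule_map_def l
    using lunit_nat[of k "bcar Z'" b] runit_nat[of k "bcar Z'" b] kk k Z(2,3) Z'(2,3) bim_typ[OF Z(1)]
        f by simp
qed

lemma split_biadj_equivalence:
  assumes adj: "adjunction B b a Y X \<eta> \<epsilon>" "adjunction B a b X Y \<eta>t \<epsilon>t" and sp: "\<epsilon>t \<cdot> \<eta> = \<one> (\<I> b)"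
  defines "A \<equiv> biadj_frob B X Y \<epsilon> \<eta> \<epsilon>t \<eta>t"
  shows "\<exists>u c. adjoint_equivalence Eq (a, A) (b, unit_frob B b) (biadj_X B a b A X Y \<epsilon>t)
      (biadj_Y B a b A X Y \<epsilon>t) u c"
proof -
  note t = adjunction_typ[OF adj(1)]
  define H where "H = S (Em b) (Nd (Lf X) (Lf Y)) \<eta>"
  define E where "E = S (Nd (Lf Y) (Lf X)) (Em a) \<epsilon>"
  define Ht where "Ht = S (Em a) (Nd (Lf Y) (Lf X)) \<eta>t"
  define Et where "Et = S (Nd (Lf X) (Lf Y)) (Em b) \<epsilon>t"
  note r1 = adjunction_rep[OF adj(1), folded H_def E_def]
      and r2 = adjunction_rep[OF adj(2), folded Ht_def Et_def]
  have i: "rep (Em b) (Em b) (\<one> (\<I> b)) (idc [] b)" by (rule rep_cong[OF rep_ident]) (simp_all add: t)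
  have EH: "W w Et v \<star> W w H v = W w (idc [] b) v" for w v
    using strict_eqD[OF sp rep_comp[OF r1(1) r2(2)] i, of w v] by (simp only: strict_norm)
  have dc: "dm H = []" "cd H = [X, Y]" "dm E = [Y, X]" "cd E = []"
    "dm Et = [X, Y]" "cd Et = []" "dm Ht = []" "cd Ht = [Y, X]"
    by (simp_all add: H_def E_def Et_def Ht_def)
  note V = rep_valid[OF r1(1)] rep_valid[OF r1(2)] rep_valid[OF r2(2)] rep_valid[OF r2(1)]
  let ?o = "(b, unit_frob B b)" and ?p = "(a, A)"
  let ?T = "Nd (Lf Y) (Lf X)"
  have fA: "fcar A = Y \<otimes> X" by (simp add: A_def biadj_frob_def)
  have rM: "rep (Nd ?T ?T) ?T (mult A) (W [Y] Et [X])"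
    unfolding A_def biadj_frob_def frob.select_convs
    by (rule rep_cong, ((rule r2 rep_rules | (simp add: t strict_norm; fail))+))
  have rU: "rep (Em a) ?T (unit A) Ht"
    unfolding A_def biadj_frob_def frob.select_convs by (rule r2)
  have rD: "rep ?T (Nd ?T ?T) (comult A) (W [Y] H [X])"
    unfolding A_def biadj_frob_def frob.select_convs
    by (rule rep_cong, ((rule r1 rep_rules | (simp add: t strict_norm; fail))+))
  have rC: "rep ?T (Em a) (counit A) E"
    unfolding A_def biadj_frob_def frob.select_convs by (rule r1)
  \<comment> \<open>With \<open>Y \<otimes> X\<close> read as two strands, associativity,
    coassociativity and the Frobenius relations are interchange laws for the caps \<open>Et\<close>
    and the cups \<open>H\<close>. Unit and counit laws are zigzags, and separability is the closed
    loop \<open>EH\<close>.\<close>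
  have EtEt: "W w Et v \<star> W w Et (X # Y # v) = W w Et v \<star> W (Y # X # w) Et v" for w v
    using whisker_exchange[of Et Et w "[]" v] V dc by simp
  have HH: "W w H (X # Y # v) \<star> W w H v = W (Y # X # w) H v \<star> W w H v" for w v
    using whisker_exchange[of H H w "[]" v] V dc by simp
  have HE1: "W w H v \<star> W w Et v = W w Et (X # Y # v) \<star> W (Y # X # w) H v" for w v
    using whisker_exchange[of Et H w "[]" v] V dc by simp
  have HE2: "W w H v \<star> W w Et v = W (Y # X # w) Et v \<star> W w H (X # Y # v)" for w v
    using whisker_exchange[of H Et w "[]" v] V dc by simp
  have wid: "W [Y] (idc [X] a) [] = idc [Y, X] a" "W [] (idc [Y] b) [X] = idc [Y, X] a"
    using W_idc[of a "[]" a "[X]" b "[Y]" a] W_idc[of a "[X]" b "[Y]" a "[]" a] t by auto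
  have sf: "separable_frobenius B a A"
    unfolding separable_frobenius_iff[of ?T A a, OF _ _ _ rM rU rD rC, unfolded fA ev.simps, OF refl
        tensor1_typ(2)[OF t(6,5), unfolded t, OF refl] tensor1_typ(3)[OF t(6,5), unfolded t, OF refl]]
    using EtEt[of "[Y]" "[X]"] HH[of "[Y]" "[X]"] HE1[of "[Y]" "[X]"] HE2[of "[Y]" "[X]"]
      r1(3)[of "[]" "[X]"] r1(4)[of "[Y]" "[]"] r2(3)[of "[Y]" "[]"] r2(4)[of "[]" "[X]"]
          EH[of "[Y]" "[X]"]
    by (simp add: strict_norm wid W_idc_Nil t)
  have op: "obj ?p" "obj ?o" using sf t unit_frob_obj by (simp_all add: obj_def)
  let ?X = "biadj_X B a b A X Y \<epsilon>t" and ?Y = "biadj_Y B a b A X Y \<epsilon>t"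
  have Xs: "bsrc ?X = ?p" "btrg ?X = ?o" "bcar ?X = X" "lact ?X = \<ll> X" "ract ?X = biadj_ract B X Y \<epsilon>t"
    and Ys: "bsrc ?Y = ?o" "btrg ?Y = ?p" "bcar ?Y = Y" "ract ?Y = \<rr> Y" "lact ?Y = biadj_lact B X Y \<epsilon>t"
    by (simp_all add: biadj_X_def biadj_Y_def)
  have ru: "rep (Nd (Em b) (Em b)) (Em b) (mult (unit_frob B b)) (idc [] b)"
      "rep (Em b) (Em b) (unit (unit_frob B b)) (idc [] b)"
    unfolding unit_frob_def frob.select_convs
    by (rule rep_cong, ((rule rep_rules | (simp add: t; fail))+))+
  have fI: "fcar (unit_frob B b) = \<I> b" by (simp add: unit_frob_def)
  have lX: "rep (Nd (Em b) (Lf X)) (Lf X) (\<ll> X) (idc [X] a)"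
    by (rule rep_cong, ((rule rep_rules | (simp add: t; fail))+))
  have rX: "rep (Nd (Lf X) ?T) (Lf X) (biadj_ract B X Y \<epsilon>t) (W [] Et [X])"
    unfolding biadj_ract_def by (rule rep_cong, ((rule r2 rep_rules | (simp add: t; fail))+))
  have rY: "rep (Nd (Lf Y) (Em b)) (Lf Y) (\<rr> Y) (idc [Y] b)"
    by (rule rep_cong, ((rule rep_rules | (simp add: t; fail))+))
  have lY: "rep (Nd ?T (Lf Y)) (Lf Y) (biadj_lact B X Y \<epsilon>t) (W [Y] Et [])"
    unfolding biadj_lact_def by (rule rep_cong, ((rule r2 rep_rules | (simp add: t; fail))+))
  have ids: "W [] (idc [] b) [X] = idc [X] a" "W [Y] (idc [] b) [] = idc [Y] b"
      "idc [X] a \<star> idc [X] a = idc [X] a"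
     "idc [Y] b \<star> idc [Y] b = idc [Y] b"
    using W_idc_Nil(1)[of X b "[]" "[]"] W_idc_Nil(2)[of Y b "[]" "[]"] t
      scomp_idc(1)[of "idc [X] a"] scomp_idc(1)[of "idc [Y] b"] idc_valid[of "[X]" a]
          idc_valid[of "[Y]" b]
      idc_sel[of a "[X]" b] idc_sel[of b "[Y]" a] by auto
  have W1: "W [] (idc [X] a) [Y, X] = idc [X, Y, X] a" "W [] (idc [X] a) [] = idc [X] a"
    "W [X, Y] (idc [Y] b) [] = idc [Y, X, Y] b" "W [] (idc [Y] b) [] = idc [Y] b"
    using W_idc[of a "[Y, X]" a "[X]" b "[]" b] W_idc[of a "[]" a "[X]" b "[]" b]
        W_idc[of b "[]" b "[Y]" a "[X, Y]" a]
      W_idc[of b "[]" b "[Y]" a "[]" a] t by auto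
  have EX: "W [] Et [X] \<star> idc [X, Y, X] a = W [] Et [X]" "idc [X] a \<star> W [] Et [X] = W [] Et [X]"
    "W [Y] Et [] \<star> idc [Y, X, Y] b = W [Y] Et []" "idc [Y] b \<star> W [Y] Et [] = W [Y] Et []"
    using scomp_idc[OF rep_valid[OF rX]] scomp_idc[OF rep_valid[OF lY]] repD(4)[OF rX] repD(4)[OF lY] t
    by simp_all
  have "left_module B (unit_frob B b) X (\<ll> X)"
    by (subst left_module_iff[of "Em b" _ "Lf X", OF _ _ _ _ _ ru lX]) (simp_all add: fI t ids)
  moreover have "right_module B A X (biadj_ract B X Y \<epsilon>t)"
    by (subst right_module_iff[of ?T A "Lf X" X, OF _ _ _ _ rM rU rX])
      (use EtEt[of "[]" "[X]"] r2(3)[of "[]" "[]"] in \<open>simp_all add: fA t strict_norm W1\<close>)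
  moreover have "biadj_ract B X Y \<epsilon>t \<cdot> (\<ll> X \<odot> \<one> (fcar A))
      = \<ll> X \<cdot> (\<one> (fcar (unit_frob B b)) \<odot> biadj_ract B X Y \<epsilon>t) \<cdot> \<aa> (fcar (unit_frob B b)) X (fcar A)"
    by (subst bimodule_compat_iff[of "Em b" _ "Lf X" _ ?T, OF _ _ _ lX rX])
        (simp_all add: fI fA W1 EX strict_norm)
  ultimately have bX: "bim ?X" using op t unfolding bim_def bimodule_def Xs by (simp add: Xs)
  have "right_module B (unit_frob B b) Y (\<rr> Y)"
    by (subst right_module_iff[of "Em b" _ "Lf Y", OF _ _ _ _ ru rY]) (simp_all add: fI t ids W1)
  moreover have "left_module B A Y (biadj_lact B X Y \<epsilon>t)"
    by (subst left_module_iff[of ?T A "Lf Y" Y, OF _ _ _ _ _ rM rU lY])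
      (use EtEt[of "[Y]" "[]"] r2(4)[of "[]" "[]"] in \<open>simp_all add: fA t strict_norm W1\<close>)
  moreover have "\<rr> Y \<cdot> (biadj_lact B X Y \<epsilon>t \<odot> \<one> (fcar (unit_frob B b)))
      = biadj_lact B X Y \<epsilon>t \<cdot> (\<one> (fcar A) \<odot> \<rr> Y) \<cdot> \<aa> (fcar A) Y (fcar (unit_frob B b))"
    by (subst bimodule_compat_iff[of ?T _ "Lf Y" _ "Em b", OF _ _ _ lY rY])
        (simp_all add: fI fA W1 EX strict_norm)
  ultimately have bY: "bim ?Y" using op t unfolding bim_def bimodule_def Ys by (simp add: Ys)
  have ok: "comp_ok ?Y ?X" "comp_ok ?X ?Y" unfolding comp_ok_def using bX bY Xs Ys by simp_all
  note bYX = bim_bcomp[OF ok(1)] and bXY = bim_bcomp[OF ok(2)]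
  let ?q = "bproj B ?Y ?X" and ?r = "bproj B ?X ?Y"
  let ?R = "bcar_comp B ?X ?Y"
  note q = bproj_universal[OF ok(1), unfolded Xs Ys snd_conv]
      and r = bproj_universal[OF ok(2), unfolded Xs Ys snd_conv]
  \<comment> \<open>The unit of the equivalence is the projection from \<open>Y \<otimes> X\<close>
    to the product over \<open>\<I> b\<close>, which is invertible. It is linear because the outer
    actions on \<open>Y \<otimes> X\<close> are both the multiplication of \<open>A\<close>.\<close>
  have q_map: "bimodule_map B (bunit ?p) (bcomp B ?Y ?X) ?q"
  proof -
    have m1: "(biadj_lact B X Y \<epsilon>t \<odot> \<one> X) \<cdot> inv2 (\<aa> (Y \<otimes> X) Y X) = mult A"
    proof (rule strict_eqI[OF _ rM])
      show "rep (Nd ?T ?T) ?T ((biadj_lact B X Y \<epsilon>t \<odot> \<one> X) \<cdot> inv2 (\<aa> (Y \<otimes> X) Y X))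
          (W [] (W [Y] Et []) [X])"
        by (rule rep_cong, ((rule lY rep_rules | (simp add: t; fail))+))
    qed (simp add: strict_norm)
    have m2: "(\<one> Y \<odot> biadj_ract B X Y \<epsilon>t) \<cdot> \<aa> Y X (Y \<otimes> X) = mult A"
      by (simp add: A_def biadj_frob_def biadj_ract_def)
    show ?thesis
      unfolding bimodule_map_def
      using bcomp_act_mem(3,4)[OF ok(1), unfolded Xs Ys snd_conv fA] q(1) m1 m2 by (simp add: Xs Ys fA)
  qed
  let ?u = "\<lparr>mdom = bunit ?p, mcod = bcomp B ?Y ?X, mcell = ?q\<rparr>"
  have u: "?u \<in> hom2 Eq (bunit ?p) (bcomp B ?Y ?X)" using op bYX q_map by (simp add: hom2_Eq)
  have ui: "iso2 Eq ?u"
    using inverse2_Eq[OF u, of "bsec ?Y ?X"] unit_bproj_inverse[OF ok(1), of b] Xs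
        by (auto simp: iso2_def)
  have wXY: "rep (Nd (Nd (Lf X) ?T) (Lf Y)) (Nd (Lf X) (Lf Y)) (biadj_ract B X Y \<epsilon>t \<odot> \<one> Y)
      (W [] Et [X, Y])"
    by (rule rep_cong, ((rule rX rep_rules | (simp add: t strict_norm; fail))+))
  have vXY: "rep (Nd (Nd (Lf X) ?T) (Lf Y)) (Nd (Lf X) (Lf Y))
      ((\<one> X \<odot> biadj_lact B X Y \<epsilon>t) \<cdot> \<aa> X (fcar A) Y) (W [Y, X] Et [])"
    unfolding fA by (rule rep_cong, ((rule lY rep_rules | (simp add: t strict_norm; fail))+))
  \<comment> \<open>Interchange of \<open>\<epsilon>t\<close> with itself makes it balanced over
    \<open>A\<close>; the induced map \<open>k\<close> will be the counit of the
    equivalence.\<close>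
  have "\<epsilon>t \<cdot> (biadj_ract B X Y \<epsilon>t \<odot> \<one> Y) = \<epsilon>t \<cdot> ((\<one> X \<odot> biadj_lact B X Y \<epsilon>t) \<cdot> \<aa> X (fcar A) Y)"
    by (rule strict_eqI[OF rep_comp[OF wXY r2(2)] rep_comp[OF vXY r2(2)]]) (simp only: strict_norm EtEt)
  from r(3)[OF repD(3)[OF r2(2), unfolded ev.simps] this]
  obtain k where k: "k \<in> hom2 B ?R (\<I> b)" "k \<cdot> ?r = \<epsilon>t" by blast
  have RT: "?R \<in> Mor B" "src B ?R = b" "trg B ?R = b" using bcar_comp_typ[OF ok(2)] Xs Ys by simp_all
  have rr: "rep (Nd (Lf X) (Lf Y)) (Lf ?R) ?r (S (Nd (Lf X) (Lf Y)) (Lf ?R) ?r)"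
    using r(1) RT t by (intro rep_prim) simp_all
  have rbal: "W w (S (Nd (Lf X) (Lf Y)) (Lf ?R) ?r) v \<star> W w Et (X # Y # v)
      = W w (S (Nd (Lf X) (Lf Y)) (Lf ?R) ?r) v \<star> W (Y # X # w) Et v" for w v
    using strict_eqD[OF r(2) rep_comp[OF wXY rr] rep_comp[OF vXY rr], of w v]
        by (simp only: strict_norm)
  have h: "\<eta> \<in> hom2 B (\<I> b) (X \<otimes> Y)" by (rule t(3))
  have kh: "k \<cdot> (?r \<cdot> \<eta>) = \<one> (\<I> b)"
    using vcomp_assoc[OF h r(1) k(1)] k(2) sp by simp
  have hk: "(?r \<cdot> \<eta>) \<cdot> k = \<one> ?R"
  proof -
    \<comment> \<open>By interchange, \<open>\<eta> \<cdot> \<epsilon>t\<close> creates a new pair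
      \<open>X\<close>, \<open>Y\<close> on the right and then closes the left pair. A balanced map
      cannot distinguish this from closing the right pair, which is the loop
      \<open>\<epsilon>t \<cdot> \<eta> = \<one> (\<I> b)\<close>.\<close>
    have rhe: "?r \<cdot> (\<eta> \<cdot> \<epsilon>t) = ?r"
    proof (rule strict_eqI[OF rep_comp[OF rep_comp[OF r2(2) r1(1)] rr] rr])
      have "W [] (S (Nd (Lf X) (Lf Y)) (Lf ?R) ?r) [] \<star> W [Y, X] (idc [] b) []
          = W [] (S (Nd (Lf X) (Lf Y)) (Lf ?R) ?r) []"
        using t rep_valid[OF rr] by (simp add: W_idc_Nil(2) idc_right del: W_unit)
      then show "W [] (S (Nd (Lf X) (Lf Y)) (Lf ?R) ?r \<star> (H \<star> Et)) []
          = W [] (S (Nd (Lf X) (Lf Y)) (Lf ?R) ?r) []"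
        by (simp only: strict_norm HE1 scomp_ctx[OF rbal]) (simp only: scomp_assoc EH)
    qed
    have rh: "?r \<cdot> \<eta> \<in> hom2 B (\<I> b) ?R" by (rule vcomp_in[OF h r(1)])
    have "((?r \<cdot> \<eta>) \<cdot> k) \<cdot> ?r = (?r \<cdot> \<eta>) \<cdot> \<epsilon>t"
      using vcomp_assoc[OF r(1) k(1) rh] k(2) by simp
    also have "\<dots> = ?r" using vcomp_assoc[OF repD(3)[OF r2(2), unfolded ev.simps] h r(1)] rhe by simp
    finally have "((?r \<cdot> \<eta>) \<cdot> k) \<cdot> ?r = ?r" .
    moreover have "\<one> ?R \<cdot> ?r = ?r" by (rule ident_vcomp[OF r(1)])
    moreover have "(?r \<cdot> \<eta>) \<cdot> k \<in> hom2 B ?R ?R" by (rule vcomp_in[OF k(1) rh])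
    moreover have "\<one> ?R \<in> hom2 B ?R ?R" by (rule ident2_in[OF RT(1)])
    ultimately show ?thesis using r(3)[OF r(1,2)] by blast
  qed
  have ki: "inverse2 B k (?r \<cdot> \<eta>)"
    using kh hk k(1) vcomp_in[OF h r(1)] by (simp add: inverse2_def hom2_def)
  let ?c = "\<lparr>mdom = bcomp B ?X ?Y, mcod = bunit ?o, mcell = k\<rparr>"
  have k_map: "bimodule_map B (bcomp B ?X ?Y) (bunit ?o) k"
    by (rule unit_bimodule_map[OF bXY _ _ bim_bunit[OF op(2)]]) (use k(1) in \<open>simp_all add: Xs Ys fI\<close>)
  have c: "?c \<in> hom2 Eq (bcomp B ?X ?Y) (bunit ?o)" using op bXY k_map by (simp add: hom2_Eq)
  have ci: "iso2 Eq ?c" using inverse2_Eq[OF c, of "?r \<cdot> \<eta>"] ki by (auto simp: iso2_def)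
  \<comment> \<open>With the identity as lift of the unit, the two conditions are the definitions of
    the actions of \<open>A\<close> on \<open>X\<close> and on \<open>Y\<close>.\<close>
  have "adjunction Eq ?p ?o ?X ?Y ?u ?c"
  proof (rule Eq_adjunction_iff[OF bX Xs(1,2) bY Ys(1,2) u c, of "\<one> (Y \<otimes> X)" \<epsilon>t, THEN iffD2])
    have YX: "Y \<otimes> X \<in> Mor B" using t by simp
    show "\<one> (Y \<otimes> X) \<in> hom2 B (fcar (snd ?p)) (bcar ?Y \<otimes> bcar ?X)" using ident2_in[OF YX]
        by (simp add: Xs Ys fA)
    show "mcell ?u = ?q \<cdot> \<one> (Y \<otimes> X)" using vcomp_ident[OF q(1)] by simp
    show "\<epsilon>t \<in> hom2 B (bcar ?X \<otimes> bcar ?Y) (fcar (snd ?o))" using repD(3)[OF r2(2)]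
        by (simp add: Xs Ys fI)
    show "\<epsilon>t = mcell ?c \<cdot> ?r" using k(2) by simp
    have 1: "\<ll> X \<cdot> (\<epsilon>t \<odot> \<one> X) \<cdot> inv2 (\<aa> X Y X) \<cdot> (\<one> X \<odot> \<one> (Y \<otimes> X)) = biadj_ract B X Y \<epsilon>t"
      by (rule strict_eqI[OF _ rX, of _ "W [] Et [X]"], rule rep_cong,
          ((rule r2 rep_rules | (simp add: t; fail))+))
        (use W_idc[of a "[]" a "[Y, X]" a "[X]" b] t EX in \<open>auto simp: strict_norm\<close>)
    have 2: "\<rr> Y \<cdot> (\<one> Y \<odot> \<epsilon>t) \<cdot> \<aa> Y X Y \<cdot> (\<one> (Y \<otimes> X) \<odot> \<one> Y) = biadj_lact B X Y \<epsilon>t"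
      by (rule strict_eqI[OF _ lY, of _ "W [Y] Et []"], rule rep_cong,
          ((rule r2 rep_rules | (simp add: t; fail))+))
        (use W_idc[of b "[Y]" a "[Y, X]" a "[]" a] t EX in \<open>auto simp: strict_norm\<close>)
    show "lact ?X \<cdot> (\<epsilon>t \<odot> \<one> (bcar ?X)) \<cdot> inv2 (\<aa> (bcar ?X) (bcar ?Y) (bcar ?X))
        \<cdot> (\<one> (bcar ?X) \<odot> \<one> (Y \<otimes> X)) = ract ?X \<and>
      ract ?Y \<cdot> (\<one> (bcar ?Y) \<odot> \<epsilon>t) \<cdot> \<aa> (bcar ?Y) (bcar ?X) (bcar ?Y) \<cdot> (\<one> (Y \<otimes> X) \<odot> \<one> (bcar ?Y))
          = lact ?Y"
      unfolding Xs Ys using 1 2 by simp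
  qed
  then show ?thesis using ui ci unfolding adjoint_equivalence_def by blast
qed

subsection \<open>From equivalences to biadjunctions\<close>

lemma equivalence_split_biadj:
  assumes eq: "adjoint_equivalence Eq (a, A) (b, unit_frob B b) X' Y' u c"
  defines "X \<equiv> bcar X'" and "Y \<equiv> bcar Y'"
  shows "\<exists>\<epsilon> \<eta> \<epsilon>t \<eta>t. adjunction B b a Y X \<eta> \<epsilon> \<and> adjunction B a b X Y \<eta>t \<epsilon>t \<and> \<epsilon>t \<cdot> \<eta> = \<one> (\<I> b) \<and>
     (\<exists>f. frobenius_iso B A (biadj_frob B X Y \<epsilon> \<eta> \<epsilon>t \<eta>t) f)"
proof -
  let ?o = "(b, unit_frob B b)" and ?p = "(a, A)" and ?A = "fcar A"
  have adj: "adjunction Eq ?p ?o X' Y' u c" and iso: "iso2 Eq u" "iso2 Eq c"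
    using eq unfolding adjoint_equivalence_def by blast+
  have X: "bim X'" "bsrc X' = ?p" "btrg X' = ?o" and Y: "bim Y'" "bsrc Y' = ?o" "btrg Y' = ?p"
    and u: "u \<in> hom2 Eq (bunit ?p) (bcomp B Y' X')" and c: "c \<in> hom2 Eq (bcomp B X' Y') (bunit ?o)"
    using adj unfolding adjunction_def hom1_Eq by (simp_all add: Eq_sel)
  have ok: "comp_ok Y' X'" "comp_ok X' Y'" unfolding comp_ok_def using X Y by simp_all
  have op: "obj ?p" "obj ?o" using bim_typ(4,5)[OF X(1)] X by simp_all
  have t: "X \<in> Mor B" "Y \<in> Mor B" "src B X = a" "trg B X = b" "src B Y = b" "trg B Y = a"
    "?A \<in> Mor B" "src B ?A = a" "trg B ?A = a" "a \<in> Obj B" "b \<in> Obj B"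
    using bim_typ[OF X(1)] bim_typ[OF Y(1)] X Y obj_typ[OF op(1)] obj_typ[OF op(2)]
        by (simp_all add: X_def Y_def)
  have fI: "fcar (unit_frob B b) = \<I> b" by (simp add: unit_frob_def)
  let ?T = "bcar_comp B Y' X'" and ?R = "bcar_comp B X' Y'"
  have TR: "?T \<in> Mor B" "?R \<in> Mor B" "src B ?T = a" "trg B ?T = a" "src B ?R = b" "trg B ?R = b"
    using bcar_comp_typ[OF ok(1)] bcar_comp_typ[OF ok(2)] X Y by simp_all
  have um: "bimodule_map B (bunit ?p) (bcomp B Y' X') (mcell u)"
    and cm: "bimodule_map B (bcomp B X' Y') (bunit ?o) (mcell c)"
    using u c by (simp_all add: hom2_Eq)
  have uh: "mcell u \<in> hom2 B ?A ?T" using bimodule_map_hom2[OF um] by simp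
  have ch: "mcell c \<in> hom2 B ?R (\<I> b)" using bimodule_map_hom2[OF cm] by (simp add: fI)
  obtain gu where "inverse2 Eq u gu" using iso(1) by (auto simp: iso2_def)
  then have ui: "inverse2 B (mcell u) (mcell gu)" by (rule inverse2_EqD)
  obtain gc where "inverse2 Eq c gc" using iso(2) by (auto simp: iso2_def)
  then have ci: "inverse2 B (mcell c) (mcell gc)" by (rule inverse2_EqD)
  have gu: "mcell gu \<in> hom2 B ?T ?A" "mcell gu \<cdot> mcell u = \<one> ?A" "mcell u \<cdot> mcell gu = \<one> ?T"
    and gc: "mcell gc \<in> hom2 B (\<I> b) ?R" "mcell gc \<cdot> mcell c = \<one> ?R" "mcell c \<cdot> mcell gc = \<one> (\<I> b)"
    using ui ci uh ch by (auto simp: inverse2_def hom2_def)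
  let ?q = "bproj B Y' X'" and ?s = "bsec Y' X'" and ?r = "bproj B X' Y'" and ?v = "bsec X' Y'"
  note q = bproj_universal(1)[OF ok(1), folded X_def Y_def] bsec_props[OF ok(1), folded X_def Y_def]
  note r = bproj_universal(1)[OF ok(2), folded X_def Y_def] bsec_props[OF ok(2), folded X_def Y_def]
  have sq: "?s \<cdot> ?q = \<one> (Y \<otimes> X)"
    using unit_bproj_inverse[OF ok(1) X(3)] q(1) by (auto simp: inverse2_def hom2_def)
  \<comment> \<open>\<open>Y\<close> and \<open>X\<close> are multiplied over \<open>\<I> b\<close>,
    where the section inverts the projection. Hence \<open>f\<close> is invertible, with
    \<open>g\<close> as its inverse.\<close>
  define f where "f = ?s \<cdot> mcell u"
  define g where "g = mcell gu \<cdot> ?q"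
  define \<epsilon>t where "\<epsilon>t = mcell c \<cdot> ?r"
  \<comment> \<open>Over \<open>A\<close> the projection \<open>?r\<close> is merely split, so its
    section takes the place of an inverse. This yields both
    \<open>\<epsilon>t \<cdot> \<eta> = \<one> (\<I> b)\<close> and
    \<open>\<eta> \<cdot> \<epsilon>t = bidem X' Y'\<close>.\<close>
  define \<eta> where "\<eta> = ?v \<cdot> mcell gc"
  \<comment> \<open>Unit and counit of \<open>A\<close> are transported along \<open>f\<close>, as
    compatibility with a Frobenius isomorphism demands.\<close>
  define \<eta>t where "\<eta>t = f \<cdot> unit A"
  define \<epsilon> where "\<epsilon> = counit A \<cdot> g"
  have f: "f \<in> hom2 B ?A (Y \<otimes> X)" unfolding f_def by (rule vcomp_in[OF uh q(2)])
  have g: "g \<in> hom2 B (Y \<otimes> X) ?A" unfolding g_def by (rule vcomp_in[OF q(1) gu(1)])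
  have et: "\<epsilon>t \<in> hom2 B (X \<otimes> Y) (\<I> b)" unfolding \<epsilon>t_def by (rule vcomp_in[OF r(1) ch])
  have h: "\<eta> \<in> hom2 B (\<I> b) (X \<otimes> Y)" unfolding \<eta>_def by (rule vcomp_in[OF gc(1) r(2)])
  have uf: "mcell u = ?q \<cdot> f"
    unfolding f_def using vcomp_assoc[OF uh q(2) q(1)] q(4) ident_vcomp[OF uh] by simp
  have gf: "g \<cdot> f = \<one> ?A"
    unfolding g_def using vcomp_assoc[OF f q(1) gu(1)] uf gu(2) by simp
  have fg: "f \<cdot> g = \<one> (Y \<otimes> X)"
  proof -
    have "f \<cdot> g = ?s \<cdot> (mcell u \<cdot> g)" unfolding f_def by (rule vcomp_assoc[OF g uh q(2)])
    also have "mcell u \<cdot> g = ?q"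
      unfolding g_def using vcomp_assoc[OF q(1) gu(1) uh] gu(3) ident_vcomp[OF q(1)] by simp
    finally show ?thesis using sq by simp
  qed
  have eh: "\<epsilon>t \<cdot> \<eta> = \<one> (\<I> b)"
  proof -
    have "\<epsilon>t \<cdot> \<eta> = mcell c \<cdot> (?r \<cdot> \<eta>)" unfolding \<epsilon>t_def by (rule vcomp_assoc[OF h r(1) ch])
    also have "?r \<cdot> \<eta> = mcell gc"
      unfolding \<eta>_def using vcomp_assoc[OF gc(1) r(2) r(1)] r(4) ident_vcomp[OF gc(1)] by simp
    finally show ?thesis using gc(3) by simp
  qed
  have he: "\<eta> \<cdot> \<epsilon>t = bidem X' Y'"
  proof -
    have "\<eta> \<cdot> \<epsilon>t = ?v \<cdot> (mcell gc \<cdot> \<epsilon>t)" unfolding \<eta>_def by (rule vcomp_assoc[OF et gc(1) r(2)])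
    also have "mcell gc \<cdot> \<epsilon>t = ?r"
      unfolding \<epsilon>t_def using vcomp_assoc[OF r(1) ch gc(1)] gc(2) ident_vcomp[OF r(1)] by simp
    finally show ?thesis using r(3) by simp
  qed
  have z: "lact X' \<cdot> (\<epsilon>t \<odot> \<one> X) \<cdot> inv2 (\<aa> X Y X) \<cdot> (\<one> X \<odot> f) = ract X'"
    "ract Y' \<cdot> (\<one> Y \<odot> \<epsilon>t) \<cdot> \<aa> Y X Y \<cdot> (f \<odot> \<one> Y) = lact Y'"
    using Eq_adjunction_iff[OF X Y u c, of f \<epsilon>t, folded X_def Y_def, THEN iffD1] f uf et \<epsilon>t_def adj
        by (simp_all add: fI)
  note lX = unit_act(1)[OF X(1,3), folded X_def] and rY = unit_act(2)[OF Y(1,2), folded Y_def]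

  let ?YX = "Nd (Lf Y) (Lf X)"
  define sf where "sf = S (Lf ?A) ?YX f"
  define sg where "sg = S ?YX (Lf ?A) g"
  define Et where "Et = S (Nd (Lf X) (Lf Y)) (Em b) \<epsilon>t"
  define H where "H = S (Em b) (Nd (Lf X) (Lf Y)) \<eta>"
  define M where "M = sM ?p" define U where "U = sU ?p" define D where "D = sD ?p" define C where
      "C = sC ?p"
  define rX where "rX = sR X'" define lY where "lY = sL Y'"
  define E where "E = sE X' Y'"
  have rep0: "rep (Lf ?A) ?YX f sf" "rep ?YX (Lf ?A) g sg" "rep (Nd (Lf X) (Lf Y)) (Em b) \<epsilon>t Et"
      "rep (Em b) (Nd (Lf X) (Lf Y)) \<eta> H"
    unfolding sf_def sg_def Et_def H_def using f g et h t by (intro rep_prim; simp)+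
  note repA = obj_rep[OF op(1), folded M_def U_def D_def C_def, unfolded snd_conv fst_conv]
  note repX = bim_rep(2)[OF X(1), folded X_def rX_def, unfolded X(2) snd_conv]
      and repY = bim_rep(1)[OF Y(1), folded Y_def lY_def, unfolded Y(3) snd_conv]
  note repE = sE_rep(1)[OF ok(2), folded X_def Y_def E_def]
  note V = rep0[THEN rep_valid] repA[THEN rep_valid] repX[THEN rep_valid] repY[THEN rep_valid]
  have dc: "dm sf = [?A]" "cd sf = [Y, X]" "dm sg = [Y, X]" "cd sg = [?A]" "dm Et = [X, Y]"
      "cd Et = []" "dm H = []" "cd H = [X, Y]"
    "dm M = [?A, ?A]" "cd M = [?A]" "dm U = []" "cd U = [?A]" "dm D = [?A]" "cd D = [?A, ?A]"
        "dm C = [?A]" "cd C = []"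
    "dm rX = [X, ?A]" "cd rX = [X]" "dm lY = [?A, Y]" "cd lY = [Y]"
    using X Y by (simp_all add: sf_def sg_def Et_def H_def M_def U_def D_def C_def rX_def lY_def X_def
        Y_def)
  have ib: "rep (Em b) (Em b) (\<one> (\<I> b)) (idc [] b)" by (rule rep_cong[OF rep_ident]) (simp_all add: t)
  have iA: "rep (Lf ?A) (Lf ?A) (\<one> ?A) (idc [?A] a)" by (rule rep_cong[OF rep_ident]) (simp_all add: t)
  have iYX: "rep ?YX ?YX (\<one> (Y \<otimes> X)) (idc [Y, X] a)" by (rule rep_cong[OF rep_ident]) (simp_all add: t)
  have EH: "W w Et v \<star> W w H v = W w (idc [] b) v" for w v
    using strict_eqD[OF eh rep_comp[OF rep0(4,3)] ib, of w v] by (simp only: strict_norm)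
  have HE: "W w H v \<star> W w Et v = W w E v" for w v
    using strict_eqD[OF he rep_comp[OF rep0(3,4)] repE, of w v] by (simp only: strict_norm)
  have GF: "W w sg v \<star> W w sf v = W w (idc [?A] a) v" for w v
    using strict_eqD[OF gf rep_comp[OF rep0(1,2)] iA, of w v] by (simp only: strict_norm)
  have FG: "W w sf v \<star> W w sg v = W w (idc [Y, X] a) v" for w v
    using strict_eqD[OF fg rep_comp[OF rep0(2,1)] iYX, of w v] by (simp only: strict_norm)
  have k1: "W w rX v = W w Et (X # v) \<star> W (X # w) sf v" for w v
  proof -
    have "rep (Nd (Lf X) (Lf ?A)) (Lf X) (lact X' \<cdot> (\<epsilon>t \<odot> \<one> X) \<cdot> inv2 (\<aa> X Y X) \<cdot> (\<one> X \<odot> f))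
        (W [] Et [X] \<star> W [X] sf [])"
      unfolding lX by (rule rep_cong, ((rule rep0 rep_rules | (simp add: t; fail))+))
    from strict_eqD[OF z(1) this repX, of w v] show ?thesis by (simp only: strict_norm)
  qed
  have k2: "W w lY v = W (Y # w) Et v \<star> W w sf (Y # v)" for w v
  proof -
    have "rep (Nd (Lf ?A) (Lf Y)) (Lf Y) (ract Y' \<cdot> (\<one> Y \<odot> \<epsilon>t) \<cdot> \<aa> Y X Y \<cdot> (f \<odot> \<one> Y))
        (W [Y] Et [] \<star> W [] sf [Y])"
      unfolding rY by (rule rep_cong, ((rule rep0 rep_rules | (simp add: t; fail))+))
    from strict_eqD[OF z(2) this repY, of w v] show ?thesis by (simp only: strict_norm)
  qed
  \<comment> \<open>\<open>u\<close> is a bimodule map and the projection is invertible; so already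
    \<open>f\<close> turns multiplication into the left action on \<open>Y\<close> and into the
    right action on \<open>X\<close>.\<close>
  have fM: "W w sf v \<star> W w M v = W w lY (X # v) \<star> W (?A # w) sf v"
    "W w sf v \<star> W w M v = W (Y # w) rX v \<star> W w sf (?A # v)" for w v
  proof -
    let ?Q = "sQ Y' X'" and ?SS = "sS Y' X'"
    have uQ: "W w (S (Lf ?A) (Lf ?T) (mcell u)) v = W w ?Q v \<star> W w sf v" for w v
      using strict_eqD[OF uf _ rep_comp[OF rep0(1) Q_rep(1)[OF ok(1), folded X_def Y_def]], of
          "S (Lf ?A) (Lf ?T) (mcell u)" w v]
        rep_prim[of "Lf ?A" "Lf ?T" "mcell u"] uh t TR by (simp add: strict_norm del: W_unit)
    have SQ1: "W w ?SS v \<star> W w ?Q v = W w (idc [Y, X] a) v" for w v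
      using strict_eqD[OF sq rep_comp[OF Q_rep[OF ok(1), folded X_def Y_def]] iYX, of w v]
          by (simp only: strict_norm)
    have iYXr: "W w (idc [Y, X] a) v \<star> W w' K v' = W w' K v'" if "valid K"
        "rev w @ Y # X # v = rev w' @ cd K @ v'" for w v w' v' K
    proof -
      have "idc [Y, X] a = W [] (idc [Y] b) [X]"
        using W_idc[of a "[X]" b "[Y]" a "[]" a] t by simp
      then show ?thesis using idc_left[of Y b K w "X # v" w' v'] that t by (simp only: strict_norm)
    qed
    note m = bimodule_map_strict[OF bim_bunit[OF op(1)] bim_bcomp[OF ok(1)] um, unfolded bunit_sel
        bcomp_sel snd_conv, folded M_def]
    note a1 = bcomp_act[OF ok(1), unfolded X Y snd_conv, folded X_def Y_def lY_def rX_def]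
    have 1: "W w ?Q v \<star> W w sf v \<star> W w M v = W w ?Q v \<star> W w lY (X # v) \<star> W (?A # w) sf v"
      using m(1)[of w v, unfolded uQ] by (simp only: scomp_assoc scomp_ctx[OF a1(1)])
    have 2: "W w ?Q v \<star> W w sf v \<star> W w M v = W w ?Q v \<star> W (Y # w) rX v \<star> W w sf (?A # v)"
      using m(2)[of w v, unfolded uQ] by (simp only: scomp_assoc scomp_ctx[OF a1(2)])
    have "W w sf v \<star> W w M v = W w ?SS v \<star> (W w ?Q v \<star> W w sf v \<star> W w M v)"
      using V dc by (simp only: scomp_ctx[OF SQ1] scomp_ctx[OF iYXr] append.simps)
    also have "\<dots> = W w lY (X # v) \<star> W (?A # w) sf v"
      unfolding 1 using V dc by (simp only: scomp_ctx[OF SQ1] scomp_ctx[OF iYXr] append.simps)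
    finally show "W w sf v \<star> W w M v = W w lY (X # v) \<star> W (?A # w) sf v" .
    have "W w sf v \<star> W w M v = W w ?SS v \<star> (W w ?Q v \<star> W w sf v \<star> W w M v)"
      using V dc by (simp only: scomp_ctx[OF SQ1] scomp_ctx[OF iYXr] append.simps)
    also have "\<dots> = W (Y # w) rX v \<star> W w sf (?A # v)"
      unfolding 2 using V dc by (subst scomp_ctx[OF SQ1], subst scomp_ctx[OF iYXr]) simp_all
    finally show "W w sf v \<star> W w M v = W (Y # w) rX v \<star> W w sf (?A # v)" .
  qed
  have rU: "W w rX v \<star> W (X # w) U v = W w (idc [X] a) v" for w v
    using whisker_eq[OF R_unit[OF X(1)], of w v] X
        by (simp add: strict_norm rX_def U_def X_def del: W_unit)
  have lU: "W w lY v \<star> W w U (Y # v) = W w (idc [Y] b) v" for w v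
    using whisker_eq[OF L_unit[OF Y(1)], of w v] Y
        by (simp add: strict_norm lY_def U_def Y_def del: W_unit)
  have MDi: "W w M v \<star> W w D v = W w (idc [?A] a) v" for w v
    using whisker_eq[OF MD[OF op(1)], of w v] by (simp add: M_def D_def)
  have CD: "W w C (?A # v) \<star> W w D v = W w (idc [?A] a) v"
      "W (?A # w) C v \<star> W w D v = W w (idc [?A] a) v" for w v
    using whisker_eq[OF D_counit(1)[OF op(1)], of w v] whisker_eq[OF D_counit(2)[OF op(1)], of w v]
        by (simp_all add: strict_norm C_def D_def del: W_unit)
  have fr: "W (?A # w) M v \<star> W w D (?A # v) = W w D v \<star> W w M v"
      "W w M (?A # v) \<star> W (?A # w) D v = W w D v \<star> W w M v" for w v
    using whisker_eq[OF frob(1)[OF op(1)], of w v] whisker_eq[OF frob(2)[OF op(1)], of w v]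
        by (simp_all add: strict_norm M_def D_def del: W_unit)
  have iYX1: "W w (idc [Y, X] a) v = W w (idc [Y] b) (X # v)" for w v
  proof -
    have "idc [Y, X] a = W [] (idc [Y] b) [X]"
      using W_idc[of a "[X]" b "[Y]" a "[]" a] t by simp
    then show ?thesis by (simp only: strict_norm)
  qed
  define d where "d = sDU ?p"
  have Vd: "valid d" "dm d = []" "cd d = [?A, ?A]" using op(1) by (simp_all add: d_def)
  note dM = sDU_M(2)[OF op(1), folded d_def M_def D_def, unfolded snd_conv]
  have Eexp: "W w E v = W w rX (Y # v) \<star> W (?A # X # w) lY v \<star> W (X # w) d (Y # v)" for w v
    using sE_expand[OF ok(2), of w v] X Y by (simp add: E_def X_def Y_def rX_def lY_def d_def)
  have ff: "W w sf (Y # X # v) \<star> W (?A # w) sf v = W (X # Y # w) sf v \<star> W w sf (?A # v)" for w v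
    using whisker_exchange[of sf sf w "[]" v] V dc by simp
  \<comment> \<open>Expressing the right action through \<open>\<epsilon>t\<close> by
    \<open>k1\<close> makes right linearity of \<open>f\<close> the multiplicativity of
    \<open>f\<close> for the product on \<open>Y \<otimes> X\<close>.\<close>
  have fm: "W w sf v \<star> W w M v = W (Y # w) Et (X # v) \<star> W w sf (Y # X # v) \<star> W (?A # w) sf v" for w v
    by (simp only: fM(2) k1 scomp_assoc ff)
  \<comment> \<open>The idempotent is given by actions and the separability element. On the image of
    \<open>f \<odot> f\<close> the actions become multiplications by \<open>fM\<close>; centrality
    merges one leg into a comultiplication, and the Frobenius relation produces the comultiplication
    after the multiplication.\<close>
  have Eff: "W (Y # w) E (X # v) \<star> W w sf (Y # X # v) \<star> W (?A # w) sf v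
    = W w sf (Y # X # v) \<star> W (?A # w) sf v \<star> W w D v \<star> W w M v" for w v
  proof -
    have x1: "W (X # Y # w) d v \<star> W w sf v = W w sf (?A # ?A # v) \<star> W (?A # w) d v" for w v
      using whisker_exchange[of sf d w "[]" v] V Vd dc by simp
    have x2: "W w d (Y # X # v) \<star> W w sf v = W (?A # ?A # w) sf v \<star> W w d (?A # v)" for w v
      using whisker_exchange[of d sf w "[]" v] V Vd dc by simp
    have x3: "W (?A # X # Y # w) lY v \<star> W w sf (?A # ?A # Y # v)
        = W w sf (?A # Y # v) \<star> W (?A # ?A # w) lY v" for w v
      using whisker_exchange[of sf lY w "[?A]" v] V dc by simp
    have x4: "W w M (Y # X # v) \<star> W (?A # ?A # w) sf v = W (?A # w) sf v \<star> W w M (?A # v)" for w v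
      using whisker_exchange[of M sf w "[]" v] V dc by simp
    have "W (Y # w) E (X # v) \<star> W w sf (Y # X # v) \<star> W (?A # w) sf v
      = W (Y # w) rX (Y # X # v) \<star> W (?A # X # Y # w) lY (X # v) \<star> W w sf (?A # ?A # Y # X # v) \<star> W
          (?A # w) d (Y # X # v) \<star> W (?A # w) sf v"
      by (simp only: Eexp scomp_assoc scomp_ctx[OF x1])
    also have "\<dots> = W (Y # w) rX (Y # X # v) \<star> W w sf (?A # Y # X # v) \<star> W (?A # ?A # w) lY (X # v)
        \<star> W (?A # ?A # ?A # w) sf v \<star> W (?A # w) d (?A # v)"
      by (simp only: x2 scomp_ctx[OF x3] scomp_assoc)
    also have "\<dots> = W w sf (Y # X # v) \<star> W w M (Y # X # v) \<star> W (?A # ?A # w) sf v \<star> W (?A # ?A # w) M v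
        \<star> W (?A # w) d (?A # v)"
      by (simp only: scomp_ctx[OF fM(2)[symmetric]] scomp_ctx[OF fM(1)[symmetric]] scomp_assoc)
    also have "\<dots> = W w sf (Y # X # v) \<star> W (?A # w) sf v \<star> W w D v \<star> W w M v"
      by (simp only: dM scomp_ctx[OF x4] scomp_assoc fr)
    finally show ?thesis .
  qed
  \<comment> \<open>By \<open>fm\<close> and \<open>HE\<close> the equation holds after a
    multiplication, by \<open>Eff\<close>. Separability makes \<open>D\<close> a section of
    \<open>M\<close>, which removes the multiplication.\<close>
  have fD: "W (Y # w) H (X # v) \<star> W w sf v = W w sf (Y # X # v) \<star> W (?A # w) sf v \<star> W w D v" for w v
  proof -
    have e: "W (Y # w) H (X # v) \<star> W w sf v \<star> W w M v
        = W w sf (Y # X # v) \<star> W (?A # w) sf v \<star> W w D v \<star> W w M v"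
      unfolding fm by (simp only: scomp_ctx[OF HE] Eff)
    have "W w sf v \<star> W w (idc [?A] a) v = W w sf v" "W w D v \<star> W w (idc [?A] a) v = W w D v"
      by (rule idc_right; simp add: t V dc)+
    then show ?thesis
      using arg_cong[OF e, of "\<lambda>K. K \<star> W w D v"] by (simp only: scomp_assoc MDi)
  qed
  have FG1: "W w sf v \<star> W w sg v = W w (idc [Y] b) (X # v)" for w v by (simp only: FG iYX1)
  have FG2: "W (Y # w) H (X # v) \<star> W w sf v \<star> W w sg v = W (Y # w) H (X # v)" for w v
    unfolding FG1 by (rule idc_right) (simp_all add: t V dc)
  have ra: "rep (Em a) ?YX \<eta>t (sf \<star> U)" unfolding \<eta>t_def by (rule rep_comp[OF repA(2) rep0(1)])
  have re: "rep ?YX (Em a) \<epsilon> (C \<star> sg)" unfolding \<epsilon>_def by (rule rep_comp[OF rep0(2) repA(4)])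
  have XY: "X \<in> hom1 B a b" "Y \<in> hom1 B b a" using t by (simp_all add: hom1_def)
  have adj1: "adjunction B a b X Y \<eta>t \<epsilon>t"
  proof (rule adjunction_iff[OF ra rep0(3) XY, THEN iffD2])
    have "W [] Et [X] \<star> W [X] (sf \<star> U) [] = W [] rX [] \<star> W [X] U []"
      by (simp only: strict_norm k1)
    moreover have "W [Y] Et [] \<star> W [] (sf \<star> U) [Y] = W [] lY [] \<star> W [] U [Y]"
      by (simp only: strict_norm k2)
    ultimately show "W [] Et [X] \<star> W [X] (sf \<star> U) [] = idc [X] a \<and> W [Y] Et [] \<star> W [] (sf \<star> U) [Y]
        = idc [Y] b"
      using rU[of "[]" "[]"] lU[of "[]" "[]"] t by simp
  qed
  let ?zY = "W [] (C \<star> sg) [Y] \<star> W [Y] H []" and ?zX = "W [X] (C \<star> sg) [] \<star> W [] H [X]"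
  have rzY: "rep (Nd (Lf Y) (Em b)) (Lf Y) (\<ll> Y \<cdot> (\<epsilon> \<odot> \<one> Y) \<cdot> inv2 (\<aa> Y X Y) \<cdot> (\<one> Y \<odot> \<eta>)) ?zY"
    by (rule rep_cong, ((rule re rep0 rep_rules | (simp add: t; fail))+))
  have rzX: "rep (Nd (Em b) (Lf X)) (Lf X) (\<rr> X \<cdot> (\<one> X \<odot> \<epsilon>) \<cdot> \<aa> X Y X \<cdot> (\<eta> \<odot> \<one> X)) ?zX"
    by (rule rep_cong, ((rule re rep0 rep_rules | (simp add: t; fail))+))
  have zd: "dm ?zY = [Y]" "cd ?zY = [Y]" "dm ?zX = [X]" "cd ?zX = [X]"
    using repD(4)[OF rzY] repD(4)[OF rzX] by simp_all
  \<comment> \<open>Next to a strand \<open>X\<close>, an inserted pair \<open>f\<close>,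
    \<open>g\<close> lets \<open>fD\<close> replace \<open>\<eta>\<close> by the comultiplication of
    \<open>A\<close>. Then \<open>g\<close> cancels against \<open>f\<close>, and counitality
    removes the comultiplication.\<close>
  have zY1: "W w ?zY (X # v) = W w (idc [Y] b) (X # v)" for w v
  proof -
    have x: "W w C (Y # X # v) \<star> W (?A # w) sf v = W w sf v \<star> W w C (?A # v)" for w v
      using whisker_exchange[of C sf w "[]" v] V dc by simp
    have g1: "W w sg (Y # X # v) \<star> W w sf (Y # X # v) \<star> W (?A # w) sf v = W (?A # w) sf v" for w v
      unfolding scomp_ctx[OF GF] by (rule idc_left) (simp_all add: t V dc)
    have g2: "W w (idc [?A] a) v \<star> W w sg v = W w sg v" for w v
      by (rule idc_left) (simp_all add: t V dc)
    have "W w ?zY (X # v) = W w C (Y # X # v) \<star> W w sg (Y # X # v) \<star> W (Y # w) H (X # v) \<star> W w sf v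
        \<star> W w sg v"
      by (simp only: strict_norm FG2)
    also have "\<dots> = W w C (Y # X # v) \<star> (W w sg (Y # X # v) \<star> W w sf (Y # X # v) \<star> W (?A # w) sf v)
        \<star> W w D v \<star> W w sg v"
      by (simp only: scomp_ctx[OF fD] scomp_assoc)
    also have "\<dots> = W w sf v \<star> W w C (?A # v) \<star> W w D v \<star> W w sg v"
      by (simp only: g1 scomp_ctx[OF x] scomp_assoc)
    also have "\<dots> = W w sf v \<star> W w sg v"
      by (simp only: scomp_ctx[OF CD(1)] g2)
    finally show ?thesis by (simp only: FG1)
  qed
  have zX1: "W (Y # w) ?zX v = W w (idc [Y] b) (X # v)" for w v
  proof -
    have x: "W (X # Y # w) C v \<star> W w sf (?A # v) = W w sf v \<star> W (?A # w) C v" for w v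
      using whisker_exchange[of sf C w "[]" v] V dc by simp
    have g1: "W (X # Y # w) sg v \<star> W (X # Y # w) sf v \<star> W w sf (?A # v) = W w sf (?A # v)" for w v
      unfolding scomp_ctx[OF GF] by (rule idc_left) (simp_all add: t V dc)
    have g2: "W w (idc [?A] a) v \<star> W w sg v = W w sg v" for w v
      by (rule idc_left) (simp_all add: t V dc)
    have "W (Y # w) ?zX v = W (X # Y # w) C v \<star> W (X # Y # w) sg v \<star> W (Y # w) H (X # v) \<star> W w sf v
        \<star> W w sg v"
      by (simp only: strict_norm FG2)
    also have "\<dots> = W (X # Y # w) C v \<star> (W (X # Y # w) sg v \<star> W (X # Y # w) sf v \<star> W w sf (?A # v))
        \<star> W w D v \<star> W w sg v"
      by (simp only: scomp_ctx[OF fD] scomp_assoc) (simp only: scomp_ctx[OF ff] scomp_assoc)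
    also have "\<dots> = W w sf v \<star> W (?A # w) C v \<star> W w D v \<star> W w sg v"
      by (simp only: g1 scomp_ctx[OF x] scomp_assoc)
    also have "\<dots> = W w sf v \<star> W w sg v"
      by (simp only: scomp_ctx[OF CD(2)] g2)
    finally show ?thesis by (simp only: FG1)
  qed
  have zY: "?zY = idc [Y] b"
  proof -
    \<comment> \<open>Interchange carries the zigzag below \<open>W [Y] Et []\<close>, where the
      strand \<open>X\<close> required by \<open>zY1\<close> is present. \<open>W [Y] Et []\<close>
      can be cancelled again because \<open>H\<close> splits it.\<close>
    have x: "W [] ?zY [] \<star> W [Y] Et [] = W [Y] Et [] \<star> W [] ?zY [X, Y]"
      using whisker_exchange[of ?zY Et "[]" "[]" "[]"] rep_valid[OF rzY] zd V dc by simp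
    have i: "W [Y] (idc [] b) [] = W [] (idc [Y] b) []" using W_idc_Nil(2)[of Y b "[]" "[]"] t by simp
    have "W [] ?zY [] = W [] ?zY [] \<star> W [Y] (idc [] b) []"
      unfolding i by (rule idc_right[symmetric]) (use rep_valid[OF rzY] zd t in simp_all)
    also have "\<dots> = (W [] ?zY [] \<star> W [Y] Et []) \<star> W [Y] H []" by (simp only: EH scomp_assoc)
    also have "\<dots> = W [Y] Et [] \<star> W [] (idc [Y] b) [X, Y] \<star> W [Y] H []" by (simp only: x zY1 scomp_assoc)
    also have "W [] (idc [Y] b) [X, Y] \<star> W [Y] H [] = W [Y] H []"
        by (rule idc_left) (simp_all add: t V dc)
    finally have "W [] ?zY [] = W [] (idc [Y] b) []" by (simp only: EH i)
    then show ?thesis using rep_valid[OF rzY] t by simp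
  qed
  have zX: "?zX = idc [X] a"
  proof -
    \<comment> \<open>The mirror image: below \<open>W [] Et [X]\<close> the zigzag has the strand
      \<open>Y\<close> on its left, as \<open>zX1\<close> requires.\<close>
    have x: "W [] ?zX [] \<star> W [] Et [X] = W [] Et [X] \<star> W [Y, X] ?zX []"
      using whisker_exchange[of Et ?zX "[]" "[]" "[]"] rep_valid[OF rzX] zd V dc by simp
    have i: "W [] (idc [] b) [X] = W [] (idc [X] a) []" using W_idc_Nil(1)[of X b "[]" "[]"] t by simp
    have "W [] ?zX [] = W [] ?zX [] \<star> W [] (idc [] b) [X]"
      unfolding i by (rule idc_right[symmetric]) (use rep_valid[OF rzX] zd t in simp_all)
    also have "\<dots> = (W [] ?zX [] \<star> W [] Et [X]) \<star> W [] H [X]" by (simp only: EH scomp_assoc)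
    also have "\<dots> = W [] Et [X] \<star> W [X] (idc [Y] b) [X] \<star> W [] H [X]" by (simp only: x zX1 scomp_assoc)
    also have "W [X] (idc [Y] b) [X] \<star> W [] H [X] = W [] H [X]"
        by (rule idc_left) (simp_all add: t V dc)
    finally have "W [] ?zX [] = W [] (idc [X] a) []" by (simp only: EH i)
    then show ?thesis using rep_valid[OF rzX] t by simp
  qed
  have adj2: "adjunction B b a Y X \<eta> \<epsilon>"
    by (rule adjunction_iff[OF rep0(4) re XY(2,1), THEN iffD2]) (use zY zX in simp)
  let ?G = "biadj_frob B X Y \<epsilon> \<eta> \<epsilon>t \<eta>t"
  have rM: "rep (Nd ?YX ?YX) ?YX (mult ?G) (W [Y] Et [X])"
    unfolding biadj_frob_def frob.select_convs
    by (rule rep_cong, ((rule rep0 rep_rules | (simp add: t strict_norm; fail))+))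
  have rD: "rep ?YX (Nd ?YX ?YX) (comult ?G) (W [Y] H [X])"
    unfolding biadj_frob_def frob.select_convs
    by (rule rep_cong, ((rule rep0 rep_rules | (simp add: t strict_norm; fail))+))
  have rff: "rep (Nd (Lf ?A) (Lf ?A)) (Nd ?YX ?YX) (f \<odot> f) (W [] sf [Y, X] \<star> W [?A] sf [])"
    by (rule rep_cong, ((rule rep0 rep_rules | (simp add: t; fail))+))
  have "frobenius_iso B A ?G f"
    unfolding frobenius_iso_def
  proof (intro conjI)
    show "f \<in> hom2 B (fcar A) (fcar ?G)" using f by (simp add: biadj_frob_def)
    show "iso2 B f" using f g gf fg by (intro iso2I[of f g]) (auto simp: hom2_def)
    show "f \<cdot> mult A = mult ?G \<cdot> (f \<odot> f)"
      by (rule strict_eqI[OF rep_comp[OF repA(1) rep0(1)] rep_comp[OF rff rM]])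
          (simp only: strict_norm fm)
    show "f \<cdot> unit A = unit ?G" by (simp add: biadj_frob_def \<eta>t_def)
    show "(f \<odot> f) \<cdot> comult A = comult ?G \<cdot> f"
      by (rule strict_eqI[OF rep_comp[OF repA(3) rff] rep_comp[OF rep0(1) rD]])
          (simp only: strict_norm fD)
    have C: "counit A \<in> hom2 B ?A (\<I> a)" using repD(3)[OF repA(4)] by simp
    show "counit ?G \<cdot> f = counit A"
      using vcomp_assoc[OF f g C] gf vcomp_ident[OF C] by (simp add: biadj_frob_def \<epsilon>_def)
  qed
  then show ?thesis using adj1 adj2 eh by blast
qed

end

theorem proposition4p4:
  fixes B :: "('o, 'f, 'm) bicat" (structure)
    and a b :: 'o and X Y :: 'f
  assumes "bicategory B" and "idempotent_complete B"
    and "a \<in> Obj B" and "b \<in> Obj B"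
    and "X \<in> hom1 B a b" and "Y \<in> hom1 B b a"
  shows
    "(\<forall>\<epsilon> \<eta> \<epsilon>t \<eta>t.
        adjunction B b a Y X \<eta> \<epsilon> \<and> adjunction B a b X Y \<eta>t \<epsilon>t \<and> iso2 B (\<epsilon>t \<cdot> \<eta>) \<longrightarrow>
        (let \<phi> = biadj_phi B X \<eta> \<epsilon>t;
             A = biadj_frob B X Y (\<epsilon> \<cdot> (\<one> Y \<odot> inv2 \<phi>)) ((\<phi> \<odot> \<one> Y) \<cdot> \<eta>) \<epsilon>t \<eta>t
         in \<exists>u c. adjoint_equivalence (equivariant_completion B) (a, A) (b, unit_frob B b)
                (biadj_X B a b A X Y \<epsilon>t) (biadj_Y B a b A X Y \<epsilon>t) u c))
     \<and>
     (\<forall>A X' Y' u c.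
        adjoint_equivalence (equivariant_completion B) (a, A) (b, unit_frob B b) X' Y' u c \<and>
        bcar X' = X \<and> bcar Y' = Y \<longrightarrow>
        (\<exists>\<epsilon> \<eta> \<epsilon>t \<eta>t.
           adjunction B b a Y X \<eta> \<epsilon> \<and> adjunction B a b X Y \<eta>t \<epsilon>t \<and>
           \<epsilon>t \<cdot> \<eta> = \<one> (\<I> b) \<and>
           (\<exists>f. frobenius_iso B A (biadj_frob B X Y \<epsilon> \<eta> \<epsilon>t \<eta>t) f)))"
proof -
  interpret complete_bicategory B
    using assms(1,2) by (simp add: complete_bicategory_def complete_bicategory_axioms_def)
  show ?thesis
  proof (intro conjI allI impI)
    fix \<epsilon> \<eta> \<epsilon>t \<eta>t
    assume h: "adjunction B b a Y X \<eta> \<epsilon> \<and> adjunction B a b X Y \<eta>t \<epsilon>t \<and> iso2 B (\<epsilon>t \<cdot> \<eta>)"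
    then have adj: "adjunction B b a Y X \<eta> \<epsilon>" "adjunction B a b X Y \<eta>t \<epsilon>t" "iso2 B (\<epsilon>t \<cdot> \<eta>)" by blast+
    show "let \<phi> = biadj_phi B X \<eta> \<epsilon>t;
             A = biadj_frob B X Y (\<epsilon> \<cdot> (\<one> Y \<odot> inv2 \<phi>)) ((\<phi> \<odot> \<one> Y) \<cdot> \<eta>) \<epsilon>t \<eta>t
         in \<exists>u c. adjoint_equivalence (equivariant_completion B) (a, A) (b, unit_frob B b)
                (biadj_X B a b A X Y \<epsilon>t) (biadj_Y B a b A X Y \<epsilon>t) u c"
      unfolding Let_def
      by (rule split_biadj_equivalence[OF biadj_normalise(1)[OF adj] adj(2) biadj_normalise(2)[OF adj]])
  next
    fix A X' Y' u c
    assume "adjoint_equivalence (equivariant_completion B) (a, A) (b, unit_frob B b) X' Y' u c \<and>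
      bcar X' = X \<and> bcar Y' = Y"
    then show "\<exists>\<epsilon> \<eta> \<epsilon>t \<eta>t. adjunction B b a Y X \<eta> \<epsilon> \<and> adjunction B a b X Y \<eta>t \<epsilon>t \<and>
        \<epsilon>t \<cdot> \<eta> = \<one> (\<I> b) \<and> (\<exists>f. frobenius_iso B A (biadj_frob B X Y \<epsilon> \<eta> \<epsilon>t \<eta>t) f)"
      using equivalence_split_biadj[of a A b X' Y' u c] by auto
  qed
qed

end
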